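(* Suppose there is a polynomial-time $\alpha_{\mathrm{CFL}}$-approximation algorithm for the capacitated facility location problem. Then, in the setting below, one can in polynomial time find a $4\alpha_{\mathrm{CFL}}$-approximate solution to the TCSD instance $\mathcal{I}^4$.
   Context: Transportation with configurable supplies and demands (TCSD): an instance $(V, d, (R_v)_{v\in V})$ consists of a finite metric space $(V,d)$ and, for each $v\in V$, a finite set $R_v$ of pairs $(g,z)$ with $g\ge 0$, $z\in\mathbb{Z}$. A solution chooses $(g_v,z_v)\in R_v$ for every $v$ with $\sum_v z_v\ge 0$; its cost is $\sum_v g_v + \mathrm{TC}(z)$, where $\mathrm{TC}(z) = \min_\psi\sum_{v,v'}\psi(v,v')d(v,v')$ over $\psi: V\times V\to\mathbb{Z}_{\ge0}$ with $z_v + \sum_{v'}\psi(v',v) - \sum_{v'}\psi(v,v')\ge 0$ for all $v$. An $\alpha$-approximate solution has cost at most $\alpha$ times the minimum. The instance $\mathcal{I}^4$: $\beta\in(1/2,1)$; $(V,d) = (S^\circ, d^2)$ a finite metric with $|S^\circ|\ge 2$ and distinct points at positive distance; for each $v\in S^\circ$ a positive integer $n_v$, $\ell_v = d^2(v, S^\circ\setminus\{v\})$, and a finite set $N_v$ of facilities containing $v$, each $i\in N_v$ having a cost $f^2_i\ge 0$ (with $f^2_v = 0$) and a lower bound $B_i\in\mathbb{Z}_{\ge 0}$; $R_v = \{(\frac{2\beta-1}{2\beta^2}n_v\ell_v,\ n_v)\}\cup\{(f^2_i,\ n_v - B_i): i\in N_v\}$. Capacitated facility location (CFL): given a finite metric,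 suppliers at points with opening costs and integer capacities, and integer amounts of demand at points, open a set of suppliers and assign each unit of demand to an open supplier respecting capacities, minimizing total opening cost plus total distance from demand units to their assigned suppliers. *)

theory Defs
  imports "HOL-Analysis.Analysis" "HOL-Library.Log_Nat"
begin

section \<open>Transportation with configurable supplies and demands\<close>

definition tcsd_instance ::
    "'v set \<Rightarrow> ('v \<Rightarrow> 'v \<Rightarrow> real) \<Rightarrow> ('v \<Rightarrow> (real \<times> int) set) \<Rightarrow> bool" where
  "tcsd_instance V d R \<longleftrightarrow>
     finite V \<and> Metric_space V d \<and> (\<forall>v\<in>V. finite (R v) \<and> (\<forall>(g, z)\<in>R v. 0 \<le> g))"

definition transport_feasible :: "'v set \<Rightarrow> ('v \<Rightarrow> int) \<Rightarrow> ('v \<Rightarrow> 'v \<Rightarrow> nat) \<Rightarrow> bool" where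
  "transport_feasible V z \<psi> \<longleftrightarrow>
     (\<forall>v\<in>V. 0 \<le> z v + (\<Sum>w\<in>V. int (\<psi> w v)) - (\<Sum>w\<in>V. int (\<psi> v w)))"

definition transport_cost :: "'v set \<Rightarrow> ('v \<Rightarrow> 'v \<Rightarrow> real) \<Rightarrow> ('v \<Rightarrow> 'v \<Rightarrow> nat) \<Rightarrow> real" where
  "transport_cost V d \<psi> = (\<Sum>v\<in>V. \<Sum>w\<in>V. real (\<psi> v w) * d v w)"

text \<open>The minima below are written as infima of sets of reals. For finite V these sets contain
  only nonnegative integer combinations of finitely many nonnegative reals (plus one of finitely
  many constants), so the infimum is attained whenever a feasible choice exists. A feasible
  transport exists if and only if the values of z on V have nonnegative sum.\<close>

definition TC :: "'v set \<Rightarrow> ('v \<Rightarrow> 'v \<Rightarrow> real) \<Rightarrow> ('v \<Rightarrow> int) \<Rightarrow> real" where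
  "TC V d z = Inf (transport_cost V d ` {\<psi>. transport_feasible V z \<psi>})"

text \<open>A solution s maps each point v to the chosen pair s v = (g, z).\<close>

definition tcsd_solution ::
    "'v set \<Rightarrow> ('v \<Rightarrow> (real \<times> int) set) \<Rightarrow> ('v \<Rightarrow> real \<times> int) \<Rightarrow> bool" where
  "tcsd_solution V R s \<longleftrightarrow> (\<forall>v\<in>V. s v \<in> R v) \<and> 0 \<le> (\<Sum>v\<in>V. snd (s v))"

definition tcsd_cost ::
    "'v set \<Rightarrow> ('v \<Rightarrow> 'v \<Rightarrow> real) \<Rightarrow> ('v \<Rightarrow> real \<times> int) \<Rightarrow> real" where
  "tcsd_cost V d s = (\<Sum>v\<in>V. fst (s v)) + TC V d (\<lambda>v. snd (s v))"

definition tcsd_opt ::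
    "'v set \<Rightarrow> ('v \<Rightarrow> 'v \<Rightarrow> real) \<Rightarrow> ('v \<Rightarrow> (real \<times> int) set) \<Rightarrow> real" where
  "tcsd_opt V d R = Inf (tcsd_cost V d ` {s. tcsd_solution V R s})"

definition tcsd_approx_solution ::
    "real \<Rightarrow> 'v set \<Rightarrow> ('v \<Rightarrow> 'v \<Rightarrow> real) \<Rightarrow> ('v \<Rightarrow> (real \<times> int) set) \<Rightarrow> ('v \<Rightarrow> real \<times> int) \<Rightarrow> bool" where
  "tcsd_approx_solution \<alpha> V d R s \<longleftrightarrow>
     tcsd_solution V R s \<and> tcsd_cost V d s \<le> \<alpha> * tcsd_opt V d R"


section \<open>The instance \<open>I\<^sup>4\<close>\<close>

text \<open>S is the set of points, n the numbers of clients, N the facility sets, f the facility costs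
  and B the lower bounds. The points of S are themselves facilities.\<close>

definition I4_setting ::
    "real \<Rightarrow> 'v set \<Rightarrow> ('v \<Rightarrow> 'v \<Rightarrow> real) \<Rightarrow> ('v \<Rightarrow> nat) \<Rightarrow> ('v \<Rightarrow> 'v set) \<Rightarrow> ('v \<Rightarrow> real) \<Rightarrow> ('v \<Rightarrow> nat) \<Rightarrow> bool"
  where
  "I4_setting \<beta> S d n N f B \<longleftrightarrow>
     1 / 2 < \<beta> \<and> \<beta> < 1 \<and> finite S \<and> 2 \<le> card S \<and> Metric_space S d \<and>
     (\<forall>v\<in>S. 0 < n v \<and> finite (N v) \<and> v \<in> N v \<and> f v = 0 \<and> (\<forall>i\<in>N v. 0 \<le> f i))"

definition nearest_dist :: "'v set \<Rightarrow> ('v \<Rightarrow> 'v \<Rightarrow> real) \<Rightarrow> 'v \<Rightarrow> real" where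
  "nearest_dist S d v = Min (d v ` (S - {v}))"

definition I4_R ::
    "real \<Rightarrow> 'v set \<Rightarrow> ('v \<Rightarrow> 'v \<Rightarrow> real) \<Rightarrow> ('v \<Rightarrow> nat) \<Rightarrow> ('v \<Rightarrow> 'v set) \<Rightarrow> ('v \<Rightarrow> real) \<Rightarrow> ('v \<Rightarrow> nat) \<Rightarrow>
     'v \<Rightarrow> (real \<times> int) set" where
  "I4_R \<beta> S d n N f B v =
     {((2 * \<beta> - 1) / (2 * \<beta>\<^sup>2) * real (n v) * nearest_dist S d v, int (n v))}
     \<union> {(f i, int (n v) - int (B i)) | i. i \<in> N v}"

lemma I4_tcsd_instance:
  assumes "I4_setting \<beta> S d n N f B"
  shows "tcsd_instance S d (I4_R \<beta> S d n N f B)"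
proof -
  have S: "finite S" "2 \<le> card S" and \<beta>: "1 / 2 < \<beta>" and M: "Metric_space S d"
    and N: "\<And>v. v \<in> S \<Longrightarrow> finite (N v) \<and> (\<forall>i\<in>N v. 0 \<le> f i)"
    using assms by (auto simp: I4_setting_def)
  have near: "0 \<le> nearest_dist S d v" if "v \<in> S" for v
  proof -
    have "card (S - {v}) \<noteq> 0"
      using S that by simp
    then have "S - {v} \<noteq> {}"
      by force
    then show ?thesis
      unfolding nearest_dist_def using S Metric_space.nonneg[OF M] by (subst Min_ge_iff) auto
  qed
  show ?thesis
    unfolding tcsd_instance_def I4_R_def
    using S M N \<beta> near by (auto intro!: mult_nonneg_nonneg divide_nonneg_nonneg)
qed


section \<open>Capacitated facility location\<close>

text \<open>V is the set of points, F the set of suppliers; loc, f and u give the location, opening cost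
  and capacity of a supplier, and dem p is the number of units of demand at p. A solution is a set
  X of open suppliers and an assignment x, where x s p units of the demand at p are assigned to s.\<close>

definition cfl_solution ::
    "'p set \<Rightarrow> 's set \<Rightarrow> ('s \<Rightarrow> nat) \<Rightarrow> ('p \<Rightarrow> nat) \<Rightarrow> 's set \<times> ('s \<Rightarrow> 'p \<Rightarrow> nat) \<Rightarrow> bool" where
  "cfl_solution V F u dem = (\<lambda>(X, x).
     X \<subseteq> F \<and>
     (\<forall>p\<in>V. (\<Sum>s\<in>F. x s p) = dem p) \<and>
     (\<forall>s\<in>X. (\<Sum>p\<in>V. x s p) \<le> u s) \<and>
     (\<forall>s\<in>F - X. \<forall>p\<in>V. x s p = 0))"

definition cfl_cost ::
    "'p set \<Rightarrow> ('p \<Rightarrow> 'p \<Rightarrow> real) \<Rightarrow> 's set \<Rightarrow> ('s \<Rightarrow> 'p) \<Rightarrow> ('s \<Rightarrow> real) \<Rightarrow>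
     's set \<times> ('s \<Rightarrow> 'p \<Rightarrow> nat) \<Rightarrow> real" where
  "cfl_cost V d F loc f = (\<lambda>(X, x).
     (\<Sum>s\<in>X. f s) + (\<Sum>s\<in>F. \<Sum>p\<in>V. real (x s p) * d p (loc s)))"

definition cfl_opt ::
    "'p set \<Rightarrow> ('p \<Rightarrow> 'p \<Rightarrow> real) \<Rightarrow> 's set \<Rightarrow> ('s \<Rightarrow> 'p) \<Rightarrow> ('s \<Rightarrow> real) \<Rightarrow> ('s \<Rightarrow> nat) \<Rightarrow> ('p \<Rightarrow> nat) \<Rightarrow> real"
  where
  "cfl_opt V d F loc f u dem = Inf (cfl_cost V d F loc f ` {Xx. cfl_solution V F u dem Xx})"

definition cfl_approx_solution ::
    "real \<Rightarrow> 'p set \<Rightarrow> ('p \<Rightarrow> 'p \<Rightarrow> real) \<Rightarrow> 's set \<Rightarrow> ('s \<Rightarrow> 'p) \<Rightarrow> ('s \<Rightarrow> real) \<Rightarrow> ('s \<Rightarrow> nat) \<Rightarrow>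
     ('p \<Rightarrow> nat) \<Rightarrow> 's set \<times> ('s \<Rightarrow> 'p \<Rightarrow> nat) \<Rightarrow> bool" where
  "cfl_approx_solution \<alpha> V d F loc f u dem Xx \<longleftrightarrow>
     cfl_solution V F u dem Xx \<and> cfl_cost V d F loc f Xx \<le> \<alpha> * cfl_opt V d F loc f u dem"


section \<open>Random access machines with logarithmic cost\<close>

text \<open>Programs are structured random access machine programs. The memory consists of integer
  arrays, of which a program can mention only finitely many, and every operation is charged the
  binary length of all integers (operands, results and addresses) involved. Polynomial time in
  this model coincides with polynomial time on Turing machines.\<close>

datatype aexp =
    Const int
  | Read nat aexp  \<comment> \<open>\<open>Read a e\<close>: the entry of array \<open>a\<close> at index \<open>e\<close>\<close>
  | Add aexp aexp
  | Sub aexp aexp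
  | Mul aexp aexp
  | Div aexp aexp

datatype prog =
    Nop
  | Write nat aexp aexp  \<comment> \<open>\<open>Write a e e'\<close>: store \<open>e'\<close> in array \<open>a\<close> at index \<open>e\<close>\<close>
  | Seq prog prog
  | Branch aexp prog prog  \<comment> \<open>first alternative iff the value is positive\<close>
  | Loop aexp prog  \<comment> \<open>iterate as long as the value is positive\<close>

type_synonym memory = "nat \<Rightarrow> int \<Rightarrow> int"

definition int_size :: "int \<Rightarrow> nat" where
  "int_size k = 1 + floorlog 2 (nat \<bar>k\<bar>)"

fun aval :: "aexp \<Rightarrow> memory \<Rightarrow> int" where
  "aval (Const k) \<sigma> = k"
| "aval (Read a e) \<sigma> = \<sigma> a (aval e \<sigma>)"
| "aval (Add e e') \<sigma> = aval e \<sigma> + aval e' \<sigma>"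
| "aval (Sub e e') \<sigma> = aval e \<sigma> - aval e' \<sigma>"
| "aval (Mul e e') \<sigma> = aval e \<sigma> * aval e' \<sigma>"
| "aval (Div e e') \<sigma> = aval e \<sigma> div aval e' \<sigma>"

fun atime :: "aexp \<Rightarrow> memory \<Rightarrow> nat" where
  "atime (Const k) \<sigma> = int_size k"
| "atime (Read a e) \<sigma> = atime e \<sigma> + int_size (aval (Read a e) \<sigma>)"
| "atime (Add e e') \<sigma> = atime e \<sigma> + atime e' \<sigma> + int_size (aval (Add e e') \<sigma>)"
| "atime (Sub e e') \<sigma> = atime e \<sigma> + atime e' \<sigma> + int_size (aval (Sub e e') \<sigma>)"
| "atime (Mul e e') \<sigma> = atime e \<sigma> + atime e' \<sigma> + int_size (aval (Mul e e') \<sigma>)"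
| "atime (Div e e') \<sigma> = atime e \<sigma> + atime e' \<sigma> + int_size (aval (Div e e') \<sigma>)"

text \<open>\<open>exec c \<sigma> t \<sigma>'\<close>: started in memory \<open>\<sigma>\<close>, program \<open>c\<close> halts after time \<open>t\<close> in memory \<open>\<sigma>'\<close>.\<close>

inductive exec :: "prog \<Rightarrow> memory \<Rightarrow> nat \<Rightarrow> memory \<Rightarrow> bool" where
  Nop: "exec Nop \<sigma> 1 \<sigma>"
| Write: "exec (Write a e e') \<sigma> (atime e \<sigma> + atime e' \<sigma>)
            (\<sigma>(a := (\<sigma> a)(aval e \<sigma> := aval e' \<sigma>)))"
| Seq: "exec c \<sigma> t \<sigma>' \<Longrightarrow> exec c' \<sigma>' t' \<sigma>'' \<Longrightarrow> exec (Seq c c') \<sigma> (t + t') \<sigma>''"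
| Branch_pos: "0 < aval e \<sigma> \<Longrightarrow> exec c \<sigma> t \<sigma>' \<Longrightarrow> exec (Branch e c c') \<sigma> (atime e \<sigma> + t) \<sigma>'"
| Branch_nonpos: "aval e \<sigma> \<le> 0 \<Longrightarrow> exec c' \<sigma> t \<sigma>' \<Longrightarrow> exec (Branch e c c') \<sigma> (atime e \<sigma> + t) \<sigma>'"
| Loop_pos: "0 < aval e \<sigma> \<Longrightarrow> exec c \<sigma> t \<sigma>' \<Longrightarrow> exec (Loop e c) \<sigma>' t' \<sigma>'' \<Longrightarrow>
    exec (Loop e c) \<sigma> (atime e \<sigma> + t + t') \<sigma>''"
| Loop_nonpos: "aval e \<sigma> \<le> 0 \<Longrightarrow> exec (Loop e c) \<sigma> (atime e \<sigma>) \<sigma>"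

lemma exec_deterministic:
  "exec c \<sigma> t \<sigma>' \<Longrightarrow> exec c \<sigma> t' \<sigma>'' \<Longrightarrow> t' = t \<and> \<sigma>'' = \<sigma>'"
proof (induction arbitrary: t' \<sigma>'' rule: exec.induct)
  case (Nop \<sigma>)
  from Nop.prems show ?case by cases auto
next
  case (Write a e e' \<sigma>)
  from Write.prems show ?case by cases auto
next
  case (Seq c \<sigma> t \<sigma>' c' t2 \<sigma>2)
  from Seq.prems show ?case by cases (use Seq.IH in blast)
next
  case (Branch_pos e \<sigma> c t \<sigma>' c')
  from Branch_pos.prems show ?case
    by cases (use Branch_pos.hyps Branch_pos.IH in \<open>blast | linarith\<close>)+
next
  case (Branch_nonpos e \<sigma> c' t \<sigma>' c)
  from Branch_nonpos.prems show ?case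
    by cases (use Branch_nonpos.hyps Branch_nonpos.IH in \<open>linarith | blast\<close>)+
next
  case (Loop_pos e \<sigma> c t \<sigma>' t2 \<sigma>2)
  from Loop_pos.prems show ?case
    by cases (use Loop_pos.hyps Loop_pos.IH in \<open>blast | linarith\<close>)+
next
  case (Loop_nonpos e \<sigma> c)
  from Loop_nonpos.prems show ?case
    by cases (use Loop_nonpos.hyps in auto)
qed

text \<open>The input is read from array 0 and the output is found in array 1; entry 0 of either array
  holds the number of integers, which follow at indices 1, 2, \<dots>\<close>

definition input_memory :: "int list \<Rightarrow> memory" where
  "input_memory xs a j =
     (if a \<noteq> 0 then 0
      else if j = 0 then int (length xs)
      else if 1 \<le> j \<and> j \<le> int (length xs) then xs ! nat (j - 1)
      else 0)"

definition output_list :: "memory \<Rightarrow> int list" where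
  "output_list \<sigma> = map (\<lambda>j. \<sigma> 1 (1 + int j)) [0..<nat (\<sigma> 1 0)]"

definition input_size :: "int list \<Rightarrow> nat" where
  "input_size xs = sum_list (map int_size xs)"

text \<open>The program c solves, in polynomial time, the problem of finding for an instance I in Is,
  given as enc I, an output related to I by sol.\<close>

definition solves_in_poly_time ::
    "prog \<Rightarrow> 'i set \<Rightarrow> ('i \<Rightarrow> int list) \<Rightarrow> ('i \<Rightarrow> int list \<Rightarrow> bool) \<Rightarrow> bool" where
  "solves_in_poly_time c Is enc sol \<longleftrightarrow>
     (\<exists>a k. \<forall>I\<in>Is. \<exists>t \<sigma>.
        exec c (input_memory (enc I)) t \<sigma> \<and>
        t \<le> a * input_size (enc I) ^ k + a \<and>
        sol I (output_list \<sigma>))"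


section \<open>Instances as inputs of algorithms\<close>

text \<open>The points of an input are 0, \<dots>, n - 1, all real parameters are rational, and all integers
  are written in binary. Metric_space demands symmetry and nonnegativity of the distance function
  also outside the set of points; this is no restriction, as only the entries for points are
  encoded and every metric on the points extends by 0.\<close>

definition encode_rat :: "rat \<Rightarrow> int list" where
  "encode_rat q = [fst (quotient_of q), snd (quotient_of q)]"

definition encode_matrix :: "nat \<Rightarrow> (nat \<Rightarrow> nat \<Rightarrow> rat) \<Rightarrow> int list" where
  "encode_matrix n d = concat (map (\<lambda>v. concat (map (\<lambda>w. encode_rat (d v w)) [0..<n])) [0..<n])"

record tcsd_input =
  tcsd_size :: nat
  tcsd_dist :: "nat \<Rightarrow> nat \<Rightarrow> rat"
  tcsd_opts :: "nat \<Rightarrow> (rat \<times> int) list"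

definition encode_tcsd :: "tcsd_input \<Rightarrow> int list" where
  "encode_tcsd I =
     [int (tcsd_size I)]
     @ encode_matrix (tcsd_size I) (tcsd_dist I)
     @ concat (map (\<lambda>v. int (length (tcsd_opts I v))
                        # concat (map (\<lambda>(g, z). encode_rat g @ [z]) (tcsd_opts I v)))
         [0..<tcsd_size I])"

definition tcsd_points :: "tcsd_input \<Rightarrow> nat set" where
  "tcsd_points I = {..<tcsd_size I}"

definition tcsd_metric :: "tcsd_input \<Rightarrow> nat \<Rightarrow> nat \<Rightarrow> real" where
  "tcsd_metric I v w = of_rat (tcsd_dist I v w)"

definition tcsd_option_list :: "tcsd_input \<Rightarrow> nat \<Rightarrow> (real \<times> int) list" where
  "tcsd_option_list I v = map (\<lambda>(g, z). (of_rat g, z)) (tcsd_opts I v)"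

definition tcsd_R :: "tcsd_input \<Rightarrow> nat \<Rightarrow> (real \<times> int) set" where
  "tcsd_R I v = set (tcsd_option_list I v)"

text \<open>The inputs that are an instance \<open>I\<^sup>4\<close> for some setting.\<close>

definition I4_inputs :: "tcsd_input set" where
  "I4_inputs = {I. \<exists>\<beta> n N f B.
     I4_setting \<beta> (tcsd_points I) (tcsd_metric I) n N f B \<and>
     (\<forall>v\<in>tcsd_points I.
        tcsd_R I v = I4_R \<beta> (tcsd_points I) (tcsd_metric I) n N f B v)}"

text \<open>A solution is output by listing, for each point, the position of the chosen pair.\<close>

definition tcsd_approx_output :: "real \<Rightarrow> tcsd_input \<Rightarrow> int list \<Rightarrow> bool" where
  "tcsd_approx_output \<alpha> I ys \<longleftrightarrow>
     (\<exists>j. ys = map (\<lambda>v. int (j v)) [0..<tcsd_size I] \<and>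
          (\<forall>v\<in>tcsd_points I. j v < length (tcsd_option_list I v)) \<and>
          tcsd_approx_solution \<alpha> (tcsd_points I) (tcsd_metric I) (tcsd_R I)
            (\<lambda>v. tcsd_option_list I v ! j v))"

record cfl_input =
  cfl_size :: nat
  cfl_dist :: "nat \<Rightarrow> nat \<Rightarrow> rat"
  cfl_suppliers :: "(nat \<times> rat \<times> nat) list"  \<comment> \<open>location, opening cost, capacity\<close>
  cfl_demand :: "nat \<Rightarrow> nat"

definition encode_cfl :: "cfl_input \<Rightarrow> int list" where
  "encode_cfl I =
     [int (cfl_size I), int (length (cfl_suppliers I))]
     @ encode_matrix (cfl_size I) (cfl_dist I)
     @ concat (map (\<lambda>(p, f, u). [int p] @ encode_rat f @ [int u]) (cfl_suppliers I))
     @ map (\<lambda>p. int (cfl_demand I p)) [0..<cfl_size I]"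

definition cfl_points :: "cfl_input \<Rightarrow> nat set" where
  "cfl_points I = {..<cfl_size I}"

definition cfl_metric :: "cfl_input \<Rightarrow> nat \<Rightarrow> nat \<Rightarrow> real" where
  "cfl_metric I v w = of_rat (cfl_dist I v w)"

definition cfl_supplier_set :: "cfl_input \<Rightarrow> nat set" where
  "cfl_supplier_set I = {..<length (cfl_suppliers I)}"

definition cfl_location :: "cfl_input \<Rightarrow> nat \<Rightarrow> nat" where
  "cfl_location I s = fst (cfl_suppliers I ! s)"

definition cfl_opening_cost :: "cfl_input \<Rightarrow> nat \<Rightarrow> real" where
  "cfl_opening_cost I s = of_rat (fst (snd (cfl_suppliers I ! s)))"

definition cfl_capacity :: "cfl_input \<Rightarrow> nat \<Rightarrow> nat" where
  "cfl_capacity I s = snd (snd (cfl_suppliers I ! s))"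

definition cfl_inputs :: "cfl_input set" where
  "cfl_inputs = {I.
     Metric_space (cfl_points I) (cfl_metric I) \<and>
     (\<forall>s\<in>cfl_supplier_set I. cfl_location I s \<in> cfl_points I \<and> 0 \<le> cfl_opening_cost I s) \<and>
     (\<exists>Xx. cfl_solution (cfl_points I) (cfl_supplier_set I) (cfl_capacity I) (cfl_demand I) Xx)}"

text \<open>A solution is output as the 0/1 vector of open suppliers followed by the assignment matrix.\<close>

definition encode_cfl_solution :: "cfl_input \<Rightarrow> nat set \<times> (nat \<Rightarrow> nat \<Rightarrow> nat) \<Rightarrow> int list" where
  "encode_cfl_solution I = (\<lambda>(X, x).
     map (\<lambda>s. if s \<in> X then 1 else 0) [0..<length (cfl_suppliers I)]
     @ concat (map (\<lambda>s. map (\<lambda>p. int (x s p)) [0..<cfl_size I]) [0..<length (cfl_suppliers I)]))"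

definition cfl_approx_output :: "real \<Rightarrow> cfl_input \<Rightarrow> int list \<Rightarrow> bool" where
  "cfl_approx_output \<alpha> I ys \<longleftrightarrow>
     (\<exists>Xx. ys = encode_cfl_solution I Xx \<and>
           cfl_approx_solution \<alpha> (cfl_points I) (cfl_metric I) (cfl_supplier_set I)
             (cfl_location I) (cfl_opening_cost I) (cfl_capacity I) (cfl_demand I) Xx)"

end

theory Submission
  imports Defs
begin

text \<open>At each point, choose levels of geometrically decreasing cost: the first threshold is the largest
  cost of an option, the next one is the largest cost that is at most half of the previous threshold,
  and so on down to 0. Level r stands for the option of largest supply within the r-th threshold. In
  the facility location instance, a supplier for level r costs the r-th threshold and has as its
  capacity the excess of the supply of level r over that of level r + 1; if the supply of the last
  level is negative, its absolute value becomes the demand of the point. An option of cost g is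
  dominated by a level of threshold at most 2 g, and opening all suppliers from that level on costs at
  most 4 g, so the optimum grows by a factor of at most 4. Conversely the most expensive open supplier
  at a point tells which option to take, since the capacities of the cheaper ones telescope.

  For the running time it is enough to count the steps of the programs around the given algorithm,
  because every step lengthens the stored numbers by a bounded number of bits only. Giving each point
  as many suppliers as there are numbers in the input keeps the indexing simple; the surplus levels
  repeat the threshold 0.\<close>


section \<open>Bit lengths of stored numbers, and time from step counts\<close>

section \<open>Sizes of integers\<close>

text \<open>Facility location knows no precedence among suppliers: an algorithm may open an
  expensive level and leave the cheaper ones closed. Priced at the increment over the next level,
  such a supplier would not pay for the option read off from it. So each supplier carries its full
  threshold and pays for its option alone, and the halving of the thresholds limits the overpayment
  when all cheaper levels are opened along. The factor 4 is 2 for this geometric sum times 2 for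
  rounding a cost up to a threshold; transport costs lose nothing.

  Since numbers are written in binary, the number of levels must not depend on the size of costs or
  supplies. Thresholds are therefore costs of options, and each positive one uses up an option.
  Every point has two options that make this work: its own facility is free, so the thresholds reach
  0, and the option of supply \<open>n v\<close> makes every instance feasible.

  The problems also differ in that TCSD lets units travel through intermediate points, whereas
  facility location assigns demand directly; the triangle inequality removes this
  difference.\<close>

lemma int_size_le: "\<bar>k\<bar> < 2 ^ m \<Longrightarrow> int_size k \<le> Suc m"
proof -
  assume "\<bar>k\<bar> < 2 ^ m"
  then have "nat \<bar>k\<bar> < 2 ^ m"
    by (simp add: nat_less_iff)
  then show ?thesis
    by (simp add: int_size_def floorlog_leI)
qed

lemma less_int_size: "\<bar>k\<bar> < 2 ^ int_size k"
proof -
  have "nat \<bar>k\<bar> < 2 ^ floorlog 2 (nat \<bar>k\<bar>)"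
    using floorlog_bounds[of "nat \<bar>k\<bar>" 2] by (cases "k = 0") (auto simp: floorlog_def)
  also have "\<dots> \<le> 2 ^ int_size k"
    by (simp add: int_size_def)
  finally show ?thesis
    by (simp add: nat_less_iff)
qed

lemma int_size_pos: "0 < int_size k"
  by (simp add: int_size_def)

lemma abs_less_power_mono: "\<bar>k :: int\<bar> < 2 ^ m \<Longrightarrow> m \<le> m' \<Longrightarrow> \<bar>k\<bar> < 2 ^ m'"
  by (meson less_le_trans one_le_numeral power_increasing)

lemma int_less_power: "int n < 2 ^ n"
  by (metis of_nat_less_iff of_nat_numeral of_nat_power less_exp)

lemma abs_add_less_power:
  fixes x y :: int
  assumes "\<bar>x\<bar> < 2 ^ a" "\<bar>y\<bar> < 2 ^ b"
  shows "\<bar>x + y\<bar> < 2 ^ Suc (max a b)" "\<bar>x - y\<bar> < 2 ^ Suc (max a b)"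
  using abs_less_power_mono[OF assms(1), of "max a b"] abs_less_power_mono[OF assms(2), of "max a b"]
  by (simp_all add: abs_less_iff)

lemma abs_mult_less_power:
  fixes x y :: int
  assumes "\<bar>x\<bar> < 2 ^ a" "\<bar>y\<bar> < 2 ^ b"
  shows "\<bar>x * y\<bar> < 2 ^ (a + b)"
  using mult_strict_mono'[OF assms] by (simp add: abs_mult power_add)

text \<open>A bit length is tracked instead of a magnitude because it grows by one under addition
  and adds up under multiplication. The bound ranges over all cells, so computed addresses need no
  side condition.\<close>

definition bounded_memory :: "nat \<Rightarrow> memory \<Rightarrow> bool" where
  "bounded_memory m \<sigma> \<longleftrightarrow> (\<forall>a j. \<bar>\<sigma> a j\<bar> < 2 ^ m)"

lemma bounded_memory_mono: "bounded_memory m \<sigma> \<Longrightarrow> m \<le> m' \<Longrightarrow> bounded_memory m' \<sigma>"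
  unfolding bounded_memory_def by (blast intro: abs_less_power_mono)

lemma bounded_memory_upd:
  "bounded_memory m \<sigma> \<Longrightarrow> \<bar>x\<bar> < 2 ^ m \<Longrightarrow> bounded_memory m (\<sigma>(a := (\<sigma> a)(j := x)))"
  by (simp add: bounded_memory_def)

lemma length_le_input_size: "length xs \<le> input_size xs"
  unfolding input_size_def
proof (induction xs)
  case (Cons x xs)
  then show ?case using int_size_pos[of x] by simp
qed simp

lemma bounded_input_memory: "bounded_memory (input_size xs) (input_memory xs)"
proof -
  have "\<bar>x\<bar> < 2 ^ input_size xs" if "x \<in> set xs" for x
    using less_int_size member_le_sum_list[of "int_size x" "map int_size xs"] that
    by (fastforce simp: input_size_def intro: abs_less_power_mono)
  moreover have "int (length xs) < 2 ^ input_size xs"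
    using abs_less_power_mono[of "int (length xs)" "length xs"] int_less_power[of "length xs"]
      length_le_input_size[of xs] by simp
  ultimately show ?thesis
    by (auto simp: bounded_memory_def input_memory_def)
qed

lemma input_size_le:
  assumes "\<And>x. x \<in> set xs \<Longrightarrow> \<bar>x\<bar> < 2 ^ m"
  shows "input_size xs \<le> length xs * Suc m"
  using sum_list_mono[of xs int_size "\<lambda>_. Suc m"] assms int_size_le
  by (simp add: input_size_def sum_list_triv)

lemma int_size_le_atime: "int_size (aval e \<sigma>) \<le> atime e \<sigma>"
  by (cases e) auto

text \<open>Every written value is charged its own length, so elapsed time bounds the growth in
  bits. This covers the given algorithm, of which nothing but the running time is known.\<close>

lemma exec_bounded_memory:
  assumes "exec c \<sigma> t \<sigma>'" "bounded_memory m \<sigma>"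
  shows "bounded_memory (m + t) \<sigma>'"
  using assms
proof (induction arbitrary: m rule: exec.induct)
  case (Nop \<sigma>)
  then show ?case by (auto elim: bounded_memory_mono)
next
  case (Write a e e' \<sigma>)
  have "\<bar>aval e' \<sigma>\<bar> < 2 ^ (m + (atime e \<sigma> + atime e' \<sigma>))"
    using less_int_size[of "aval e' \<sigma>"] int_size_le_atime[of e' \<sigma>]
    by (auto elim: abs_less_power_mono)
  with Write show ?case
    by (intro bounded_memory_upd) (auto elim: bounded_memory_mono)
next
  case (Loop_pos e \<sigma> c t \<sigma>' t' \<sigma>'')
  show ?case
    using Loop_pos.IH(2)[OF Loop_pos.IH(1)[OF Loop_pos.prems]] by (rule bounded_memory_mono) simp
next
  case (Seq c \<sigma> t \<sigma>' c' t2 \<sigma>2)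
  show ?case
    using Seq.IH(2)[OF Seq.IH(1)[OF Seq.prems]] by (simp add: add.assoc)
next
  case (Branch_pos e \<sigma> c t \<sigma>' c')
  show ?case using Branch_pos.IH[OF Branch_pos.prems] by (rule bounded_memory_mono) simp
next
  case (Branch_nonpos e \<sigma> c' t \<sigma>' c)
  show ?case using Branch_nonpos.IH[OF Branch_nonpos.prems] by (rule bounded_memory_mono) simp
next
  case (Loop_nonpos e \<sigma> c)
  then show ?case by (auto intro: bounded_memory_mono)
qed


section \<open>Counting steps instead of bit operations\<close>

text \<open>Mirrors \<open>exec\<close> with unit charges that do not depend on the memory, so that
  loops can be analysed with fixed budgets; \<open>runs_exec_bounds\<close> converts back.\<close>

inductive runs :: "prog \<Rightarrow> memory \<Rightarrow> nat \<Rightarrow> memory \<Rightarrow> bool" where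
  Nop: "runs Nop \<sigma> 1 \<sigma>"
| Write: "runs (Write a e e') \<sigma> 1 (\<sigma>(a := (\<sigma> a)(aval e \<sigma> := aval e' \<sigma>)))"
| Seq: "runs c \<sigma> s \<sigma>' \<Longrightarrow> runs c' \<sigma>' s' \<sigma>'' \<Longrightarrow> runs (Seq c c') \<sigma> (s + s') \<sigma>''"
| Branch_pos: "0 < aval e \<sigma> \<Longrightarrow> runs c \<sigma> s \<sigma>' \<Longrightarrow> runs (Branch e c c') \<sigma> (Suc s) \<sigma>'"
| Branch_nonpos: "aval e \<sigma> \<le> 0 \<Longrightarrow> runs c' \<sigma> s \<sigma>' \<Longrightarrow> runs (Branch e c c') \<sigma> (Suc s) \<sigma>'"
| Loop_pos: "0 < aval e \<sigma> \<Longrightarrow> runs c \<sigma> s \<sigma>' \<Longrightarrow> runs (Loop e c) \<sigma>' s' \<sigma>'' \<Longrightarrow>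
    runs (Loop e c) \<sigma> (Suc (s + s')) \<sigma>''"
| Loop_nonpos: "aval e \<sigma> \<le> 0 \<Longrightarrow> runs (Loop e c) \<sigma> 1 \<sigma>"

fun div_free :: "aexp \<Rightarrow> bool" where
  "div_free (Const k) = True"
| "div_free (Read a e) = div_free e"
| "div_free (Add e e') = (div_free e \<and> div_free e')"
| "div_free (Sub e e') = (div_free e \<and> div_free e')"
| "div_free (Mul e e') = (div_free e \<and> div_free e')"
| "div_free (Div e e') = False"

text \<open>A product adds the bit lengths of its factors, so the length stays linear in
  \<open>m\<close>, with a factor \<open>K\<close> that depends only on the expression.
  \<open>Suc m\<close> leaves room for constants when \<open>m\<close> is 0.\<close>

lemma aval_bound:
  assumes "div_free e"
  shows "\<exists>K. \<forall>m \<sigma>. bounded_memory m \<sigma> \<longrightarrow> \<bar>aval e \<sigma>\<bar> < 2 ^ (K * Suc m)"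
  using assms
proof (induction e)
  case (Const k)
  have "\<bar>k\<bar> < 2 ^ (int_size k * Suc m)" for m
    using abs_less_power_mono[OF less_int_size] by simp
  then show ?case by auto
next
  case (Read a e)
  have "\<bar>aval (Read a e) \<sigma>\<bar> < 2 ^ (1 * Suc m)" if "bounded_memory m \<sigma>" for m \<sigma>
    using that abs_less_power_mono[of _ m "Suc m"] unfolding bounded_memory_def
    by (simp only: aval.simps mult_1 le_SucI order_refl)
  then show ?case by blast
next
  case (Add e e')
  then obtain K K' where K: "\<And>m \<sigma>. bounded_memory m \<sigma> \<Longrightarrow> \<bar>aval e \<sigma>\<bar> < 2 ^ (K * Suc m)"
    "\<And>m \<sigma>. bounded_memory m \<sigma> \<Longrightarrow> \<bar>aval e' \<sigma>\<bar> < 2 ^ (K' * Suc m)" by auto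
  have "\<bar>aval (Add e e') \<sigma>\<bar> < 2 ^ ((Suc (K + K')) * Suc m)" if "bounded_memory m \<sigma>" for m \<sigma>
    using abs_add_less_power(1)[OF K[OF that]]
    by (auto elim!: abs_less_power_mono simp: algebra_simps simp del: power_Suc)
  then show ?case by blast
next
  case (Sub e e')
  then obtain K K' where K: "\<And>m \<sigma>. bounded_memory m \<sigma> \<Longrightarrow> \<bar>aval e \<sigma>\<bar> < 2 ^ (K * Suc m)"
    "\<And>m \<sigma>. bounded_memory m \<sigma> \<Longrightarrow> \<bar>aval e' \<sigma>\<bar> < 2 ^ (K' * Suc m)" by auto
  have "\<bar>aval (Sub e e') \<sigma>\<bar> < 2 ^ ((Suc (K + K')) * Suc m)" if "bounded_memory m \<sigma>" for m \<sigma>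
    using abs_add_less_power(2)[OF K[OF that]]
    by (auto elim!: abs_less_power_mono simp: algebra_simps simp del: power_Suc)
  then show ?case by blast
next
  case (Mul e e')
  then obtain K K' where K: "\<And>m \<sigma>. bounded_memory m \<sigma> \<Longrightarrow> \<bar>aval e \<sigma>\<bar> < 2 ^ (K * Suc m)"
    "\<And>m \<sigma>. bounded_memory m \<sigma> \<Longrightarrow> \<bar>aval e' \<sigma>\<bar> < 2 ^ (K' * Suc m)" by auto
  have "\<bar>aval (Mul e e') \<sigma>\<bar> < 2 ^ ((K + K') * Suc m)" if "bounded_memory m \<sigma>" for m \<sigma>
    using abs_mult_less_power[OF K[OF that]] by (simp only: aval.simps add_mult_distrib)
  then show ?case by blast
qed auto

lemma atime_le_sum:
  "\<lbrakk>t \<le> K * Suc m; t' \<le> K' * Suc m; \<bar>x\<bar> < 2 ^ (K'' * Suc m)\<rbrakk> \<Longrightarrow>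
    t + t' + int_size x \<le> (K + K' + K'' + 1) * Suc m"
  using int_size_le[of x "K'' * Suc m"] by (simp add: algebra_simps)

lemma atime_bound:
  assumes "div_free e"
  shows "\<exists>K. \<forall>m \<sigma>. bounded_memory m \<sigma> \<longrightarrow> atime e \<sigma> \<le> K * Suc m"
  using assms
proof (induction e)
  case (Const k)
  then show ?case by (auto intro!: exI[of _ "int_size k"])
next
  case (Read a e)
  then obtain K where K: "\<And>m \<sigma>. bounded_memory m \<sigma> \<Longrightarrow> atime e \<sigma> \<le> K * Suc m" by auto
  obtain K'' where K'': "\<And>m \<sigma>. bounded_memory m \<sigma> \<Longrightarrow> \<bar>aval (Read a e) \<sigma>\<bar> < 2 ^ (K'' * Suc m)"
    using aval_bound[OF Read.prems] by auto
  have "atime (Read a e) \<sigma> \<le> (K + 0 + K'' + 1) * Suc m" if "bounded_memory m \<sigma>" for m \<sigma>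
    using atime_le_sum[OF K[OF that] _ K''[OF that], of 0 0] by simp
  then show ?case by blast
next
  case (Add e e')
  then obtain K K' where K: "\<And>m \<sigma>. bounded_memory m \<sigma> \<Longrightarrow> atime e \<sigma> \<le> K * Suc m"
    "\<And>m \<sigma>. bounded_memory m \<sigma> \<Longrightarrow> atime e' \<sigma> \<le> K' * Suc m" by auto
  obtain K'' where "\<And>m \<sigma>. bounded_memory m \<sigma> \<Longrightarrow> \<bar>aval (Add e e') \<sigma>\<bar> < 2 ^ (K'' * Suc m)"
    using aval_bound[OF Add.prems] by auto
  from atime_le_sum[OF K this] show ?case by (metis atime.simps(3))
next
  case (Sub e e')
  then obtain K K' where K: "\<And>m \<sigma>. bounded_memory m \<sigma> \<Longrightarrow> atime e \<sigma> \<le> K * Suc m"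
    "\<And>m \<sigma>. bounded_memory m \<sigma> \<Longrightarrow> atime e' \<sigma> \<le> K' * Suc m" by auto
  obtain K'' where "\<And>m \<sigma>. bounded_memory m \<sigma> \<Longrightarrow> \<bar>aval (Sub e e') \<sigma>\<bar> < 2 ^ (K'' * Suc m)"
    using aval_bound[OF Sub.prems] by auto
  from atime_le_sum[OF K this] show ?case by (metis atime.simps(4))
next
  case (Mul e e')
  then obtain K K' where K: "\<And>m \<sigma>. bounded_memory m \<sigma> \<Longrightarrow> atime e \<sigma> \<le> K * Suc m"
    "\<And>m \<sigma>. bounded_memory m \<sigma> \<Longrightarrow> atime e' \<sigma> \<le> K' * Suc m" by auto
  obtain K'' where "\<And>m \<sigma>. bounded_memory m \<sigma> \<Longrightarrow> \<bar>aval (Mul e e') \<sigma>\<bar> < 2 ^ (K'' * Suc m)"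
    using aval_bound[OF Mul.prems] by auto
  from atime_le_sum[OF K this] show ?case by (metis atime.simps(5))
qed auto

text \<open>Products may occur inside an address, since a read returns a stored number however its
  address was computed. A stored product, in contrast, could double the bit length at every step.
  Multiples that must be stored are therefore formed by repeated addition or by counting in a
  loop.\<close>

fun affine :: "aexp \<Rightarrow> bool" where
  "affine (Const k) = True"
| "affine (Read a e) = div_free e"
| "affine (Add e e') = (affine e \<and> affine e')"
| "affine (Sub e e') = (affine e \<and> affine e')"
| "affine e = False"

lemma affine_div_free: "affine e \<Longrightarrow> div_free e"
  by (induction e) auto

lemma affine_bound:
  assumes "affine e"
  shows "\<exists>D. \<forall>m \<sigma>. bounded_memory m \<sigma> \<longrightarrow> \<bar>aval e \<sigma>\<bar> < 2 ^ (m + D)"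
  using assms
proof (induction e)
  case (Const k)
  have "\<bar>k\<bar> < 2 ^ (m + int_size k)" for m
    using abs_less_power_mono[OF less_int_size] by simp
  then show ?case by auto
next
  case (Read a e)
  have "\<bar>aval (Read a e) \<sigma>\<bar> < 2 ^ (m + 0)" if "bounded_memory m \<sigma>" for m \<sigma>
    using that by (simp add: bounded_memory_def)
  then show ?case by blast
next
  case (Add e e')
  then obtain K K' where K: "\<And>m \<sigma>. bounded_memory m \<sigma> \<Longrightarrow> \<bar>aval e \<sigma>\<bar> < 2 ^ (m + K)"
    "\<And>m \<sigma>. bounded_memory m \<sigma> \<Longrightarrow> \<bar>aval e' \<sigma>\<bar> < 2 ^ (m + K')" by auto
  have "\<bar>aval (Add e e') \<sigma>\<bar> < 2 ^ (m + Suc (K + K'))" if "bounded_memory m \<sigma>" for m \<sigma>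
    using abs_add_less_power(1)[OF K[OF that]]
    by (auto elim!: abs_less_power_mono simp del: power_Suc)
  then show ?case by blast
next
  case (Sub e e')
  then obtain K K' where K: "\<And>m \<sigma>. bounded_memory m \<sigma> \<Longrightarrow> \<bar>aval e \<sigma>\<bar> < 2 ^ (m + K)"
    "\<And>m \<sigma>. bounded_memory m \<sigma> \<Longrightarrow> \<bar>aval e' \<sigma>\<bar> < 2 ^ (m + K')" by auto
  have "\<bar>aval (Sub e e') \<sigma>\<bar> < 2 ^ (m + Suc (K + K'))" if "bounded_memory m \<sigma>" for m \<sigma>
    using abs_add_less_power(2)[OF K[OF that]]
    by (auto elim!: abs_less_power_mono simp del: power_Suc)
  then show ?case by blast
qed auto

text \<open>A step of an affine program lengthens the stored numbers by a constant number of bits only,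
  hence polynomially many steps take polynomial time.\<close>

fun affine_prog :: "prog \<Rightarrow> bool" where
  "affine_prog Nop = True"
| "affine_prog (Write a e e') = (div_free e \<and> affine e')"
| "affine_prog (Seq c c') = (affine_prog c \<and> affine_prog c')"
| "affine_prog (Branch e c c') = (div_free e \<and> affine_prog c \<and> affine_prog c')"
| "affine_prog (Loop e c) = (div_free e \<and> affine_prog c)"

text \<open>One pair of constants serves a whole program: \<open>K\<close> relates the time of a
  step to the bit length of the memory, \<open>D\<close> is the number of bits a write may add. The
  induction over \<open>runs\<close> can then keep the pair fixed.\<close>

fun prog_bounds :: "nat \<Rightarrow> nat \<Rightarrow> prog \<Rightarrow> bool" where
  "prog_bounds K D Nop = True"
| "prog_bounds K D (Write a e e') =
     (\<forall>m \<sigma>. bounded_memory m \<sigma> \<longrightarrow>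
        atime e \<sigma> + atime e' \<sigma> \<le> K * Suc m \<and> \<bar>aval e' \<sigma>\<bar> < 2 ^ (m + D))"
| "prog_bounds K D (Seq c c') = (prog_bounds K D c \<and> prog_bounds K D c')"
| "prog_bounds K D (Branch e c c') =
     ((\<forall>m \<sigma>. bounded_memory m \<sigma> \<longrightarrow> atime e \<sigma> \<le> K * Suc m) \<and>
      prog_bounds K D c \<and> prog_bounds K D c')"
| "prog_bounds K D (Loop e c) =
     ((\<forall>m \<sigma>. bounded_memory m \<sigma> \<longrightarrow> atime e \<sigma> \<le> K * Suc m) \<and> prog_bounds K D c)"

lemma prog_bounds_mono: "prog_bounds K D c \<Longrightarrow> K \<le> K' \<Longrightarrow> D \<le> D' \<Longrightarrow> prog_bounds K' D' c"
proof (induction c)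
  case (Write a e e')
  then show ?case
    by (simp del: mult_Suc_right) (meson abs_less_power_mono add_left_mono le_trans mult_le_mono1)
next
  case (Branch e c c')
  then show ?case by (simp del: mult_Suc_right) (meson le_trans mult_le_mono1)
next
  case (Loop e c)
  then show ?case by (simp del: mult_Suc_right) (meson le_trans mult_le_mono1)
qed auto

lemma affine_prog_bounds: "affine_prog c \<Longrightarrow> \<exists>K D. 1 \<le> K \<and> prog_bounds K D c"
proof (induction c)
  case Nop
  then show ?case by auto
next
  case (Write a e e')
  obtain K where K: "\<And>m \<sigma>. bounded_memory m \<sigma> \<Longrightarrow> atime e \<sigma> \<le> K * Suc m"
    using atime_bound Write by fastforce
  obtain K' where K': "\<And>m \<sigma>. bounded_memory m \<sigma> \<Longrightarrow> atime e' \<sigma> \<le> K' * Suc m"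
    using atime_bound affine_div_free Write by fastforce
  obtain D where D: "\<And>m \<sigma>. bounded_memory m \<sigma> \<Longrightarrow> \<bar>aval e' \<sigma>\<bar> < 2 ^ (m + D)"
    using affine_bound Write by fastforce
  have "atime e \<sigma> + atime e' \<sigma> \<le> Suc (K + K') * Suc m" if "bounded_memory m \<sigma>" for m \<sigma>
    using K[OF that] K'[OF that] by (simp add: algebra_simps)
  with D show ?case
    by (intro exI[of _ "Suc (K + K')"] exI[of _ D]) auto
next
  case (Seq c c')
  then obtain K D K' D' where *: "1 \<le> K" "prog_bounds K D c" "prog_bounds K' D' c'" by auto
  then show ?case
    using prog_bounds_mono[OF *(2), of "K + K'" "D + D'"]
      prog_bounds_mono[OF *(3), of "K + K'" "D + D'"]
    by (intro exI[of _ "K + K'"] exI[of _ "D + D'"]) auto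
next
  case (Branch e c c')
  obtain K0 where K0: "\<And>m \<sigma>. bounded_memory m \<sigma> \<Longrightarrow> atime e \<sigma> \<le> K0 * Suc m"
    using atime_bound Branch by fastforce
  from Branch obtain K D K' D' where *: "1 \<le> K" "prog_bounds K D c" "prog_bounds K' D' c'" by auto
  have "atime e \<sigma> \<le> (K0 + K + K') * Suc m" if "bounded_memory m \<sigma>" for m \<sigma>
    using K0[OF that] by (simp add: algebra_simps)
  then show ?case
    using prog_bounds_mono[OF *(2), of "K0 + K + K'" "D + D'"]
      prog_bounds_mono[OF *(3), of "K0 + K + K'" "D + D'"] *(1)
    by (intro exI[of _ "K0 + K + K'"] exI[of _ "D + D'"]) auto
next
  case (Loop e c)
  obtain K0 where K0: "\<And>m \<sigma>. bounded_memory m \<sigma> \<Longrightarrow> atime e \<sigma> \<le> K0 * Suc m"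
    using atime_bound Loop by fastforce
  from Loop obtain K D where *: "1 \<le> K" "prog_bounds K D c" by auto
  have "atime e \<sigma> \<le> (K0 + K) * Suc m" if "bounded_memory m \<sigma>" for m \<sigma>
    using K0[OF that] by (simp add: algebra_simps)
  then show ?case
    using prog_bounds_mono[OF *(2), of "K0 + K" D] *(1)
    by (intro exI[of _ "K0 + K"] exI[of _ D]) auto
qed

text \<open>The final bit length \<open>M\<close> is fixed in advance, so each of the
  \<open>s\<close> steps costs at most \<open>K * Suc M\<close>, while \<open>m\<close> grows by
  \<open>D\<close> per step along the run.\<close>

lemma runs_exec_bounds:
  assumes "runs c \<sigma> s \<sigma>'" "prog_bounds K D c" "1 \<le> K" "bounded_memory m \<sigma>"
    "m + D * s \<le> M"
  shows "(\<exists>t \<le> s * (K * Suc M). exec c \<sigma> t \<sigma>') \<and> bounded_memory (m + D * s) \<sigma>'"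
  using assms
proof (induction arbitrary: m rule: runs.induct)
  case (Nop \<sigma>)
  then have "1 \<le> 1 * (K * Suc M)" by simp
  with Nop show ?case
    by (meson bounded_memory_mono exec.Nop le_add1)
next
  case (Write a e e' \<sigma>)
  have M: "bounded_memory M \<sigma>"
    using Write by (auto intro: bounded_memory_mono)
  have le: "\<bar>aval e' \<sigma>\<bar> < 2 ^ (m + D * 1)" "atime e \<sigma> + atime e' \<sigma> \<le> 1 * (K * Suc M)"
    using Write M by auto
  have "bounded_memory (m + D * 1) \<sigma>"
    using Write.prems(3) by (rule bounded_memory_mono) simp
  then show ?case
    using bounded_memory_upd[OF _ le(1)] le(2) exec.Write[of a e e' \<sigma>] by blast
next
  case (Seq c \<sigma> s \<sigma>' c' s' \<sigma>'')
  then have "m + D * s \<le> M" "m + D * s + D * s' \<le> M" by (auto simp: algebra_simps)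
  note le = this
  obtain t where t: "t \<le> s * (K * Suc M)" "exec c \<sigma> t \<sigma>'" "bounded_memory (m + D * s) \<sigma>'"
    using Seq.IH(1)[of m] Seq.prems le by auto
  obtain t' where t': "t' \<le> s' * (K * Suc M)" "exec c' \<sigma>' t' \<sigma>''"
    "bounded_memory (m + D * s + D * s') \<sigma>''"
    using Seq.IH(2)[OF _ _ t(3)] Seq.prems le by auto
  have "t + t' \<le> (s + s') * (K * Suc M)"
    using add_mono[OF t(1) t'(1)] by (simp only: add_mult_distrib)
  moreover have "bounded_memory (m + D * (s + s')) \<sigma>''"
    using t'(3) by (simp add: algebra_simps)
  ultimately show ?case
    using exec.Seq[OF t(2) t'(2)] by blast
next
  case (Branch_pos e \<sigma> c s \<sigma>' c')
  have "atime e \<sigma> \<le> K * Suc M" "m + D * s \<le> M"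
    using Branch_pos.prems bounded_memory_mono[of m \<sigma> M] by simp_all
  moreover obtain t where "t \<le> s * (K * Suc M)" "exec c \<sigma> t \<sigma>'" "bounded_memory (m + D * s) \<sigma>'"
    using Branch_pos.IH[of m] Branch_pos.prems calculation by auto
  ultimately have "atime e \<sigma> + t \<le> Suc s * (K * Suc M)"
    "exec (Branch e c c') \<sigma> (atime e \<sigma> + t) \<sigma>'" "bounded_memory (m + D * Suc s) \<sigma>'"
    using exec.Branch_pos[OF Branch_pos.hyps(1)] by (auto intro: bounded_memory_mono)
  then show ?case by blast
next
  case (Branch_nonpos e \<sigma> c' s \<sigma>' c)
  have "atime e \<sigma> \<le> K * Suc M" "m + D * s \<le> M"
    using Branch_nonpos.prems bounded_memory_mono[of m \<sigma> M] by simp_all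
  moreover obtain t where "t \<le> s * (K * Suc M)" "exec c' \<sigma> t \<sigma>'" "bounded_memory (m + D * s) \<sigma>'"
    using Branch_nonpos.IH[of m] Branch_nonpos.prems calculation by auto
  ultimately have "atime e \<sigma> + t \<le> Suc s * (K * Suc M)"
    "exec (Branch e c c') \<sigma> (atime e \<sigma> + t) \<sigma>'" "bounded_memory (m + D * Suc s) \<sigma>'"
    using exec.Branch_nonpos[OF Branch_nonpos.hyps(1)] by (auto intro: bounded_memory_mono)
  then show ?case by blast
next
  case (Loop_pos e \<sigma> c s \<sigma>' s' \<sigma>'')
  have le: "atime e \<sigma> \<le> K * Suc M" "m + D * s \<le> M" "m + D * s + D * s' \<le> M"
    using Loop_pos.prems bounded_memory_mono[of m \<sigma> M] by (simp_all add: add_mult_distrib2)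
  obtain t where t: "t \<le> s * (K * Suc M)" "exec c \<sigma> t \<sigma>'" "bounded_memory (m + D * s) \<sigma>'"
    using Loop_pos.IH(1)[of m] Loop_pos.prems le by auto
  obtain t' where t': "t' \<le> s' * (K * Suc M)" "exec (Loop e c) \<sigma>' t' \<sigma>''"
    "bounded_memory (m + D * s + D * s') \<sigma>''"
    using Loop_pos.IH(2)[OF Loop_pos.prems(1,2) t(3)] le by auto
  have "atime e \<sigma> + t + t' \<le> Suc (s + s') * (K * Suc M)"
    using le t t' by (simp add: algebra_simps)
  moreover have "bounded_memory (m + D * Suc (s + s')) \<sigma>''"
    using t'(3) by (rule bounded_memory_mono) (simp add: algebra_simps)
  ultimately show ?case
    using exec.Loop_pos[OF Loop_pos.hyps(1) t(2) t'(2)] by blast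
next
  case (Loop_nonpos e \<sigma> c)
  have "atime e \<sigma> \<le> 1 * (K * Suc M)"
    using Loop_nonpos.prems bounded_memory_mono[of m \<sigma> M] by simp
  then show ?case
    using exec.Loop_nonpos[OF Loop_nonpos.hyps] bounded_memory_mono[OF Loop_nonpos.prems(3)]
    by (meson le_add1)
qed

lemma affine_prog_exec:
  assumes "affine_prog c"
  shows "\<exists>K D. \<forall>\<sigma> s \<sigma>' m. runs c \<sigma> s \<sigma>' \<longrightarrow> bounded_memory m \<sigma> \<longrightarrow>
    (\<exists>t \<le> s * (K * Suc (m + D * s)). exec c \<sigma> t \<sigma>') \<and> bounded_memory (m + D * s) \<sigma>'"
proof -
  obtain K D where "1 \<le> K" "prog_bounds K D c"
    using affine_prog_bounds[OF assms] by blast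
  then show ?thesis
    using runs_exec_bounds[of c _ _ _ K D _ "_ + _ * _", OF _ _ _ _ order_refl] by blast
qed


section \<open>Program logic with step budgets, relocation, polynomial bounds\<close>

section \<open>Verification of programs\<close>

fun writes :: "prog \<Rightarrow> nat set" where
  "writes Nop = {}"
| "writes (Write a e e') = {a}"
| "writes (Seq c c') = writes c \<union> writes c'"
| "writes (Branch e c c') = writes c \<union> writes c'"
| "writes (Loop e c) = writes c"

lemma runs_frame: "runs c \<sigma> s \<sigma>' \<Longrightarrow> a \<notin> writes c \<Longrightarrow> \<sigma>' a = \<sigma> a"
  by (induction rule: runs.induct) auto

text \<open>Total correctness with a budget: \<open>k\<close> is only an upper bound, since branches
  differ in length, and budgets compose by addition.\<close>

definition wp :: "prog \<Rightarrow> nat \<Rightarrow> (memory \<Rightarrow> bool) \<Rightarrow> memory \<Rightarrow> bool" where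
  "wp c k Q \<sigma> \<longleftrightarrow> (\<exists>s \<sigma>'. runs c \<sigma> s \<sigma>' \<and> s \<le> k \<and> Q \<sigma>')"

text \<open>Consequence and frame rule in one: \<open>Q\<close> may stay silent about arrays that
  \<open>c\<close> never writes.\<close>

lemma wp_frame:
  assumes "wp c k Q \<sigma>" "k \<le> k'"
    "\<And>\<sigma>'. Q \<sigma>' \<Longrightarrow> (\<And>a. a \<notin> writes c \<Longrightarrow> \<sigma>' a = \<sigma> a) \<Longrightarrow> Q' \<sigma>'"
  shows "wp c k' Q' \<sigma>"
proof -
  obtain s \<sigma>' where "runs c \<sigma> s \<sigma>'" "s \<le> k" "Q \<sigma>'"
    using assms(1) by (auto simp: wp_def)
  then show ?thesis
    using assms(2,3) runs_frame[of c \<sigma> s \<sigma>'] unfolding wp_def by (metis le_trans)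
qed

lemma wp_Nop: "Q \<sigma> \<Longrightarrow> wp Nop 1 Q \<sigma>"
  unfolding wp_def using runs.Nop by blast

lemma wp_Write: "Q (\<sigma>(a := (\<sigma> a)(aval e \<sigma> := aval e' \<sigma>))) \<Longrightarrow> wp (Write a e e') 1 Q \<sigma>"
  unfolding wp_def using runs.Write by blast

lemma wp_Seq: "wp c k (wp c' k' Q) \<sigma> \<Longrightarrow> wp (Seq c c') (k + k') Q \<sigma>"
  unfolding wp_def by (meson add_mono runs.Seq)

lemma wp_Branch:
  assumes "0 < aval e \<sigma> \<Longrightarrow> wp c k Q \<sigma>" "aval e \<sigma> \<le> 0 \<Longrightarrow> wp c' k' Q \<sigma>"
  shows "wp (Branch e c c') (Suc (max k k')) Q \<sigma>"
proof (cases "0 < aval e \<sigma>")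
  case True
  with assms obtain s \<sigma>' where "runs c \<sigma> s \<sigma>'" "s \<le> k" "Q \<sigma>'"
    by (auto simp: wp_def)
  with True show ?thesis
    unfolding wp_def by (metis Suc_le_mono max.coboundedI1 runs.Branch_pos)
next
  case False
  with assms obtain s \<sigma>' where "runs c' \<sigma> s \<sigma>'" "s \<le> k'" "Q \<sigma>'"
    by (auto simp: wp_def)
  with False show ?thesis
    unfolding wp_def by (metis Suc_le_mono max.coboundedI2 not_less runs.Branch_nonpos)
qed

abbreviation Var :: "nat \<Rightarrow> aexp" where
  "Var x \<equiv> Read x (Const 0)"

abbreviation Assign :: "nat \<Rightarrow> aexp \<Rightarrow> prog" where
  "Assign x e \<equiv> Write x (Const 0) e"

definition For :: "nat \<Rightarrow> aexp \<Rightarrow> prog \<Rightarrow> prog" where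
  "For x e c = Seq (Assign x (Const 0))
     (Loop (Sub e (Var x)) (Seq c (Assign x (Add (Var x) (Const 1)))))"

lemma writes_For [simp]: "writes (For x e c) = insert x (writes c)"
  by (auto simp: For_def)

lemma affine_prog_For [simp]: "affine_prog (For x e c) \<longleftrightarrow> div_free e \<and> affine_prog c"
  by (auto simp: For_def)

text \<open>The bound \<open>e\<close> is reevaluated in every round, so arrays outside the loop
  must determine its value. Each round pays 2 extra steps for test and increment; the outer 2 are
  the initialization and the last test. The counter keeps the value \<open>N\<close> afterwards,
  which \<open>build_prog\<close> exploits.\<close>

lemma wp_For:
  assumes init: "Inv 0 (\<sigma>(x := (\<sigma> x)(0 := 0)))"
    and x: "x \<notin> writes c"
    and bound: "\<And>\<tau>. (\<And>a. a \<notin> insert x (writes c) \<Longrightarrow> \<tau> a = \<sigma> a) \<Longrightarrow> aval e \<tau> = int N"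
    and step: "\<And>i \<tau>. i < N \<Longrightarrow> Inv i \<tau> \<Longrightarrow> \<tau> x 0 = int i \<Longrightarrow>
      (\<And>a. a \<notin> insert x (writes c) \<Longrightarrow> \<tau> a = \<sigma> a) \<Longrightarrow>
      wp c k (\<lambda>\<tau>'. Inv (Suc i) (\<tau>'(x := (\<tau>' x)(0 := int (Suc i))))) \<tau>"
    and post: "\<And>\<tau>. Inv N \<tau> \<Longrightarrow> \<tau> x 0 = int N \<Longrightarrow>
      (\<And>a. a \<notin> insert x (writes c) \<Longrightarrow> \<tau> a = \<sigma> a) \<Longrightarrow> Q \<tau>"
  shows "wp (For x e c) (2 + N * (k + 2)) Q \<sigma>"
proof -
  let ?L = "Loop (Sub e (Var x)) (Seq c (Assign x (Add (Var x) (Const 1))))"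
  have loop: "wp ?L (1 + (N - i) * (k + 2)) Q \<tau>"
    if "i \<le> N" "Inv i \<tau>" "\<tau> x 0 = int i" "\<And>a. a \<notin> insert x (writes c) \<Longrightarrow> \<tau> a = \<sigma> a" for i \<tau>
    using that
  proof (induction "N - i" arbitrary: i \<tau>)
    case 0
    then have "i = N" by simp
    moreover have "aval (Sub e (Var x)) \<tau> \<le> 0"
      using bound[OF 0(5)] 0 by simp
    moreover have "Q \<tau>"
      using 0 post by simp
    ultimately show ?case
      unfolding wp_def using runs.Loop_nonpos by fastforce
  next
    case (Suc l)
    then have "i < N" by simp
    have pos: "0 < aval (Sub e (Var x)) \<tau>"
      using bound[OF Suc(6)] Suc(5) \<open>i < N\<close> by simp
    obtain s \<tau>' where s: "runs c \<tau> s \<tau>'" "s \<le> k"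
      "Inv (Suc i) (\<tau>'(x := (\<tau>' x)(0 := int (Suc i))))"
      using step[OF \<open>i < N\<close> Suc(4,5,6)] by (auto simp: wp_def)
    let ?\<tau> = "\<tau>'(x := (\<tau>' x)(0 := int (Suc i)))"
    have fr: "\<tau>' a = \<tau> a" if "a \<notin> writes c" for a
      using runs_frame[OF s(1) that] .
    have "runs (Assign x (Add (Var x) (Const 1))) \<tau>' 1 ?\<tau>"
      using runs.Write[of x "Const 0" "Add (Var x) (Const 1)" \<tau>'] fr[OF x] Suc(5)
      by (simp add: add.commute)
    with s have body: "runs (Seq c (Assign x (Add (Var x) (Const 1)))) \<tau> (s + 1) ?\<tau>"
      by (blast intro: runs.Seq)
    have "wp ?L (1 + (N - Suc i) * (k + 2)) Q ?\<tau>"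
      using Suc s(3) fr by (intro Suc.hyps(1)) auto
    then obtain s' \<tau>'' where s': "runs ?L ?\<tau> s' \<tau>''" "s' \<le> 1 + (N - Suc i) * (k + 2)" "Q \<tau>''"
      by (auto simp: wp_def)
    have "N - i = Suc (N - Suc i)"
      using \<open>i < N\<close> by simp
    then have "Suc (s + 1 + s') \<le> 1 + (N - i) * (k + 2)"
      using s(2) s'(2) by simp
    with runs.Loop_pos[OF pos body s'(1)] s'(3) show ?case
      unfolding wp_def by blast
  qed
  have "wp (For x e c) (1 + (1 + N * (k + 2))) Q \<sigma>"
    unfolding For_def
    by (intro wp_Seq wp_Write, use loop[of 0 "\<sigma>(x := (\<sigma> x)(0 := 0))"] init in simp)
  then show ?thesis by simp
qed


section \<open>Relocation of programs\<close>

fun shift_aexp :: "nat \<Rightarrow> aexp \<Rightarrow> aexp" where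
  "shift_aexp k (Const n) = Const n"
| "shift_aexp k (Read a e) = Read (a + k) (shift_aexp k e)"
| "shift_aexp k (Add e e') = Add (shift_aexp k e) (shift_aexp k e')"
| "shift_aexp k (Sub e e') = Sub (shift_aexp k e) (shift_aexp k e')"
| "shift_aexp k (Mul e e') = Mul (shift_aexp k e) (shift_aexp k e')"
| "shift_aexp k (Div e e') = Div (shift_aexp k e) (shift_aexp k e')"

fun shift_prog :: "nat \<Rightarrow> prog \<Rightarrow> prog" where
  "shift_prog k Nop = Nop"
| "shift_prog k (Write a e e') = Write (a + k) (shift_aexp k e) (shift_aexp k e')"
| "shift_prog k (Seq c c') = Seq (shift_prog k c) (shift_prog k c')"
| "shift_prog k (Branch e c c') = Branch (shift_aexp k e) (shift_prog k c) (shift_prog k c')"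
| "shift_prog k (Loop e c) = Loop (shift_aexp k e) (shift_prog k c)"

lemma aval_shift: "aval (shift_aexp k e) \<tau> = aval e (\<lambda>a. \<tau> (a + k))"
  by (induction e) auto

lemma atime_shift: "atime (shift_aexp k e) \<tau> = atime e (\<lambda>a. \<tau> (a + k))"
  by (induction e) (auto simp: aval_shift)

text \<open>Array numbers belong to the program text and are not charged, so relocation preserves
  the time exactly. The arrays below \<open>k\<close> survive and can hold the data for
  decoding.\<close>

lemma exec_shift:
  assumes "exec c \<sigma> t \<sigma>'" "\<sigma> = (\<lambda>a. \<tau> (a + k))"
  shows "\<exists>\<tau>'. exec (shift_prog k c) \<tau> t \<tau>' \<and> \<sigma>' = (\<lambda>a. \<tau>' (a + k)) \<and> (\<forall>a<k. \<tau>' a = \<tau> a)"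
  using assms
proof (induction arbitrary: \<tau> rule: exec.induct)
  case (Nop \<sigma>)
  then show ?case using exec.Nop by auto
next
  case (Write a e e' \<sigma>)
  then show ?case
    using exec.Write[of "a + k" "shift_aexp k e" "shift_aexp k e'" \<tau>]
    by (fastforce simp: aval_shift atime_shift)
next
  case (Seq c \<sigma> t \<sigma>' c' t' \<sigma>'')
  then obtain \<tau>' where 1: "exec (shift_prog k c) \<tau> t \<tau>'" "\<sigma>' = (\<lambda>a. \<tau>' (a + k))" "\<forall>a<k. \<tau>' a = \<tau> a"
    by blast
  with Seq obtain \<tau>'' where "exec (shift_prog k c') \<tau>' t' \<tau>''" "\<sigma>'' = (\<lambda>a. \<tau>'' (a + k))"
    "\<forall>a<k. \<tau>'' a = \<tau>' a" by blast
  with 1 show ?case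
    by (auto intro!: exI[of _ \<tau>''] exec.Seq)
next
  case (Branch_pos e \<sigma> c t \<sigma>' c')
  then obtain \<tau>' where "exec (shift_prog k c) \<tau> t \<tau>'" "\<sigma>' = (\<lambda>a. \<tau>' (a + k))" "\<forall>a<k. \<tau>' a = \<tau> a"
    by blast
  with Branch_pos show ?case
    using exec.Branch_pos[of "shift_aexp k e" \<tau> "shift_prog k c" t \<tau>' "shift_prog k c'"]
    by (auto simp: aval_shift atime_shift intro!: exI[of _ \<tau>'])
next
  case (Branch_nonpos e \<sigma> c' t \<sigma>' c)
  then obtain \<tau>' where "exec (shift_prog k c') \<tau> t \<tau>'" "\<sigma>' = (\<lambda>a. \<tau>' (a + k))" "\<forall>a<k. \<tau>' a = \<tau> a"
    by blast
  with Branch_nonpos show ?case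
    using exec.Branch_nonpos[of "shift_aexp k e" \<tau> "shift_prog k c'" t \<tau>' "shift_prog k c"]
    by (auto simp: aval_shift atime_shift intro!: exI[of _ \<tau>'])
next
  case (Loop_pos e \<sigma> c t \<sigma>' t' \<sigma>'')
  then obtain \<tau>' where 1: "exec (shift_prog k c) \<tau> t \<tau>'" "\<sigma>' = (\<lambda>a. \<tau>' (a + k))" "\<forall>a<k. \<tau>' a = \<tau> a"
    by blast
  with Loop_pos obtain \<tau>'' where "exec (shift_prog k (Loop e c)) \<tau>' t' \<tau>''"
    "\<sigma>'' = (\<lambda>a. \<tau>'' (a + k))" "\<forall>a<k. \<tau>'' a = \<tau>' a" by blast
  with 1 Loop_pos show ?case
    using exec.Loop_pos[of "shift_aexp k e" \<tau> "shift_prog k c" t \<tau>' t' \<tau>'']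
    by (auto simp: aval_shift atime_shift intro!: exI[of _ \<tau>''])
next
  case (Loop_nonpos e \<sigma> c)
  then show ?case
    using exec.Loop_nonpos[of "shift_aexp k e" \<tau>] by (auto simp: aval_shift atime_shift)
qed


section \<open>Polynomially bounded functions\<close>

text \<open>Powers of \<open>x + 1\<close> increase with the exponent even at \<open>x = 0\<close>,
  so one monomial suffices and closure under sums and products is a matter of adding
  exponents.\<close>

definition polynomially_bounded :: "(nat \<Rightarrow> nat) \<Rightarrow> bool" where
  "polynomially_bounded f \<longleftrightarrow> (\<exists>a k. \<forall>x. f x \<le> a * (x + 1) ^ k)"

lemma polynomially_bounded_const: "polynomially_bounded (\<lambda>_. c)"
  unfolding polynomially_bounded_def by (intro exI[of _ c] exI[of _ 0]) simp

lemma polynomially_bounded_ident: "polynomially_bounded (\<lambda>x. x)"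
  unfolding polynomially_bounded_def by (intro exI[of _ 1]) simp

lemma polynomially_bounded_add:
  assumes "polynomially_bounded f" "polynomially_bounded g"
  shows "polynomially_bounded (\<lambda>x. f x + g x)"
proof -
  obtain a k b l where *: "\<And>x. f x \<le> a * (x + 1) ^ k" "\<And>x. g x \<le> b * (x + 1) ^ l"
    using assms unfolding polynomially_bounded_def by blast
  have "f x + g x \<le> (a + b) * (x + 1) ^ (k + l)" for x
  proof -
    have "f x \<le> a * (x + 1) ^ (k + l)" "g x \<le> b * (x + 1) ^ (k + l)"
      using *(1)[of x] *(2)[of x] power_increasing[of k "k + l" "x + 1"]
        power_increasing[of l "k + l" "x + 1"]
      by (meson le_add1 le_add2 le_trans mult_le_mono2)+
    then show ?thesis by (simp add: add_mult_distrib)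
  qed
  then show ?thesis unfolding polynomially_bounded_def by blast
qed

lemma polynomially_bounded_mult:
  assumes "polynomially_bounded f" "polynomially_bounded g"
  shows "polynomially_bounded (\<lambda>x. f x * g x)"
proof -
  obtain a k b l where *: "\<And>x. f x \<le> a * (x + 1) ^ k" "\<And>x. g x \<le> b * (x + 1) ^ l"
    using assms unfolding polynomially_bounded_def by blast
  have "f x * g x \<le> (a * b) * (x + 1) ^ (k + l)" for x
    using mult_le_mono[OF *(1)[of x] *(2)[of x]]
    by (simp add: power_add ac_simps)
  then show ?thesis unfolding polynomially_bounded_def by blast
qed

lemma polynomially_bounded_power:
  "polynomially_bounded f \<Longrightarrow> polynomially_bounded (\<lambda>x. f x ^ k)"
  by (induction k) (auto intro: polynomially_bounded_const polynomially_bounded_mult)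

lemmas polynomially_bounded_intros =
  polynomially_bounded_const polynomially_bounded_ident polynomially_bounded_add
  polynomially_bounded_mult polynomially_bounded_power

lemma polynomially_bounded_le:
  assumes "polynomially_bounded f"
  shows "\<exists>a k. \<forall>x. f x \<le> a * x ^ k + a"
proof -
  obtain a k where *: "\<And>x. f x \<le> a * (x + 1) ^ k"
    using assms unfolding polynomially_bounded_def by blast
  \<comment> \<open>The factor \<open>2 ^ k\<close> comes from \<open>x + 1 \<le> 2 * x\<close> for
    positive \<open>x\<close>; the additive constant covers \<open>x = 0\<close>.\<close>
  have "f x \<le> (a * 2 ^ k) * x ^ k + a * 2 ^ k" for x
  proof (cases "x = 0")
    case True
    have "f x \<le> a" using *[of x] True by simp
    also have "\<dots> \<le> a * 2 ^ k" by simp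
    finally show ?thesis by simp
  next
    case False
    have "f x \<le> a * (x + 1) ^ k" by fact
    also have "\<dots> \<le> a * (2 * x) ^ k"
      using False by (intro mult_le_mono2 power_mono) auto
    finally show ?thesis by (simp add: power_mult_distrib)
  qed
  then show ?thesis by blast
qed


section \<open>Transports, direct assignments and optimal values\<close>

section \<open>Integral transports\<close>

text \<open>Units of demand are placed one at a time: as long as one is missing, those placed sum to
  less than the total capacity, so some supplier has slack. The lemma yields feasible transports and
  also distributes the load of a point over its open levels.\<close>

lemma split_supplies:
  fixes b :: "'p \<Rightarrow> nat" and u :: "'s \<Rightarrow> nat"
  assumes "finite P" "finite S" "(\<Sum>p\<in>P. b p) \<le> (\<Sum>s\<in>S. u s)"
  shows "\<exists>y. (\<forall>p\<in>P. (\<Sum>s\<in>S. y s p) = b p) \<and> (\<forall>s\<in>S. (\<Sum>p\<in>P. y s p) \<le> u s)"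
  using assms(3)
proof (induction "\<Sum>p\<in>P. b p" arbitrary: b)
  case 0
  then show ?case
    using assms(1) by (intro exI[of _ "\<lambda>_ _. 0"]) simp
next
  case (Suc k)
  then obtain q where q: "q \<in> P" "0 < b q"
    by (metis gr0I sum.neutral nat.distinct(1))
  define b' where "b' = b(q := b q - 1)"
  have "(\<Sum>p\<in>P. b p) = Suc (\<Sum>p\<in>P. b' p)"
    using q assms(1) by (simp add: b'_def sum.remove)
  with Suc obtain y where y: "\<And>p. p \<in> P \<Longrightarrow> (\<Sum>s\<in>S. y s p) = b' p"
    "\<And>s. s \<in> S \<Longrightarrow> (\<Sum>p\<in>P. y s p) \<le> u s"
    by (metis Suc_inject Suc_leD)
  have "(\<Sum>s\<in>S. \<Sum>p\<in>P. y s p) = (\<Sum>p\<in>P. b' p)"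
    using y(1) by (subst sum.swap) simp
  also have "\<dots> < (\<Sum>s\<in>S. u s)"
    using Suc.prems \<open>(\<Sum>p\<in>P. b p) = Suc (\<Sum>p\<in>P. b' p)\<close> by simp
  finally obtain s where s: "s \<in> S" "(\<Sum>p\<in>P. y s p) < u s"
    by (meson not_less sum_mono)
  define y' where "y' = (\<lambda>t p. y t p + (if t = s \<and> p = q then 1 else 0))"
  have "(\<Sum>t\<in>S. y' t p) = b p" if "p \<in> P" for p
    using y(1)[OF that] q s(1) assms(2)
    by (cases "p = q") (auto simp: y'_def sum.distrib b'_def)
  moreover have "(\<Sum>p\<in>P. y' t p) \<le> u t" if "t \<in> S" for t
    using y(2)[OF that] q s assms(1)
    by (cases "t = s") (auto simp: y'_def sum.distrib)
  ultimately show ?case by blast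
qed

lemma sum_pos_nat_obtain:
  fixes h :: "'a \<Rightarrow> nat"
  assumes "0 < (\<Sum>a\<in>A. h a)"
  obtains a where "a \<in> A" "0 < h a"
  using assms by (metis gr0I less_irrefl sum.neutral)

abbreviation unit_flow :: "'v \<Rightarrow> 'v \<Rightarrow> 'v \<Rightarrow> 'v \<Rightarrow> nat" where
  "unit_flow a b \<equiv> (\<lambda>v w. if v = a \<and> w = b then 1 else 0)"

lemma split_unit_flow:
  fixes h :: "'v \<Rightarrow> 'v \<Rightarrow> nat"
  assumes "0 < h a b"
  obtains h' where "h = (\<lambda>v w. h' v w + unit_flow a b v w)"
proof
  show "h = (\<lambda>v w. (h v w - unit_flow a b v w) + unit_flow a b v w)"
    using assms by (auto simp: fun_eq_iff)
qed

lemma sum_add_unit_flow: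
  assumes "finite V" "a \<in> V" "b \<in> V"
  shows "(\<Sum>w\<in>V. h v w + unit_flow a b v w) = (\<Sum>w\<in>V. h v w) + (if v = a then 1 else 0)"
    "(\<Sum>v\<in>V. h v w + unit_flow a b v w) = (\<Sum>v\<in>V. h v w) + (if w = b then 1 else 0)"
  using assms by (auto simp: sum.distrib)

lemma transport_cost_add_unit_flow:
  assumes "finite V" "a \<in> V" "b \<in> V"
  shows "transport_cost V d (\<lambda>v w. h v w + unit_flow a b v w) = transport_cost V d h + d a b"
proof -
  have "(\<Sum>w\<in>V. real (unit_flow a b v w) * d v w) = (\<Sum>w\<in>V. if w = b then if v = a then d a b else 0 else 0)" for v
    by (intro sum.cong) auto
  then have "(\<Sum>v\<in>V. \<Sum>w\<in>V. real (unit_flow a b v w) * d v w) = d a b"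
    using assms by simp
  then show ?thesis
    by (simp add: transport_cost_def distrib_right sum.distrib)
qed

lemma transport_cost_nonneg: "Metric_space V d \<Longrightarrow> 0 \<le> transport_cost V d \<psi>"
  unfolding transport_cost_def by (simp add: sum_nonneg Metric_space.nonneg)

text \<open>Shortcutting: take one unit off an arc (u, w) of the flow, turning it into a unit of demand
  at u and a unit of supply at w. If a solves the smaller problem with y serving the new demand and
  the new supply serving p, then y can serve p by the triangle inequality.\<close>

lemma flow_to_assignment:
  assumes M: "Metric_space V d" and V: "finite V"
    and bal: "\<And>v. v \<in> V \<Longrightarrow> dem v + (\<Sum>w\<in>V. \<psi> v w) \<le> a v + (\<Sum>w\<in>V. \<psi> w v)"
  shows "\<exists>x. (\<forall>p\<in>V. (\<Sum>v\<in>V. x v p) = dem p) \<and> (\<forall>v\<in>V. (\<Sum>p\<in>V. x v p) \<le> (a v :: nat)) \<and>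
    transport_cost V d x \<le> transport_cost V d \<psi>"
  using bal
proof (induction "\<Sum>v\<in>V. \<Sum>w\<in>V. \<psi> v w" arbitrary: \<psi> a dem)
  case 0
  then have \<psi>: "\<psi> v w = 0" if "v \<in> V" "w \<in> V" for v w
    using that V by auto
  define x where "x = (\<lambda>v w. if v = w then dem v else 0)"
  have "transport_cost V d x = 0" "transport_cost V d \<psi> = 0"
    using \<psi> M by (auto simp: transport_cost_def x_def Metric_space.zero intro!: sum.neutral)
  moreover have "(\<Sum>v\<in>V. x v p) = dem p" "(\<Sum>q\<in>V. x p q) \<le> a p" if "p \<in> V" for p
    using that V 0(2)[OF that] \<psi> by (auto simp: x_def)
  ultimately show ?case
    by (intro exI[of _ x]) auto
next
  case (Suc k)
  obtain u where u: "u \<in> V" "0 < (\<Sum>w\<in>V. \<psi> u w)"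
    using sum_pos_nat_obtain[of "\<lambda>v. \<Sum>w\<in>V. \<psi> v w" V] Suc.hyps(2) by (metis zero_less_Suc)
  obtain w where w: "w \<in> V" "0 < \<psi> u w"
    using sum_pos_nat_obtain[of "\<psi> u" V] u(2) by blast
  obtain \<psi>' where \<psi>: "\<psi> = (\<lambda>v v'. \<psi>' v v' + unit_flow u w v v')"
    using split_unit_flow[of \<psi>] w(2) by blast
  have \<psi>_sums: "(\<Sum>w\<in>V. \<psi> v w) = (\<Sum>w\<in>V. \<psi>' v w) + (if v = u then 1 else 0)"
    "(\<Sum>w\<in>V. \<psi> w v) = (\<Sum>w\<in>V. \<psi>' w v) + (if v = w then 1 else 0)" for v
    unfolding \<psi> by (rule sum_add_unit_flow[OF V u(1) w(1)])+
  define dem' where "dem' = dem(u := Suc (dem u))"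
  define a' where "a' = a(w := Suc (a w))"
  have "k = (\<Sum>v\<in>V. \<Sum>w\<in>V. \<psi>' v w)"
  proof -
    have "(\<Sum>v\<in>V. \<Sum>w\<in>V. \<psi> v w) = (\<Sum>v\<in>V. (\<Sum>w\<in>V. \<psi>' v w) + (if v = u then 1 else 0))"
      by (intro sum.cong refl \<psi>_sums)
    also have "\<dots> = Suc (\<Sum>v\<in>V. \<Sum>w\<in>V. \<psi>' v w)"
      using V u(1) by (simp add: sum.distrib)
    finally show ?thesis
      using Suc.hyps(2) by simp
  qed
  moreover have "dem' v + (\<Sum>w\<in>V. \<psi>' v w) \<le> a' v + (\<Sum>w\<in>V. \<psi>' w v)" if "v \<in> V" for v
    using Suc.prems[OF that] by (auto simp: \<psi>_sums dem'_def a'_def split: if_splits)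
  ultimately obtain x where x: "\<And>p. p \<in> V \<Longrightarrow> (\<Sum>v\<in>V. x v p) = dem' p"
    "\<And>v. v \<in> V \<Longrightarrow> (\<Sum>p\<in>V. x v p) \<le> a' v" "transport_cost V d x \<le> transport_cost V d \<psi>'"
    using Suc.hyps(1)[of \<psi>' dem' a'] by blast
  have cost: "transport_cost V d \<psi> = transport_cost V d \<psi>' + d u w"
    using transport_cost_add_unit_flow[OF V u(1) w(1), of d \<psi>'] by (simp only: \<psi>)
  have "0 < (\<Sum>v\<in>V. x v u)"
    using x(1)[OF u(1)] by (simp add: dem'_def)
  then obtain y where y: "y \<in> V" "0 < x y u"
    by (rule sum_pos_nat_obtain)
  obtain x1 where x1: "x = (\<lambda>v v'. x1 v v' + unit_flow y u v v')"
    using split_unit_flow[of x] y(2) by blast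
  have x_sums: "(\<Sum>p\<in>V. x v p) = (\<Sum>p\<in>V. x1 v p) + (if v = y then 1 else 0)"
    "(\<Sum>p\<in>V. x p v) = (\<Sum>p\<in>V. x1 p v) + (if v = u then 1 else 0)" for v
    unfolding x1 by (rule sum_add_unit_flow[OF V y(1) u(1)])+
  have cost1: "transport_cost V d x = transport_cost V d x1 + d y u"
    using transport_cost_add_unit_flow[OF V y(1) u(1), of d x1] by (simp only: x1)
  have dem1: "(\<Sum>v\<in>V. x1 v p) = dem p" if "p \<in> V" for p
    using x(1)[OF that] by (auto simp: x_sums dem'_def split: if_splits)
  have sup1: "(\<Sum>p\<in>V. x1 v p) + (if v = y then 1 else 0) \<le> a' v" if "v \<in> V" for v
    using x(2)[OF that] by (simp only: x_sums)
  have pos: "0 \<le> d y u" "0 \<le> d u w"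
    using M by (auto simp: Metric_space.nonneg)
  show ?case
  \<comment> \<open>Once the unit from \<open>y\<close> to \<open>u\<close> is dropped, either
    \<open>w\<close> stays within \<open>a w\<close> (in particular if \<open>y = w\<close>), and
    \<open>x1\<close> is the answer, or some \<open>p\<close> relies on the extra supply at
    \<open>w\<close> and is handed over to \<open>y\<close>.\<close>
  proof (cases "(\<Sum>p\<in>V. x1 w p) \<le> a w")
    case True
    then have "(\<Sum>p\<in>V. x1 v p) \<le> a v" if "v \<in> V" for v
      using sup1[OF that] by (cases "v = w") (auto simp: a'_def split: if_splits)
    moreover have "transport_cost V d x1 \<le> transport_cost V d \<psi>"
      using cost cost1 x(3) pos by simp
    ultimately show ?thesis using dem1 by blast
  next
    case False
    with sup1[OF w(1)] have full: "(\<Sum>p\<in>V. x1 w p) = Suc (a w)" "w \<noteq> y"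
      by (auto simp: a'_def split: if_splits)
    then have "0 < (\<Sum>p\<in>V. x1 w p)" by simp
    then obtain p where p: "p \<in> V" "0 < x1 w p"
      by (rule sum_pos_nat_obtain)
    obtain x2 where x2: "x1 = (\<lambda>v v'. x2 v v' + unit_flow w p v v')"
      using split_unit_flow[of x1] p(2) by blast
    have x1_sums: "(\<Sum>q\<in>V. x1 v q) = (\<Sum>q\<in>V. x2 v q) + (if v = w then 1 else 0)"
      "(\<Sum>q\<in>V. x1 q v) = (\<Sum>q\<in>V. x2 q v) + (if v = p then 1 else 0)" for v
      unfolding x2 by (rule sum_add_unit_flow[OF V w(1) p(1)])+
    define x3 where "x3 = (\<lambda>v v'. x2 v v' + unit_flow y p v v')"
    have x3_sums: "(\<Sum>q\<in>V. x3 v q) = (\<Sum>q\<in>V. x2 v q) + (if v = y then 1 else 0)"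
      "(\<Sum>q\<in>V. x3 q v) = (\<Sum>q\<in>V. x2 q v) + (if v = p then 1 else 0)" for v
      unfolding x3_def by (rule sum_add_unit_flow[OF V y(1) p(1)])+
    have "transport_cost V d x1 = transport_cost V d x2 + d w p"
      using transport_cost_add_unit_flow[OF V w(1) p(1), of d x2] by (simp only: x2)
    moreover have "transport_cost V d x3 = transport_cost V d x2 + d y p"
      unfolding x3_def by (rule transport_cost_add_unit_flow[OF V y(1) p(1)])
    moreover have "d y p \<le> d y u + d u w + d w p"
      using Metric_space.triangle[OF M y(1) u(1) p(1)] Metric_space.triangle[OF M u(1) w(1) p(1)]
      by simp
    ultimately have "transport_cost V d x3 \<le> transport_cost V d \<psi>"
      using cost cost1 x(3) by simp
    moreover have "(\<Sum>v\<in>V. x3 v q) = dem q" if "q \<in> V" for q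
      using dem1[OF that] by (simp only: x1_sums x3_sums)
    moreover have "(\<Sum>q\<in>V. x3 v q) \<le> a v" if "v \<in> V" for v
      using sup1[OF that] full by (auto simp: x1_sums x3_sums a'_def split: if_splits)
    ultimately show ?thesis by blast
  qed
qed

lemma transport_feasible_exists:
  assumes "finite V" "0 \<le> (\<Sum>v\<in>V. z v)"
  shows "\<exists>\<psi>. transport_feasible V z \<psi>"
proof -
  have "(\<Sum>v\<in>V. z v) = (\<Sum>v\<in>V. int (nat (z v)) - int (nat (- z v)))"
    by (intro sum.cong) auto
  then have "int (\<Sum>v\<in>V. nat (- z v)) \<le> int (\<Sum>v\<in>V. nat (z v))"
    using assms(2) by (simp add: sum_subtractf)
  then have "(\<Sum>v\<in>V. nat (- z v)) \<le> (\<Sum>v\<in>V. nat (z v))"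
    by linarith
  from split_supplies[OF assms(1) assms(1) this] obtain y where y:
    "\<And>p. p \<in> V \<Longrightarrow> (\<Sum>s\<in>V. y s p) = nat (- z p)" "\<And>s. s \<in> V \<Longrightarrow> (\<Sum>p\<in>V. y s p) \<le> nat (z s)"
    by blast
  have "0 \<le> z v + (\<Sum>w\<in>V. int (y w v)) - (\<Sum>w\<in>V. int (y v w))" if "v \<in> V" for v
    using y(1)[OF that] y(2)[OF that] unfolding of_nat_sum[symmetric] by linarith
  then show ?thesis
    unfolding transport_feasible_def by blast
qed


section \<open>Optimal values\<close>

lemma TC_le:
  assumes "Metric_space V d" "transport_feasible V z \<psi>"
  shows "TC V d z \<le> transport_cost V d \<psi>"
  unfolding TC_def using assms transport_cost_nonneg[OF assms(1)]
  by (intro cInf_lower) (auto intro!: bdd_belowI)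

text \<open>The nonnegative sum guarantees a feasible transport, so that the infimum is taken over a
  nonempty set.\<close>

lemma le_TC:
  assumes "finite V" "0 \<le> (\<Sum>v\<in>V. z v)"
    "\<And>\<psi>. transport_feasible V z \<psi> \<Longrightarrow> c \<le> transport_cost V d \<psi>"
  shows "c \<le> TC V d z"
  unfolding TC_def using transport_feasible_exists[OF assms(1,2)] assms(3)
  by (intro cInf_greatest) auto

lemma tcsd_cost_nonneg:
  assumes "tcsd_instance V d R" "tcsd_solution V R s"
  shows "0 \<le> tcsd_cost V d s"
proof -
  have "0 \<le> TC V d (\<lambda>v. snd (s v))"
    using assms transport_cost_nonneg by (intro le_TC) (auto simp: tcsd_instance_def tcsd_solution_def)
  moreover have "0 \<le> fst (s v)" if "v \<in> V" for v
    using assms that unfolding tcsd_instance_def tcsd_solution_def by fastforce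
  ultimately show ?thesis
    by (simp add: tcsd_cost_def sum_nonneg)
qed

lemma tcsd_opt_le:
  assumes "tcsd_instance V d R" "tcsd_solution V R s"
  shows "tcsd_opt V d R \<le> tcsd_cost V d s"
  unfolding tcsd_opt_def using assms tcsd_cost_nonneg[OF assms(1)]
  by (intro cInf_lower) (auto intro!: bdd_belowI)

lemma le_tcsd_opt:
  assumes "tcsd_solution V R s" "\<And>s. tcsd_solution V R s \<Longrightarrow> c \<le> tcsd_cost V d s"
  shows "c \<le> tcsd_opt V d R"
  unfolding tcsd_opt_def using assms by (intro cInf_greatest) auto

lemma cfl_cost_nonneg:
  assumes "Metric_space V d" "\<And>s. s \<in> F \<Longrightarrow> 0 \<le> f s" "X \<subseteq> F"
  shows "0 \<le> cfl_cost V d F loc f (X, x)"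
  using assms by (auto simp: cfl_cost_def Metric_space.nonneg intro!: add_nonneg_nonneg sum_nonneg)

lemma cfl_opt_le:
  assumes "Metric_space V d" "\<And>s. s \<in> F \<Longrightarrow> 0 \<le> f s" "cfl_solution V F u dem Xx"
  shows "cfl_opt V d F loc f u dem \<le> cfl_cost V d F loc f Xx"
  unfolding cfl_opt_def
proof (rule cInf_lower)
  show "cfl_cost V d F loc f Xx \<in> cfl_cost V d F loc f ` {Xx. cfl_solution V F u dem Xx}"
    using assms(3) by blast
  show "bdd_below (cfl_cost V d F loc f ` {Xx. cfl_solution V F u dem Xx})"
    using cfl_cost_nonneg[of V d F f, OF assms(1,2)]
    by (intro bdd_belowI[of _ 0]) (auto simp: cfl_solution_def)
qed


section \<open>The combinatorial reduction, its factor 4 and the levels\<close>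

section \<open>The reduction to capacitated facility location\<close>

text \<open>Level \<open>r\<close> at point \<open>v\<close> becomes supplier
  \<open>v * R + r\<close>, so sums over suppliers are double sums, and \<open>div\<close> and
  \<open>mod\<close> by \<open>R\<close> recover the pair.\<close>

lemma sum_blocks: "(\<Sum>s<n * R. h s) = (\<Sum>v<n. \<Sum>r<R. h (v * R + r))"
  for h :: "nat \<Rightarrow> 'a :: comm_monoid_add"
proof -
  have shift: "sum h {k..<k + R} = (\<Sum>r<R. h (k + r))" for k
    using sum.shift_bounds_nat_ivl[of h 0 k R] by (simp add: add.commute lessThan_atLeast0)
  have "(\<Sum>s<n * R. h s) = (\<Sum>v<n. sum h {v * R..<v * R + R})"
    by (simp add: sum.nat_group)
  also have "\<dots> = (\<Sum>v<n. \<Sum>r<R. h (v * R + r))"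
    by (simp only: shift)
  finally show ?thesis .
qed

lemma block_less: "v < n \<Longrightarrow> r < R \<Longrightarrow> v * R + r < n * (R :: nat)"
proof -
  assume "v < n" "r < R"
  then have "v * R + r < Suc v * R" by simp
  also have "\<dots> \<le> n * R"
    using \<open>v < n\<close> by (intro mult_le_mono1) simp
  finally show ?thesis .
qed

text \<open>Level r at point v stands for an option with cost g v r and supply Z v r. Opening the suppliers
  of all levels from r to R - 1 cancels the demand at v and adds the supply Z v r.\<close>

locale levels =
  fixes n R :: nat and d :: "nat \<Rightarrow> nat \<Rightarrow> real" and opts :: "nat \<Rightarrow> (real \<times> int) set"
    and g c :: "nat \<Rightarrow> nat \<Rightarrow> real" and Z :: "nat \<Rightarrow> nat \<Rightarrow> int"
    and u :: "nat \<Rightarrow> nat \<Rightarrow> nat" and dem :: "nat \<Rightarrow> nat"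
  assumes inst: "tcsd_instance {..<n} d opts"
    and R_pos: "0 < R"
    and level_option: "\<And>v r. v < n \<Longrightarrow> r < R \<Longrightarrow> (g v r, Z v r) \<in> opts v"
    and capacities: "\<And>v r. v < n \<Longrightarrow> r < R \<Longrightarrow> (\<Sum>q = r..<R. int (u v q)) = Z v r + int (dem v)"
    and level_cost: "\<And>v r. v < n \<Longrightarrow> r < R \<Longrightarrow> g v r \<le> c v r"
    and cost_nonneg: "\<And>v r. v < n \<Longrightarrow> r < R \<Longrightarrow> 0 \<le> c v r"
    and last_level: "\<And>v. v < n \<Longrightarrow> g v (R - 1) = 0"
    and level_exists: "\<And>v a z. v < n \<Longrightarrow> (a, z) \<in> opts v \<Longrightarrow>
      \<exists>r<R. z \<le> Z v r \<and> (\<Sum>q = r..<R. c v q) \<le> 4 * a"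
begin

abbreviation "F \<equiv> {..<n * R}"
abbreviation "loc \<equiv> (\<lambda>s. s div R)"
abbreviation "price \<equiv> (\<lambda>s. c (s div R) (s mod R))"
abbreviation "cap \<equiv> (\<lambda>s. u (s div R) (s mod R))"

lemma metric: "Metric_space {..<n} d"
  using inst by (simp add: tcsd_instance_def)

lemma block_mod [simp]: "r < R \<Longrightarrow> (v * R + r) mod R = r"
  by simp

text \<open>All units leaving the suppliers at \<open>v\<close> form the flow out of
  \<open>v\<close>; the units arriving equal \<open>dem v\<close>, which cancels the demand term in
  \<open>capacities\<close>. The supplier of level \<open>\<rho> v\<close> alone pays for the
  option, and nothing is owed if \<open>R - 1\<close> is taken by default.\<close>

lemma tcsd_of_cfl:
  assumes sol: "cfl_solution {..<n} F cap dem (X, x)"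
    and \<rho>: "\<And>v. v < n \<Longrightarrow> \<rho> v < R"
      "\<And>v r. v < n \<Longrightarrow> r < \<rho> v \<Longrightarrow> v * R + r \<notin> X"
      "\<And>v. v < n \<Longrightarrow> v * R + \<rho> v \<in> X \<or> \<rho> v = R - 1"
  defines "s \<equiv> (\<lambda>v. (g v (\<rho> v), Z v (\<rho> v)))"
  shows "tcsd_solution {..<n} opts s" "tcsd_cost {..<n} d s \<le> cfl_cost {..<n} d F loc price (X, x)"
proof -
  have X: "X \<subseteq> F" and dem: "\<And>p. p < n \<Longrightarrow> (\<Sum>s<n * R. x s p) = dem p"
    and cap: "\<And>s. s \<in> X \<Longrightarrow> (\<Sum>p<n. x s p) \<le> cap s"
    and closed: "\<And>s p. s \<in> F - X \<Longrightarrow> p < n \<Longrightarrow> x s p = 0"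
    using sol by (auto simp: cfl_solution_def)
  define \<psi> where "\<psi> = (\<lambda>v w. \<Sum>r<R. x (v * R + r) w)"
  have inflow: "(\<Sum>w<n. \<psi> w v) = dem v" if "v < n" for v
    using dem[OF that] by (simp add: \<psi>_def sum_blocks)
  have outflow: "int (\<Sum>w<n. \<psi> v w) \<le> Z v (\<rho> v) + int (dem v)" if v: "v < n" for v
  proof -
    have "(\<Sum>w<n. x (v * R + r) w) \<le> (if \<rho> v \<le> r then u v r else 0)" if "r < R" for r
      using cap[of "v * R + r"] closed[of "v * R + r"] block_less[OF v that] \<rho>(2)[OF v, of r] that
      by (cases "v * R + r \<in> X") (auto simp: not_le)
    then have "(\<Sum>r<R. \<Sum>w<n. x (v * R + r) w) \<le> (\<Sum>r<R. if \<rho> v \<le> r then u v r else 0)"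
      by (intro sum_mono) simp
    also have "\<dots> = (\<Sum>r = \<rho> v..<R. u v r)"
      by (intro sum.mono_neutral_cong_right) auto
    finally have "(\<Sum>w<n. \<psi> v w) \<le> (\<Sum>r = \<rho> v..<R. u v r)"
      unfolding \<psi>_def by (subst sum.swap)
    then have "int (\<Sum>w<n. \<psi> v w) \<le> int (\<Sum>r = \<rho> v..<R. u v r)"
      by (simp only: of_nat_le_iff)
    then show ?thesis
      using capacities[OF v \<rho>(1)[OF v]] by simp
  qed
  have feasible: "transport_feasible {..<n} (\<lambda>v. snd (s v)) \<psi>"
    unfolding transport_feasible_def s_def
    using inflow outflow by (simp flip: of_nat_sum)
  \<comment> \<open>Summed over all points, inflow and outflow cancel, so feasibility of
    \<open>\<psi>\<close> forces the total supply to be nonnegative.\<close>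
  have "0 \<le> (\<Sum>v<n. Z v (\<rho> v) + (\<Sum>w<n. int (\<psi> w v)) - (\<Sum>w<n. int (\<psi> v w)))"
    using feasible by (intro sum_nonneg) (simp add: transport_feasible_def s_def)
  also have "\<dots> = (\<Sum>v<n. Z v (\<rho> v))"
    using sum.swap[of "\<lambda>v w. int (\<psi> w v)" "{..<n}" "{..<n}"]
    by (simp add: sum.distrib sum_subtractf)
  finally show "tcsd_solution {..<n} opts s"
    using level_option \<rho>(1) by (simp add: tcsd_solution_def s_def)
  have "transport_cost {..<n} d \<psi> = (\<Sum>s\<in>F. \<Sum>p<n. real (x s p) * d p (loc s))"
  proof -
    have "(\<Sum>w<n. real (\<psi> v w) * d v w) = (\<Sum>r<R. \<Sum>p<n. real (x (v * R + r) p) * d p v)" for v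
      unfolding \<psi>_def of_nat_sum sum_distrib_right
      by (subst sum.swap) (simp add: Metric_space.commute[OF metric, of v])
    then show ?thesis
      by (simp add: transport_cost_def sum_blocks)
  qed
  moreover have "(\<Sum>v<n. g v (\<rho> v)) \<le> (\<Sum>s\<in>X. price s)"
  proof -
    have "(\<Sum>v<n. g v (\<rho> v)) \<le> (\<Sum>v<n. \<Sum>r<R. if v * R + r \<in> X then c v r else 0)"
    proof (intro sum_mono)
      fix v assume "v \<in> {..<n}"
      then have v: "v < n" by simp
      have nonneg: "0 \<le> (if v * R + r \<in> X then c v r else 0)" if "r < R" for r
        using cost_nonneg[OF v that] by simp
      have "g v (\<rho> v) \<le> (if v * R + \<rho> v \<in> X then c v (\<rho> v) else 0)"
        using \<rho>(3)[OF v] level_cost[OF v \<rho>(1)[OF v]] last_level[OF v] cost_nonneg[OF v \<rho>(1)[OF v]]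
        by auto
      also have "\<dots> \<le> (\<Sum>r<R. if v * R + r \<in> X then c v r else 0)"
        using \<rho>(1)[OF v] nonneg
          member_le_sum[of "\<rho> v" "{..<R}" "\<lambda>r. if v * R + r \<in> X then c v r else 0"] by simp
      finally show "g v (\<rho> v) \<le> (\<Sum>r<R. if v * R + r \<in> X then c v r else 0)" .
    qed
    also have "\<dots> = (\<Sum>s<n * R. if s \<in> X then price s else 0)"
      by (auto simp: sum_blocks intro!: sum.cong)
    also have "\<dots> = (\<Sum>s\<in>X. price s)"
      using X by (simp add: sum.inter_restrict[symmetric] Int_absorb1)
    finally show ?thesis .
  qed
  ultimately show "tcsd_cost {..<n} d s \<le> cfl_cost {..<n} d F loc price (X, x)"
    using TC_le[OF metric feasible] by (simp add: tcsd_cost_def cfl_cost_def s_def)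
qed

text \<open>The transport is made direct first, since facility location has no intermediate stops;
  then the load of each point is split over its opened levels. Only option costs are blown up by
  4.\<close>

lemma cfl_of_tcsd:
  assumes s: "tcsd_solution {..<n} opts s" and \<psi>: "transport_feasible {..<n} (\<lambda>v. snd (s v)) \<psi>"
  obtains Xx where "cfl_solution {..<n} F cap dem Xx"
    "cfl_cost {..<n} d F loc price Xx \<le> 4 * (\<Sum>v<n. fst (s v)) + transport_cost {..<n} d \<psi>"
proof -
  have "\<forall>v<n. \<exists>r<R. snd (s v) \<le> Z v r \<and> (\<Sum>q = r..<R. c v q) \<le> 4 * fst (s v)"
    using s level_exists by (metis tcsd_solution_def lessThan_iff prod.collapse)
  then obtain \<rho> where \<rho>: "\<And>v. v < n \<Longrightarrow> \<rho> v < R" "\<And>v. v < n \<Longrightarrow> snd (s v) \<le> Z v (\<rho> v)"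
    "\<And>v. v < n \<Longrightarrow> (\<Sum>q = \<rho> v..<R. c v q) \<le> 4 * fst (s v)" by metis
  \<comment> \<open>Joint capacity of the opened levels; by \<open>capacities\<close> it covers the
    chosen supply plus the demand of the point.\<close>
  define a where "a = (\<lambda>v. \<Sum>q = \<rho> v..<R. u v q)"
  have "dem v + (\<Sum>w<n. \<psi> v w) \<le> a v + (\<Sum>w<n. \<psi> w v)" if "v < n" for v
  proof -
    have "int (a v) = Z v (\<rho> v) + int (dem v)"
      using capacities[OF that \<rho>(1)[OF that]] by (simp add: a_def)
    then have "int (dem v + (\<Sum>w<n. \<psi> v w)) \<le> int (a v + (\<Sum>w<n. \<psi> w v))"
      using bspec[OF \<psi>[unfolded transport_feasible_def], of v] \<rho>(2)[OF that] that by simp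
    then show ?thesis by linarith
  qed
  then obtain y where y: "\<And>p. p < n \<Longrightarrow> (\<Sum>v<n. y v p) = dem p" "\<And>v. v < n \<Longrightarrow> (\<Sum>p<n. y v p) \<le> a v"
    "transport_cost {..<n} d y \<le> transport_cost {..<n} d \<psi>"
    using flow_to_assignment[OF metric, of dem \<psi> a] by (auto simp: Ball_def)
  have "\<forall>v\<in>{..<n}. \<exists>x. (\<forall>p\<in>{..<n}. (\<Sum>r\<in>{\<rho> v..<R}. x r p) = y v p) \<and>
    (\<forall>r\<in>{\<rho> v..<R}. (\<Sum>p\<in>{..<n}. x r p) \<le> u v r)"
    using y(2) by (intro ballI split_supplies) (auto simp: a_def)
  from bchoice[OF this] obtain x where
    "\<forall>v\<in>{..<n}. (\<forall>p\<in>{..<n}. (\<Sum>r\<in>{\<rho> v..<R}. x v r p) = y v p) \<and>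
      (\<forall>r\<in>{\<rho> v..<R}. (\<Sum>p\<in>{..<n}. x v r p) \<le> u v r)" by blast
  then have x: "\<And>v p. v < n \<Longrightarrow> p < n \<Longrightarrow> (\<Sum>r = \<rho> v..<R. x v r p) = y v p"
    "\<And>v r. v < n \<Longrightarrow> \<rho> v \<le> r \<Longrightarrow> r < R \<Longrightarrow> (\<Sum>p<n. x v r p) \<le> u v r"
    by simp_all
  define X where "X = {s\<in>F. \<rho> (s div R) \<le> s mod R}"
  define x' where "x' = (\<lambda>s p. if s \<in> X then x (s div R) (s mod R) p else 0)"
  have inX: "v * R + r \<in> X \<longleftrightarrow> \<rho> v \<le> r" if "v < n" "r < R" for v r
    using that block_less[OF that] by (simp add: X_def)
  have sum_x': "(\<Sum>r<R. x' (v * R + r) p) = y v p" if "v < n" "p < n" for v p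
  proof -
    have "(\<Sum>r<R. x' (v * R + r) p) = (\<Sum>r = \<rho> v..<R. x v r p)"
      using that inX by (intro sum.mono_neutral_cong_right) (auto simp: x'_def)
    then show ?thesis using x(1)[OF that] by simp
  qed
  have "(\<Sum>s<n * R. x' s p) = dem p" if "p < n" for p
    using y(1)[OF that] sum_x' that by (simp add: sum_blocks)
  moreover have "(\<Sum>p<n. x' s p) \<le> cap s" if "s \<in> X" for s
    using that x(2)[of "s div R" "s mod R"] R_pos
    by (auto simp: X_def x'_def less_mult_imp_div_less)
  ultimately have sol: "cfl_solution {..<n} F cap dem (X, x')"
    by (auto simp: cfl_solution_def X_def x'_def)
  have "(\<Sum>s\<in>X. price s) = (\<Sum>s<n * R. if s \<in> X then price s else 0)"
    by (subst sum.inter_restrict[symmetric]) (auto simp: X_def intro!: sum.cong)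
  also have "\<dots> = (\<Sum>v<n. \<Sum>r<R. if \<rho> v \<le> r then c v r else 0)"
    using inX by (auto simp: sum_blocks intro!: sum.cong)
  also have "\<dots> = (\<Sum>v<n. \<Sum>r = \<rho> v..<R. c v r)"
    by (intro sum.cong sum.mono_neutral_cong_right) auto
  also have "\<dots> \<le> (\<Sum>v<n. 4 * fst (s v))"
    using \<rho>(3) by (intro sum_mono) simp
  finally have "(\<Sum>s\<in>X. price s) \<le> 4 * (\<Sum>v<n. fst (s v))"
    by (simp add: sum_distrib_left)
  moreover have "(\<Sum>s\<in>F. \<Sum>p<n. real (x' s p) * d p (loc s)) = transport_cost {..<n} d y"
  proof -
    have "(\<Sum>r<R. \<Sum>p<n. real (x' (v * R + r) p) * d p v) = (\<Sum>p<n. real (y v p) * d v p)"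
      if "v < n" for v
      using sum_x'[OF that, symmetric]
      by (subst sum.swap) (simp add: Metric_space.commute[OF metric, of v] sum_distrib_right)
    then show ?thesis
      by (simp add: transport_cost_def sum_blocks)
  qed
  ultimately have "cfl_cost {..<n} d F loc price (X, x') \<le>
      4 * (\<Sum>v<n. fst (s v)) + transport_cost {..<n} d \<psi>"
    using y(3) by (simp add: cfl_cost_def)
  with sol that show thesis by blast
qed

lemma price_nonneg: "s \<in> F \<Longrightarrow> 0 \<le> price s"
  using R_pos by (simp add: cost_nonneg less_mult_imp_div_less)

lemma cfl_feasible:
  assumes "tcsd_solution {..<n} opts s"
  shows "\<exists>Xx. cfl_solution {..<n} F cap dem Xx"
proof -
  obtain \<psi> where "transport_feasible {..<n} (\<lambda>v. snd (s v)) \<psi>"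
    using assms transport_feasible_exists[of "{..<n}" "\<lambda>v. snd (s v)"]
    by (auto simp: tcsd_solution_def)
  from cfl_of_tcsd[OF assms this] show ?thesis by blast
qed

lemma cfl_opt_le_tcsd_opt:
  assumes "tcsd_solution {..<n} opts s0"
  shows "cfl_opt {..<n} d F loc price cap dem \<le> 4 * tcsd_opt {..<n} d opts"
proof -
  let ?opt = "cfl_opt {..<n} d F loc price cap dem"
  have "?opt / 4 \<le> tcsd_cost {..<n} d s" if s: "tcsd_solution {..<n} opts s" for s
  proof -
    have "?opt / 4 - (\<Sum>v<n. fst (s v)) \<le> TC {..<n} d (\<lambda>v. snd (s v))"
    proof (rule le_TC)
      fix \<psi> assume "transport_feasible {..<n} (\<lambda>v. snd (s v)) \<psi>"
      from cfl_of_tcsd[OF s this] obtain Xx where Xx: "cfl_solution {..<n} F cap dem Xx"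
        "cfl_cost {..<n} d F loc price Xx \<le> 4 * (\<Sum>v<n. fst (s v)) + transport_cost {..<n} d \<psi>" .
      have "?opt \<le> cfl_cost {..<n} d F loc price Xx"
        by (rule cfl_opt_le[OF metric _ Xx(1)]) (rule price_nonneg)
      \<comment> \<open>Division by 4 leaves a quarter of the transport cost; as that cost is
        nonnegative, the full cost may stand there.\<close>
      then show "?opt / 4 - (\<Sum>v<n. fst (s v)) \<le> transport_cost {..<n} d \<psi>"
        using Xx(2) transport_cost_nonneg[OF metric, of \<psi>] by linarith
    qed (use s in \<open>simp_all add: tcsd_solution_def\<close>)
    then show ?thesis
      unfolding tcsd_cost_def by linarith
  qed
  then have "?opt / 4 \<le> tcsd_opt {..<n} d opts"
    by (rule le_tcsd_opt[OF assms])
  then show ?thesis by simp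
qed

lemma tcsd_approx_of_cfl_approx:
  assumes sol: "cfl_approx_solution \<alpha> {..<n} d F loc price cap dem (X, x)"
    and \<rho>: "\<And>v. v < n \<Longrightarrow> \<rho> v < R"
      "\<And>v r. v < n \<Longrightarrow> r < \<rho> v \<Longrightarrow> v * R + r \<notin> X"
      "\<And>v. v < n \<Longrightarrow> v * R + \<rho> v \<in> X \<or> \<rho> v = R - 1"
  shows "tcsd_approx_solution (4 * \<alpha>) {..<n} d opts (\<lambda>v. (g v (\<rho> v), Z v (\<rho> v)))"
proof -
  let ?s = "\<lambda>v. (g v (\<rho> v), Z v (\<rho> v))"
  let ?cfl = "cfl_opt {..<n} d F loc price cap dem" and ?tcsd = "tcsd_opt {..<n} d opts"
  have X: "cfl_solution {..<n} F cap dem (X, x)"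
    and \<alpha>: "cfl_cost {..<n} d F loc price (X, x) \<le> \<alpha> * ?cfl"
    using sol by (auto simp: cfl_approx_solution_def)
  note s = tcsd_of_cfl[OF X \<rho>]
  have cost: "tcsd_cost {..<n} d ?s \<le> \<alpha> * ?cfl"
    using s(2) \<alpha> by simp
  have le: "?cfl \<le> 4 * ?tcsd"
    using cfl_opt_le_tcsd_opt s(1) by blast
  have "tcsd_cost {..<n} d ?s \<le> 4 * \<alpha> * ?tcsd"
  proof (cases "0 \<le> \<alpha>")
    case True
    then show ?thesis
      using cost mult_left_mono[OF le True] by simp
  next
    \<comment> \<open>For negative \<open>\<alpha>\<close> the found cost is at most 0. The optimum
      lies between 0 and the found cost, so it is 0 and the sign of \<open>\<alpha>\<close> no
      longer matters.\<close>
    case False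
    have "0 \<le> ?cfl"
      unfolding cfl_opt_def
    proof (rule cInf_greatest)
      fix a assume "a \<in> cfl_cost {..<n} d F loc price ` {Xx. cfl_solution {..<n} F cap dem Xx}"
      then obtain X' x' where "X' \<subseteq> F" "a = cfl_cost {..<n} d F loc price (X', x')"
        by (auto simp: cfl_solution_def)
      then show "0 \<le> a"
        using cfl_cost_nonneg[OF metric, of F price X'] price_nonneg by blast
    qed (use X in blast)
    then have "\<alpha> * ?cfl \<le> 0"
      using False by (simp add: mult_nonpos_nonneg)
    moreover have "?tcsd \<le> tcsd_cost {..<n} d ?s"
      by (rule tcsd_opt_le[OF inst s(1)])
    moreover have "0 \<le> ?tcsd"
      using le_tcsd_opt[OF s(1)] tcsd_cost_nonneg[OF inst] by blast
    ultimately have "?tcsd = 0" "tcsd_cost {..<n} d ?s \<le> 0"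
      using cost by simp_all
    then show ?thesis by simp
  qed
  with s(1) show ?thesis
    by (simp add: tcsd_approx_solution_def)
qed

end


section \<open>Levels of a list of options\<close>

text \<open>The candidate held by a selection loop after \<open>i\<close> rounds. The levels are
  defined by this loop itself, ties included, so that the programs compute them literally.\<close>

primrec scan :: "(nat \<Rightarrow> nat \<Rightarrow> bool) \<Rightarrow> nat \<Rightarrow> nat \<Rightarrow> nat" where
  "scan C 0 t = t"
| "scan C (Suc i) t = (if C i (scan C i t) then i else scan C i t)"

lemma scan_less: "t < m \<Longrightarrow> i \<le> m \<Longrightarrow> scan C i t < m"
  by (induction i) auto

text \<open>The starting candidate must satisfy \<open>P\<close>, for otherwise it could survive.
  This is why selections under a cost limit start from a cheapest option: its cost is 0 and meets
  every limit.\<close>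

lemma scan_maximum:
  fixes key :: "nat \<Rightarrow> 'a :: linorder" and m t j :: nat
  assumes "P t"
  defines "r \<equiv> scan (\<lambda>i x. P i \<and> key x < key i) m t"
  shows "P r" "j < m \<Longrightarrow> P j \<Longrightarrow> key j \<le> key r"
proof -
  have "P (scan (\<lambda>i x. P i \<and> key x < key i) i t) \<and>
    (\<forall>j<i. P j \<longrightarrow> key j \<le> key (scan (\<lambda>i x. P i \<and> key x < key i) i t))" for i
  proof (induction i)
    case (Suc i)
    then show ?case by (auto simp: less_Suc_eq not_less)
  qed (use assms(1) in simp)
  then show "P r" "j < m \<Longrightarrow> P j \<Longrightarrow> key j \<le> key r"
    by (auto simp: r_def)
qed

type_synonym options = "(rat \<times> int) list"

abbreviation cost :: "options \<Rightarrow> nat \<Rightarrow> rat" where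
  "cost os j \<equiv> fst (os ! j)"

abbreviation gain :: "options \<Rightarrow> nat \<Rightarrow> int" where
  "gain os j \<equiv> snd (os ! j)"

definition cheapest :: "options \<Rightarrow> nat" where
  "cheapest os = scan (\<lambda>j t. cost os j < cost os t) (length os) 0"

definition dearest :: "options \<Rightarrow> nat" where
  "dearest os = scan (\<lambda>j t. cost os t < cost os j) (length os) (cheapest os)"

definition best :: "options \<Rightarrow> nat \<Rightarrow> nat" where
  "best os k = scan (\<lambda>j t. cost os j \<le> cost os k \<and> gain os t < gain os j)
     (length os) (cheapest os)"

text \<open>A threshold is represented by an option of that cost, so indices suffice as data and no
  new rationals are computed.\<close>

definition halve :: "options \<Rightarrow> nat \<Rightarrow> nat" where
  "halve os k = scan (\<lambda>j t. 2 * cost os j \<le> cost os k \<and> cost os t < cost os j)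
     (length os) (cheapest os)"

definition level :: "options \<Rightarrow> nat \<Rightarrow> nat" where
  "level os r = (halve os ^^ r) (dearest os)"

text \<open>The suppliers of levels r, \<dots>, R - 1 together supply the excess of level r over the last
  level, which itself is nonnegative or else becomes the demand.\<close>

definition level_capacity :: "nat \<Rightarrow> options \<Rightarrow> nat \<Rightarrow> int" where
  "level_capacity R os r =
     (if Suc r = R then max 0 (gain os (best os (level os r)))
      else gain os (best os (level os r)) - gain os (best os (level os (Suc r))))"

definition last_supply :: "options \<Rightarrow> int" where
  "last_supply os = gain os (best os (cheapest os))"

lemma level_simps: "level os 0 = dearest os" "level os (Suc r) = halve os (level os r)"
  by (simp_all add: level_def)

text \<open>For surplus levels only the cost 0 is known, not the index; this is enough to identify
  their best option.\<close>

lemma best_cong: "cost os k = cost os k' \<Longrightarrow> best os k = best os k'"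
  by (simp add: best_def)

locale free_option =
  fixes os :: options
  assumes nonneg: "\<And>j. j < length os \<Longrightarrow> 0 \<le> cost os j"
    and zero: "\<exists>j<length os. cost os j = 0"
begin

lemma cheapest_less: "cheapest os < length os"
  unfolding cheapest_def using zero by (intro scan_less) auto

lemma cost_cheapest: "cost os (cheapest os) = 0"
proof -
  obtain j where j: "j < length os" "cost os j = 0"
    using zero by blast
  \<comment> \<open>Minimization as maximization of the negated cost.\<close>
  have "- cost os j \<le> - cost os (cheapest os)"
    using scan_maximum(2)[of "\<lambda>_. True" 0 j "length os" "\<lambda>j. - cost os j"] j(1)
    by (simp add: cheapest_def)
  with j(2) nonneg[OF cheapest_less] show ?thesis by simp
qed

lemma dearest_less: "dearest os < length os"
  unfolding dearest_def by (intro scan_less cheapest_less) simp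

lemma cost_le_dearest: "j < length os \<Longrightarrow> cost os j \<le> cost os (dearest os)"
  using scan_maximum(2)[of "\<lambda>_. True" "cheapest os" j "length os" "cost os"]
  by (simp add: dearest_def)

lemma best_less: "best os k < length os"
  unfolding best_def by (intro scan_less cheapest_less) simp

lemma halve_less: "halve os k < length os"
  unfolding halve_def by (intro scan_less cheapest_less) simp

lemma level_less: "level os r < length os"
  by (cases r) (simp_all add: level_simps dearest_less halve_less)

lemma cost_best: "k < length os \<Longrightarrow> cost os (best os k) \<le> cost os k"
  using scan_maximum(1)[of "\<lambda>j. cost os j \<le> cost os k" "cheapest os" "gain os" "length os"]
    cost_cheapest nonneg
  by (simp add: best_def)

lemma supply_le_best:
  "k < length os \<Longrightarrow> j < length os \<Longrightarrow> cost os j \<le> cost os k \<Longrightarrow> gain os j \<le> gain os (best os k)"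
  using scan_maximum(2)[of "\<lambda>j. cost os j \<le> cost os k" "cheapest os" j "length os" "gain os"]
    cost_cheapest nonneg
  by (simp add: best_def)

lemma cost_halve: "k < length os \<Longrightarrow> 2 * cost os (halve os k) \<le> cost os k"
  using scan_maximum(1)[of "\<lambda>j. 2 * cost os j \<le> cost os k" "cheapest os" "cost os" "length os"]
    cost_cheapest nonneg
  by (simp add: halve_def)

lemma cost_le_halve:
  "k < length os \<Longrightarrow> j < length os \<Longrightarrow> 2 * cost os j \<le> cost os k \<Longrightarrow> cost os j \<le> cost os (halve os k)"
  using scan_maximum(2)[of "\<lambda>j. 2 * cost os j \<le> cost os k" "cheapest os" j "length os" "cost os"]
    cost_cheapest nonneg
  by (simp add: halve_def)

lemma level_decreasing: "cost os (level os (Suc r)) \<le> cost os (level os r)"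
  using cost_halve[OF level_less, of r] nonneg[OF level_less, of "Suc r"] by (simp add: level_simps)

text \<open>\<open>P r\<close> collects the options of positive cost within the \<open>r\<close>-th
  threshold. As long as thresholds are positive, halving expels at least the option that represents
  the old one, so the set is exhausted after at most \<open>length os\<close> rounds.\<close>

lemma level_zero:
  assumes "length os \<le> r"
  shows "cost os (level os r) = 0"
proof -
  define P where "P = (\<lambda>r. {j. j < length os \<and> 0 < cost os j \<and> cost os j \<le> cost os (level os r)})"
  have fin: "finite (P r)" for r
    unfolding P_def by simp
  have "card (P r) + r \<le> length os \<or> cost os (level os r) = 0" for r
  proof (induction r)
    case 0
    have "card (P 0) \<le> card {..<length os}"
      by (rule card_mono) (auto simp: P_def)
    then show ?case by simp
  next
    case (Suc r)
    show ?case
    proof (cases "cost os (level os (Suc r)) = 0")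
      case False
      then have pos: "0 < cost os (level os (Suc r))"
        using nonneg[OF level_less, of "Suc r"] by simp
      moreover have half: "2 * cost os (level os (Suc r)) \<le> cost os (level os r)"
        using cost_halve[OF level_less] by (simp add: level_simps)
      ultimately have "level os r \<in> P r" "level os r \<notin> P (Suc r)"
        using level_less by (auto simp: P_def)
      moreover have "P (Suc r) \<subseteq> P r"
        using level_decreasing[of r] by (auto simp: P_def)
      ultimately have "card (P (Suc r)) < card (P r)"
        using fin by (intro psubset_card_mono) auto
      then show ?thesis
        using Suc pos half by auto
    qed simp
  qed
  from this[of r] show ?thesis
  proof
    assume "card (P r) + r \<le> length os"
    with assms have "card (P r) = 0" by linarith
    then have "P r = {}" using fin by simp
    moreover have "level os r \<in> P r \<or> cost os (level os r) = 0"
      using nonneg[OF level_less, of r] level_less by (auto simp: P_def)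
    ultimately show ?thesis by blast
  qed
qed

text \<open>A lower threshold admits fewer options, so the best supply can only drop. Differences of
  successive levels can thus serve as capacities.\<close>

lemma supply_level_decreasing:
  "gain os (best os (level os (Suc r))) \<le> gain os (best os (level os r))"
  using cost_best[OF level_less] level_decreasing[of r]
  by (intro supply_le_best level_less best_less) (blast intro: order_trans)

lemma level_capacity_nonneg: "0 \<le> level_capacity R os r"
  using supply_level_decreasing[of r] by (simp add: level_capacity_def)

lemma best_last: "length os \<le> r \<Longrightarrow> best os (level os r) = best os (cheapest os)"
  by (rule best_cong) (simp add: level_zero cost_cheapest)

text \<open>The differences telescope down to level \<open>R - 1\<close>, whose threshold is 0
  because \<open>length os < R\<close>; the identity \<open>max 0 z = z + max 0 (- z)\<close> splits
  its capacity into supply and demand.\<close>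

lemma sum_level_capacity:
  assumes "length os < R" "r < R"
  shows "(\<Sum>q = r..<R. level_capacity R os q) =
    gain os (best os (level os r)) + max 0 (- last_supply os)"
proof -
  have "(\<Sum>q = r..<R. level_capacity R os q) =
      (\<Sum>q = r..<R - 1. level_capacity R os q) + level_capacity R os (R - 1)"
    using assms(2) sum.atLeastLessThan_Suc[of r "R - 1" "level_capacity R os"] by simp
  also have "(\<Sum>q = r..<R - 1. level_capacity R os q) =
      (\<Sum>q = r..<R - 1. - gain os (best os (level os (Suc q))) - - gain os (best os (level os q)))"
    by (intro sum.cong) (auto simp: level_capacity_def)
  also have "\<dots> = gain os (best os (level os r)) - gain os (best os (level os (R - 1)))"
    using assms(2) by (subst sum_Suc_diff') auto
  finally show ?thesis
    using assms best_last[of "R - 1"] by (simp add: level_capacity_def last_supply_def)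
qed

text \<open>Thresholds at least halve, so everything after level \<open>r\<close> costs at most as
  much as level \<open>r\<close> itself. This is one factor 2; the other is lost in
  \<open>level_for_option\<close>.\<close>

lemma sum_level_costs: "(\<Sum>q = r..<R. cost os (level os q)) \<le> 2 * cost os (level os r)"
proof (induction "R - r" arbitrary: r)
  case 0
  then show ?case using nonneg[OF level_less] by simp
next
  case (Suc k)
  then have "(\<Sum>q = r..<R. cost os (level os q)) =
      cost os (level os r) + (\<Sum>q = Suc r..<R. cost os (level os q))"
    by (simp add: sum.atLeast_Suc_lessThan)
  also have "\<dots> \<le> cost os (level os r) + 2 * cost os (level os (Suc r))"
    using Suc by simp
  also have "\<dots> \<le> 2 * cost os (level os r)"
    using cost_halve[OF level_less, of r] by (simp add: level_simps)
  finally show ?case .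
qed

text \<open>The first level of cost at most twice that of the option j still costs at least as much as j.\<close>

lemma level_for_option:
  assumes "j < length os" "length os < R"
  obtains r where "r < R" "gain os j \<le> gain os (best os (level os r))"
    "(\<Sum>q = r..<R. cost os (level os q)) \<le> 4 * cost os j"
proof -
  define r where "r = (LEAST r. cost os (level os r) \<le> 2 * cost os j)"
  have "cost os (level os (length os)) \<le> 2 * cost os j"
    using level_zero nonneg[OF assms(1)] by simp
  then have r: "cost os (level os r) \<le> 2 * cost os j" "r \<le> length os"
    unfolding r_def by (rule LeastI, rule Least_le)
  have "cost os j \<le> cost os (level os r)"
  proof (cases r)
    case 0
    then show ?thesis using cost_le_dearest[OF assms(1)] by (simp add: level_simps)
  next
    \<comment> \<open>By minimality of \<open>r\<close>, level \<open>q\<close> costs more than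
      \<open>2 * cost os j\<close>, so \<open>j\<close> was eligible when the next threshold was
      selected.\<close>
    case (Suc q)
    then have "2 * cost os j \<le> cost os (level os q)"
      using not_less_Least[of q "\<lambda>r. cost os (level os r) \<le> 2 * cost os j"] by (simp add: r_def)
    then show ?thesis
      using cost_le_halve[OF level_less assms(1)] Suc by (simp add: level_simps)
  qed
  then have "gain os j \<le> gain os (best os (level os r))"
    by (intro supply_le_best level_less assms(1))
  moreover have "(\<Sum>q = r..<R. cost os (level os q)) \<le> 4 * cost os j"
    using sum_level_costs[of r R] r(1) by linarith
  moreover have "r < R"
    using r(2) assms(2) by simp
  ultimately show thesis using that by blast
qed

end


section \<open>Machine programs for the levels and for the facility location input\<close>

section \<open>Computing the levels\<close>

abbreviation numer :: "rat \<Rightarrow> int" where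
  "numer q \<equiv> fst (quotient_of q)"

abbreviation denom :: "rat \<Rightarrow> int" where
  "denom q \<equiv> snd (quotient_of q)"

text \<open>Denominators from \<open>quotient_of\<close> are positive, so the programs compare
  rationals by cross multiplication and never divide.\<close>

lemma numer_le_iff: "numer p * denom q \<le> numer q * denom p \<longleftrightarrow> p \<le> q"
  by (subst rat_less_eq_code) (simp add: case_prod_beta Let_def mult.commute)

lemma double_numer_le_iff: "2 * (numer p * denom q) \<le> numer q * denom p \<longleftrightarrow> 2 * p \<le> q"
proof -
  have pos: "0 < denom p" "0 < denom q"
    by (simp_all add: quotient_of_denom_pos')
  have eq: "of_int (numer x) = x * of_int (denom x)" for x
  proof -
    have "x = of_int (numer x) / of_int (denom x)"
      by (rule quotient_of_div) simp
    moreover have "of_int (denom x) \<noteq> (0 :: rat)"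
      using quotient_of_denom_pos'[of x] by simp
    ultimately show ?thesis
      using nonzero_eq_divide_eq[of "of_int (denom x)" x "of_int (numer x)"] by metis
  qed
  have "2 * (numer p * denom q) \<le> numer q * denom p \<longleftrightarrow>
      2 * (of_int (numer p) * of_int (denom q)) \<le> (of_int (numer q) * of_int (denom p) :: rat)"
    by (metis (mono_tags) of_int_le_iff of_int_mult of_int_numeral)
  also have "\<dots> \<longleftrightarrow> 2 * p * of_int (denom p * denom q) \<le> q * of_int (denom p * denom q)"
    by (simp add: eq ac_simps)
  also have "\<dots> \<longleftrightarrow> 2 * p \<le> q"
    using pos by (intro mult_le_cancel_right_pos) simp
  finally show ?thesis .
qed

definition stored_at :: "(int \<Rightarrow> int) \<Rightarrow> int \<Rightarrow> options \<Rightarrow> bool" where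
  "stored_at \<mu> b os \<longleftrightarrow> \<mu> b = int (length os) \<and> (\<forall>j<length os.
     \<mu> (b + 1 + 3 * int j) = numer (cost os j) \<and> \<mu> (b + 2 + 3 * int j) = denom (cost os j) \<and>
     \<mu> (b + 3 + 3 * int j) = gain os j)"

text \<open>Arrays 3 to 13 hold one variable each, at index 0: the address of the options of the current
  point (3), the current point, level and supplier (4, 5, 6), loop counters (7, 13), and options of
  the current point (8 to 12).\<close>

abbreviation option_field :: "int \<Rightarrow> nat \<Rightarrow> aexp" where
  "option_field k x \<equiv> Read 0 (Add (Add (Var 3) (Const k)) (Mul (Const 3) (Var x)))"

abbreviation cost_less :: "nat \<Rightarrow> nat \<Rightarrow> aexp" where
  "cost_less x y \<equiv> Sub (Mul (option_field 1 y) (option_field 2 x))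
     (Mul (option_field 1 x) (option_field 2 y))"

text \<open>\<open>Branch\<close> tests for a positive value; the summand 1 makes the comparison of
  integers non-strict. The factor \<open>k\<close> is 1 for \<open>best\<close> and 2 for
  \<open>halve\<close>.\<close>

abbreviation cost_le :: "int \<Rightarrow> nat \<Rightarrow> nat \<Rightarrow> aexp" where
  "cost_le k x y \<equiv> Add (Const 1) (Sub (Mul (option_field 1 y) (option_field 2 x))
     (Mul (Const k) (Mul (option_field 1 x) (option_field 2 y))))"

text \<open>The nested branches stand for a conjunction; selections with a single condition use
  \<open>Const 1\<close> as the first. The candidate lives in array \<open>t\<close>, the index in
  array 7.\<close>

definition select_prog :: "nat \<Rightarrow> aexp \<Rightarrow> aexp \<Rightarrow> aexp \<Rightarrow> prog" where
  "select_prog t e p q = Seq (Assign t e)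
     (For 7 (Read 0 (Var 3)) (Branch p (Branch q (Assign t (Var 7)) Nop) Nop))"

text \<open>The loop computes \<open>scan C\<close> by construction. Of the budget, a round takes 3
  steps for the branches and the assignment and 2 for the loop; 3 more are spent outside the
  rounds.\<close>

lemma wp_select:
  assumes t: "t \<notin> {0, 3, 7}"
    and e: "aval e \<sigma> = int t0" "t0 < m"
    and m: "\<sigma> 0 (\<sigma> 3 0) = int m"
    and cond: "\<And>\<tau> i x. (\<And>a. a \<notin> {7, t} \<Longrightarrow> \<tau> a = \<sigma> a) \<Longrightarrow> \<tau> 7 0 = int i \<Longrightarrow> \<tau> t 0 = int x \<Longrightarrow>
      i < m \<Longrightarrow> x < m \<Longrightarrow> 0 < aval p \<tau> \<and> 0 < aval q \<tau> \<longleftrightarrow> C i x"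
    and post: "\<And>\<tau>. (\<And>a. a \<notin> {7, t} \<Longrightarrow> \<tau> a = \<sigma> a) \<Longrightarrow> \<tau> t 0 = int (scan C m t0) \<Longrightarrow> Q \<tau>"
  shows "wp (select_prog t e p q) (5 * m + 3) Q \<sigma>"
proof -
  let ?\<sigma> = "\<sigma>(t := (\<sigma> t)(0 := int t0))"
  let ?body = "Branch p (Branch q (Assign t (Var 7)) Nop) Nop"
  have "wp (For 7 (Read 0 (Var 3)) ?body) (2 + m * (3 + 2)) Q ?\<sigma>"
  proof (rule wp_For[where Inv = "\<lambda>i \<tau>. \<tau> t 0 = int (scan C i t0)"])
    fix i \<tau>
    assume i: "i < m" "\<tau> t 0 = int (scan C i t0)" "\<tau> 7 0 = int i"
      and frame: "\<And>a. a \<notin> insert 7 (writes ?body) \<Longrightarrow> \<tau> a = ?\<sigma> a"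
    have "0 < aval p \<tau> \<and> 0 < aval q \<tau> \<longleftrightarrow> C i (scan C i t0)"
      using i scan_less[OF e(2), of i C] frame by (intro cond) auto
    then have "wp ?body (Suc (max (Suc (max 1 1)) 1))
        (\<lambda>\<tau>'. (\<tau>'(7 := (\<tau>' 7)(0 := int (Suc i)))) t 0 = int (scan C (Suc i) t0)) \<tau>"
      using i t by (intro wp_Branch wp_Write wp_Nop) auto
    then show "wp ?body 3
        (\<lambda>\<tau>'. (\<tau>'(7 := (\<tau>' 7)(0 := int (Suc i)))) t 0 = int (scan C (Suc i) t0)) \<tau>"
      by (simp add: numeral_3_eq_3)
  next
    fix \<tau> assume "\<tau> t 0 = int (scan C m t0)" "\<And>a. a \<notin> insert 7 (writes ?body) \<Longrightarrow> \<tau> a = ?\<sigma> a"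
    then show "Q \<tau>" by (intro post) auto
  qed (use t m in auto)
  then have "wp (select_prog t e p q) (1 + (2 + m * (3 + 2))) Q \<sigma>"
    unfolding select_prog_def using e(1) by (intro wp_Seq wp_Write) simp
  moreover have "1 + (2 + m * (3 + 2)) = 5 * m + 3" by simp
  ultimately show ?thesis by (simp only:)
qed

abbreviation cheapest_prog :: prog where
  "cheapest_prog \<equiv> select_prog 8 (Const 0) (Const 1) (cost_less 7 8)"

abbreviation dearest_prog :: prog where
  "dearest_prog \<equiv> select_prog 9 (Var 8) (Const 1) (cost_less 9 7)"

abbreviation best_prog :: "nat \<Rightarrow> nat \<Rightarrow> prog" where
  "best_prog t x \<equiv> select_prog t (Var 8) (cost_le 1 7 x) (Sub (option_field 3 7) (option_field 3 t))"

abbreviation halve_prog :: "nat \<Rightarrow> nat \<Rightarrow> prog" where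
  "halve_prog t x \<equiv> select_prog t (Var 8) (cost_le 2 7 x) (cost_less t 7)"

context free_option
begin

lemma aval_cost_less:
  assumes "stored_at (\<tau> 0) (\<tau> 3 0) os" "\<tau> x 0 = int i" "\<tau> y 0 = int j"
    "i < length os" "j < length os"
  shows "0 < aval (cost_less x y) \<tau> \<longleftrightarrow> cost os i < cost os j"
  using assms numer_le_iff[of "cost os j" "cost os i"]
  by (simp add: stored_at_def flip: not_le)

lemma aval_cost_le:
  assumes "stored_at (\<tau> 0) (\<tau> 3 0) os" "\<tau> x 0 = int i" "\<tau> y 0 = int j"
    "i < length os" "j < length os"
  shows "0 < aval (cost_le 1 x y) \<tau> \<longleftrightarrow> cost os i \<le> cost os j"
    "0 < aval (cost_le 2 x y) \<tau> \<longleftrightarrow> 2 * cost os i \<le> cost os j"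
proof -
  have fields: "aval (option_field 1 x) \<tau> = numer (cost os i)" "aval (option_field 2 x) \<tau> = denom (cost os i)"
    "aval (option_field 1 y) \<tau> = numer (cost os j)" "aval (option_field 2 y) \<tau> = denom (cost os j)"
    using assms by (simp_all add: stored_at_def)
  have eval: "aval (cost_le k x y) \<tau> =
      1 + (numer (cost os j) * denom (cost os i) - k * (numer (cost os i) * denom (cost os j)))" for k
    by (simp only: aval.simps(1,3-5) fields)
  show "0 < aval (cost_le 1 x y) \<tau> \<longleftrightarrow> cost os i \<le> cost os j"
    unfolding eval numer_le_iff[symmetric] by linarith
  show "0 < aval (cost_le 2 x y) \<tau> \<longleftrightarrow> 2 * cost os i \<le> cost os j"
    unfolding eval double_numer_le_iff[symmetric] by linarith
qed

lemma aval_gain: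
  assumes "stored_at (\<tau> 0) (\<tau> 3 0) os" "\<tau> x 0 = int i" "i < length os"
  shows "aval (option_field 3 x) \<tau> = gain os i"
  using assms by (simp add: stored_at_def)

lemma stored_length: "stored_at \<mu> b os \<Longrightarrow> \<mu> b = int (length os)"
  by (simp add: stored_at_def)

lemma wp_cheapest:
  assumes "stored_at (\<sigma> 0) (\<sigma> 3 0) os"
    and "\<And>\<tau>. (\<And>a. a \<notin> {7, 8} \<Longrightarrow> \<tau> a = \<sigma> a) \<Longrightarrow> \<tau> 8 0 = int (cheapest os) \<Longrightarrow> Q \<tau>"
  shows "wp cheapest_prog (5 * length os + 3) Q \<sigma>"
proof (rule wp_select[where C = "\<lambda>j t. cost os j < cost os t"])
  show "0 < length os" using cheapest_less by linarith
  fix \<tau> i x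
  assume "\<And>a. a \<notin> {7, 8} \<Longrightarrow> \<tau> a = \<sigma> a" "\<tau> 7 0 = int i" "\<tau> 8 0 = int x" "i < length os" "x < length os"
  then show "0 < aval (Const 1) \<tau> \<and> 0 < aval (cost_less 7 8) \<tau> \<longleftrightarrow> cost os i < cost os x"
    using assms(1) by (subst aval_cost_less) simp_all
qed (use assms stored_length in \<open>auto simp: cheapest_def\<close>)

lemma wp_dearest:
  assumes "stored_at (\<sigma> 0) (\<sigma> 3 0) os" "\<sigma> 8 0 = int (cheapest os)"
    and "\<And>\<tau>. (\<And>a. a \<notin> {7, 9} \<Longrightarrow> \<tau> a = \<sigma> a) \<Longrightarrow> \<tau> 9 0 = int (dearest os) \<Longrightarrow> Q \<tau>"
  shows "wp dearest_prog (5 * length os + 3) Q \<sigma>"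
proof (rule wp_select[where C = "\<lambda>j t. cost os t < cost os j"])
  show "cheapest os < length os" by (rule cheapest_less)
  fix \<tau> i x
  assume "\<And>a. a \<notin> {7, 9} \<Longrightarrow> \<tau> a = \<sigma> a" "\<tau> 7 0 = int i" "\<tau> 9 0 = int x" "i < length os" "x < length os"
  then show "0 < aval (Const 1) \<tau> \<and> 0 < aval (cost_less 9 7) \<tau> \<longleftrightarrow> cost os x < cost os i"
    using assms(1) by (subst aval_cost_less) simp_all
qed (use assms stored_length in \<open>auto simp: dearest_def\<close>)

lemma wp_best:
  assumes "stored_at (\<sigma> 0) (\<sigma> 3 0) os" "\<sigma> 8 0 = int (cheapest os)"
    "t \<notin> {0, 3, 7, x}" "x \<noteq> 7" "\<sigma> x 0 = int k" "k < length os"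
    and "\<And>\<tau>. (\<And>a. a \<notin> {7, t} \<Longrightarrow> \<tau> a = \<sigma> a) \<Longrightarrow> \<tau> t 0 = int (best os k) \<Longrightarrow> Q \<tau>"
  shows "wp (best_prog t x) (5 * length os + 3) Q \<sigma>"
proof (rule wp_select[where C = "\<lambda>j t. cost os j \<le> cost os k \<and> gain os t < gain os j"])
  show "cheapest os < length os" by (rule cheapest_less)
  fix \<tau> i y
  assume \<tau>: "\<And>a. a \<notin> {7, t} \<Longrightarrow> \<tau> a = \<sigma> a" "\<tau> 7 0 = int i" "\<tau> t 0 = int y" "i < length os" "y < length os"
  then have stored: "stored_at (\<tau> 0) (\<tau> 3 0) os" and x: "\<tau> x 0 = int k"
    using assms(1,3,4,5) by auto
  have "aval (Sub (option_field 3 7) (option_field 3 t)) \<tau> = gain os i - gain os y"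
    by (simp only: aval.simps(4) aval_gain[OF stored \<tau>(2,4)] aval_gain[OF stored \<tau>(3,5)])
  then show "0 < aval (cost_le 1 7 x) \<tau> \<and> 0 < aval (Sub (option_field 3 7) (option_field 3 t)) \<tau> \<longleftrightarrow>
      cost os i \<le> cost os k \<and> gain os y < gain os i"
    unfolding aval_cost_le(1)[OF stored \<tau>(2) x \<tau>(4) assms(6)] by linarith
qed (use assms stored_length in \<open>auto simp: best_def\<close>)

lemma wp_halve:
  assumes "stored_at (\<sigma> 0) (\<sigma> 3 0) os" "\<sigma> 8 0 = int (cheapest os)"
    "t \<notin> {0, 3, 7, x}" "x \<noteq> 7" "\<sigma> x 0 = int k" "k < length os"
    and "\<And>\<tau>. (\<And>a. a \<notin> {7, t} \<Longrightarrow> \<tau> a = \<sigma> a) \<Longrightarrow> \<tau> t 0 = int (halve os k) \<Longrightarrow> Q \<tau>"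
  shows "wp (halve_prog t x) (5 * length os + 3) Q \<sigma>"
proof (rule wp_select[where C = "\<lambda>j t. 2 * cost os j \<le> cost os k \<and> cost os t < cost os j"])
  show "cheapest os < length os" by (rule cheapest_less)
  fix \<tau> i y
  assume \<tau>: "\<And>a. a \<notin> {7, t} \<Longrightarrow> \<tau> a = \<sigma> a" "\<tau> 7 0 = int i" "\<tau> t 0 = int y" "i < length os" "y < length os"
  then have stored: "stored_at (\<tau> 0) (\<tau> 3 0) os" and x: "\<tau> x 0 = int k"
    using assms(1,3,4,5) by auto
  show "0 < aval (cost_le 2 7 x) \<tau> \<and> 0 < aval (cost_less t 7) \<tau> \<longleftrightarrow>
      2 * cost os i \<le> cost os k \<and> cost os y < cost os i"
    unfolding aval_cost_le(2)[OF stored \<tau>(2) x \<tau>(4) assms(6)]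
      aval_cost_less[OF stored \<tau>(3,2,5,4)] by simp
qed (use assms stored_length in \<open>auto simp: halve_def\<close>)

end


section \<open>The program\<close>

abbreviation count_exp :: aexp where
  "count_exp \<equiv> Read 0 (Const 0)"

abbreviation size_exp :: aexp where
  "size_exp \<equiv> Read 0 (Const 1)"

text \<open>Array 20 holds its length and the numbers of points and suppliers in cells 0 to 2, then
  the matrix, four numbers per supplier and the demands. Array 13 keeps the matrix size
  \<open>2 * (n * n)\<close> from the copying loop and array 6 counts suppliers, so that
  \<open>k\<close> from 3 to 6 selects location, numerator, denominator and capacity.\<close>

abbreviation supplier_addr :: "int \<Rightarrow> aexp" where
  "supplier_addr k \<equiv> Add (Add (Const k) (Var 13)) (Mul (Const 4) (Var 6))"

abbreviation demand_addr :: aexp where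
  "demand_addr \<equiv> Add (Add (Add (Const 3) (Var 13)) (Mul (Const 4) (Mul size_exp count_exp))) (Var 4)"

text \<open>A capacity involves two successive levels, so the next one is computed into arrays 11
  and 12 while the current one is still in 9 and 10; it moves over at the end. Array 2 remembers the
  option of each supplier for decoding.\<close>

definition level_prog :: prog where
  "level_prog =
     Seq (halve_prog 11 9)
    (Seq (best_prog 12 11)
    (Seq (Write 2 (Var 6) (Var 10))
    (Seq (Write 20 (supplier_addr 3) (Var 4))
    (Seq (Write 20 (supplier_addr 4) (option_field 1 9))
    (Seq (Write 20 (supplier_addr 5) (option_field 2 9))
    (Seq (Write 20 (supplier_addr 6) (Sub (option_field 3 10) (option_field 3 12)))
    (Seq (Assign 9 (Var 11))
    (Seq (Assign 10 (Var 12))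
         (Assign 6 (Add (Var 6) (Const 1)))))))))))"

text \<open>Here array 6 already points behind the last supplier, whose capacity is therefore found one
  cell before the next supplier.\<close>

definition demand_prog :: prog where
  "demand_prog =
     Seq (Branch (option_field 3 10)
       (Seq (Write 20 (supplier_addr 2) (option_field 3 10)) (Write 20 demand_addr (Const 0)))
       (Write 20 demand_addr (Sub (Const 0) (option_field 3 10))))
    (Seq (Write 1 (Add (Const 1) (Var 4)) (Var 10))
         (Assign 3 (Add (Add (Var 3) (Const 1))
           (Add (Read 0 (Var 3)) (Add (Read 0 (Var 3)) (Read 0 (Var 3)))))))"

definition point_prog :: prog where
  "point_prog =
     Seq cheapest_prog
    (Seq dearest_prog
    (Seq (best_prog 10 9)
    (Seq (For 5 count_exp level_prog)
         demand_prog)))"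

text \<open>The input of the algorithm for facility location is built in array 20, to which that
  algorithm is relocated.\<close>

definition build_prog :: prog where
  "build_prog =
     Seq (Write 1 (Const 0) size_exp)
    (Seq (Write 20 (Const 1) size_exp)
    (Seq (For 13 (Mul (Const 2) (Mul size_exp size_exp))
       (Write 20 (Add (Const 3) (Var 13)) (Read 0 (Add (Const 2) (Var 13)))))
    (Seq (Assign 3 (Add (Const 2) (Var 13)))
    (Seq (For 4 size_exp point_prog)
    (Seq (Write 20 (Const 2) (Var 6))
         (Write 20 (Const 0) (Add (Add (Const 2) (Var 13)) (Add size_exp
           (Add (Add (Var 6) (Var 6)) (Add (Var 6) (Var 6)))))))))))"

text \<open>Suppliers are inspected by decreasing level, so that the lowest open level wins.\<close>

definition decode_prog :: prog where
  "decode_prog = For 4 size_exp (For 5 count_exp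
     (Branch (Read 21 (Sub (Add (Mul (Var 4) count_exp) count_exp) (Var 5)))
       (Write 1 (Add (Const 1) (Var 4))
         (Read 2 (Sub (Add (Mul (Var 4) count_exp) count_exp) (Add (Var 5) (Const 1)))))
       Nop))"

text \<open>Budgets in one variable, to be read as \<open>R\<close>, which bounds the number of
  points, the matrix size and the length of every option list.\<close>

definition build_steps :: "nat \<Rightarrow> nat" where
  "build_steps x = 9 + 3 * x + x * (18 + 15 * x + x * (10 * x + 16))"

definition decode_steps :: "nat \<Rightarrow> nat" where
  "decode_steps x = 2 + x * (4 * x + 4)"

text \<open>Naming the new state avoids the exponential growth of nested updates.\<close>

lemma wp_assign:
  assumes "\<And>\<tau>. (\<And>b. b \<noteq> a \<Longrightarrow> \<tau> b = \<sigma> b) \<Longrightarrow> \<tau> a = (\<sigma> a)(aval e \<sigma> := aval e' \<sigma>) \<Longrightarrow> Q \<tau>"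
  shows "wp (Write a e e') 1 Q \<sigma>"
  using assms by (intro wp_Write) simp

lemma affine_select [simp]:
  "affine_prog (select_prog t e p q) \<longleftrightarrow> affine e \<and> div_free p \<and> div_free q"
  by (simp add: select_prog_def)

lemma writes_select [simp]: "writes (select_prog t e p q) = {t, 7}"
  by (auto simp: select_prog_def)

lemma affine_build: "affine_prog build_prog"
  by (simp add: build_prog_def point_prog_def level_prog_def demand_prog_def)

lemma affine_decode: "affine_prog decode_prog"
  by (simp add: decode_prog_def)

lemma writes_level: "writes level_prog = {2, 6, 7, 9, 10, 11, 12, 20}"
  by (auto simp: level_prog_def)

lemma writes_demand: "writes demand_prog = {1, 3, 20}"
  by (auto simp: demand_prog_def)

lemma writes_point: "writes point_prog = {1, 2, 3, 5, 6, 7, 8, 9, 10, 11, 12, 20}"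
  by (auto simp: point_prog_def writes_level writes_demand)

context free_option
begin

lemma wp_level:
  assumes os: "stored_at (\<sigma> 0) (\<sigma> 3 0) os" and "\<sigma> 8 0 = int (cheapest os)"
    and k: "\<sigma> 9 0 = int k" "k < length os" "\<sigma> 10 0 = int (best os k)"
  defines "A \<equiv> 3 + \<sigma> 13 0 + 4 * \<sigma> 6 0"
  shows "wp level_prog (10 * length os + 14)
    (\<lambda>\<tau>. \<tau> 9 0 = int (halve os k) \<and> \<tau> 10 0 = int (best os (halve os k)) \<and> \<tau> 6 0 = \<sigma> 6 0 + 1 \<and>
      \<tau> 2 = (\<sigma> 2)(\<sigma> 6 0 := int (best os k)) \<and>
      \<tau> 20 = (\<sigma> 20)(A := \<sigma> 4 0, A + 1 := numer (cost os k), A + 2 := denom (cost os k),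
        A + 3 := gain os (best os k) - gain os (best os (halve os k)))) \<sigma>"
    (is "wp _ _ ?Q _")
proof -
  have "wp level_prog (5 * length os + 3 + (5 * length os + 3 + (1 + (1 + (1 + (1 + (1 + (1 + (1 + 1)))))))))
      ?Q \<sigma>"
    unfolding level_prog_def
  proof (rule wp_Seq, rule wp_halve[OF os assms(2) _ _ k(1,2)], goal_cases)
    case (3 \<tau>)
    have os\<tau>: "stored_at (\<tau> 0) (\<tau> 3 0) os" "\<tau> 8 0 = int (cheapest os)"
      using 3(1) assms by simp_all
    show ?case
    proof (rule wp_Seq, rule wp_best[OF os\<tau> _ _ 3(2) halve_less], goal_cases)
      case (3 \<tau>')
      then have fr: "\<tau>' a = \<sigma> a" if "a \<notin> {7, 11, 12}" for a
        using \<open>\<And>a. a \<notin> {7, 11} \<Longrightarrow> \<tau> a = \<sigma> a\<close> that by simp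
      have "\<tau>' 11 0 = int (halve os k)"
        using 3 \<open>\<tau> 11 0 = int (halve os k)\<close> by simp
      moreover have "\<sigma> 0 (\<sigma> 3 0 + 1 + 3 * int k) = numer (cost os k)"
        "\<sigma> 0 (\<sigma> 3 0 + 2 + 3 * int k) = denom (cost os k)"
        "\<sigma> 0 (\<sigma> 3 0 + 3 + 3 * int (best os j)) = gain os (best os j)" for j
        using os k best_less by (simp_all add: stored_at_def)
      moreover have "3 + \<sigma> 13 0 + 4 * \<sigma> 6 0 + 1 = 4 + \<sigma> 13 0 + 4 * \<sigma> 6 0"
        "3 + \<sigma> 13 0 + 4 * \<sigma> 6 0 + 2 = 5 + \<sigma> 13 0 + 4 * \<sigma> 6 0"
        "3 + \<sigma> 13 0 + 4 * \<sigma> 6 0 + 3 = 6 + \<sigma> 13 0 + 4 * \<sigma> 6 0"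
        by simp_all
      ultimately show ?case
        using k(1,3) 3(2) unfolding A_def
        by (intro wp_Seq wp_assign) (simp add: fr add.assoc)
    qed simp_all
  qed simp_all
  then show ?thesis
    by (rule wp_frame) simp_all
qed

lemma wp_demand:
  assumes os: "stored_at (\<sigma> 0) (\<sigma> 3 0) os" and k: "\<sigma> 10 0 = int k" "k < length os"
  defines "A \<equiv> 2 + \<sigma> 13 0 + 4 * \<sigma> 6 0"
    and "D \<equiv> 3 + \<sigma> 13 0 + 4 * (\<sigma> 0 1 * \<sigma> 0 0) + \<sigma> 4 0"
  shows "wp demand_prog 5
    (\<lambda>\<tau>. \<tau> 1 = (\<sigma> 1)(1 + \<sigma> 4 0 := int k) \<and> \<tau> 3 0 = \<sigma> 3 0 + int (1 + 3 * length os) \<and>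
      \<tau> 20 = (if 0 < gain os k then (\<sigma> 20)(A := gain os k, D := 0)
        else (\<sigma> 20)(D := - gain os k))) \<sigma>"
    (is "wp _ _ ?Q _")
proof -
  have z: "\<sigma> 0 (\<sigma> 3 0 + 3 + 3 * int k) = gain os k" and m: "\<sigma> 0 (\<sigma> 3 0) = int (length os)"
    using os k by (simp_all add: stored_at_def)
  have "wp demand_prog (Suc (max (1 + 1) 1) + (1 + 1)) ?Q \<sigma>"
    unfolding demand_prog_def
  proof (rule wp_Seq, rule wp_Branch)
    assume "0 < aval (option_field 3 10) \<sigma>"
    then show "wp (Seq (Write 20 (supplier_addr 2) (option_field 3 10)) (Write 20 demand_addr (Const 0))) (1 + 1)
        (wp (Seq (Write 1 (Add (Const 1) (Var 4)) (Var 10)) (Assign 3 (Add (Add (Var 3) (Const 1))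
          (Add (Read 0 (Var 3)) (Add (Read 0 (Var 3)) (Read 0 (Var 3))))))) (1 + 1) ?Q) \<sigma>"
      by (intro wp_Seq wp_Write) (simp add: z m k A_def D_def)
  next
    assume "aval (option_field 3 10) \<sigma> \<le> 0"
    then show "wp (Write 20 demand_addr (Sub (Const 0) (option_field 3 10))) 1
        (wp (Seq (Write 1 (Add (Const 1) (Var 4)) (Var 10)) (Assign 3 (Add (Add (Var 3) (Const 1))
          (Add (Read 0 (Var 3)) (Add (Read 0 (Var 3)) (Read 0 (Var 3))))))) (1 + 1) ?Q) \<sigma>"
      by (intro wp_Seq wp_Write) (simp add: z m k A_def D_def)
  qed
  then show ?thesis
    by (rule wp_frame) simp_all
qed

text \<open>A point overwrites the capacity of its last supplier: before, it is the difference 0 of two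
  levels of cost 0.\<close>

lemma wp_point:
  assumes os: "stored_at (\<sigma> 0) (\<sigma> 3 0) os"
    and R: "\<sigma> 0 0 = int R" "length os < R"
    and s: "\<sigma> 6 0 = int s"
  defines "A \<equiv> (\<lambda>r. 3 + \<sigma> 13 0 + 4 * int (s + r))"
    and "D \<equiv> 3 + \<sigma> 13 0 + 4 * (\<sigma> 0 1 * int R) + \<sigma> 4 0"
  assumes D: "A R \<le> D"
  shows "wp point_prog (16 + 15 * length os + R * (10 * length os + 16))
    (\<lambda>\<tau>. \<tau> 3 0 = \<sigma> 3 0 + int (1 + 3 * length os) \<and> \<tau> 6 0 = int (s + R) \<and>
      \<tau> 1 = (\<sigma> 1)(1 + \<sigma> 4 0 := int (best os (level os (R - 1)))) \<and>
      (\<forall>r<R. \<tau> 2 (int (s + r)) = int (best os (level os r)) \<and>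
        \<tau> 20 (A r) = \<sigma> 4 0 \<and> \<tau> 20 (A r + 1) = numer (cost os (level os r)) \<and>
        \<tau> 20 (A r + 2) = denom (cost os (level os r)) \<and>
        \<tau> 20 (A r + 3) = level_capacity R os r) \<and>
      \<tau> 20 D = max 0 (- last_supply os) \<and>
      (\<forall>j. j < A 0 \<or> A R \<le> j \<and> j \<noteq> D \<longrightarrow> \<tau> 20 j = \<sigma> 20 j) \<and>
      (\<forall>j. j < int s \<longrightarrow> \<tau> 2 j = \<sigma> 2 j)) \<sigma>"
    (is "wp _ _ ?Q _")
proof -
  \<comment> \<open>The invariant records plain differences even for the last level;
    \<open>demand_prog\<close> corrects that one after the loop.\<close>
  define Inv where "Inv = (\<lambda>r (\<tau> :: memory). \<tau> 9 0 = int (level os r) \<and>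
    \<tau> 10 0 = int (best os (level os r)) \<and> \<tau> 6 0 = int (s + r) \<and>
    (\<forall>q<r. \<tau> 2 (int (s + q)) = int (best os (level os q)) \<and>
      \<tau> 20 (A q) = \<sigma> 4 0 \<and> \<tau> 20 (A q + 1) = numer (cost os (level os q)) \<and>
      \<tau> 20 (A q + 2) = denom (cost os (level os q)) \<and>
      \<tau> 20 (A q + 3) = gain os (best os (level os q)) - gain os (best os (level os (Suc q)))) \<and>
    (\<forall>j. j < A 0 \<or> A r \<le> j \<longrightarrow> \<tau> 20 j = \<sigma> 20 j) \<and>
    (\<forall>j. j < int s \<longrightarrow> \<tau> 2 j = \<sigma> 2 j))"
  have loop: "wp (For 5 count_exp level_prog) (2 + R * ((10 * length os + 14) + 2))
      (wp demand_prog 5 ?Q) \<tau>"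
    if \<tau>: "\<And>a. a \<notin> {7, 8, 9, 10} \<Longrightarrow> \<tau> a = \<sigma> a" "\<tau> 8 0 = int (cheapest os)"
      "\<tau> 9 0 = int (dearest os)" "\<tau> 10 0 = int (best os (dearest os))" for \<tau>
  proof (rule wp_For[where Inv = Inv])
    show "Inv 0 (\<tau>(5 := (\<tau> 5)(0 := 0)))"
      using \<tau> s by (simp add: Inv_def level_simps)
    show "5 \<notin> writes level_prog"
      by (simp add: writes_level)
    show "aval count_exp \<tau>' = int R" if "\<And>a. a \<notin> insert 5 (writes level_prog) \<Longrightarrow> \<tau>' a = \<tau> a" for \<tau>'
      using that \<tau>(1) R(1) by (simp add: writes_level)
  next
    fix r \<tau>'
    assume r: "r < R" "Inv r \<tau>'" "\<tau>' 5 0 = int r"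
      and fr: "\<And>a. a \<notin> insert 5 (writes level_prog) \<Longrightarrow> \<tau>' a = \<tau> a"
    have fr': "\<tau>' 0 = \<sigma> 0" "\<tau>' 3 = \<sigma> 3" "\<tau>' 4 = \<sigma> 4" "\<tau>' 13 = \<sigma> 13" "\<tau>' 8 = \<tau> 8"
      using fr \<tau>(1) by (simp_all add: writes_level)
    show "wp level_prog (10 * length os + 14) (\<lambda>\<tau>'. Inv (Suc r) (\<tau>'(5 := (\<tau>' 5)(0 := int (Suc r))))) \<tau>'"
    proof (rule wp_frame[OF wp_level[of \<tau>' "level os r"]], goal_cases)
      case (7 \<tau>'')
      define M where "M = \<tau>' 20"
      define P where "P = \<tau>' 2"
      have M'': "\<tau>'' 20 = M(A r := \<sigma> 4 0, A r + 1 := numer (cost os (level os r)),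
          A r + 2 := denom (cost os (level os r)),
          A r + 3 := gain os (best os (level os r)) - gain os (best os (level os (Suc r))))"
        using 7(1) r(2) by (simp add: fr' Inv_def A_def M_def level_simps)
      have P'': "\<tau>'' 2 = P(int (s + r) := int (best os (level os r)))"
        using 7(1) r(2) by (simp add: Inv_def P_def)
      have "\<tau>'' 9 0 = int (level os (Suc r))" "\<tau>'' 10 0 = int (best os (level os (Suc r)))"
        "\<tau>'' 6 0 = int (s + Suc r)"
        using 7(1) r(2) by (simp_all add: Inv_def level_simps)
      moreover have "M (A q) = \<sigma> 4 0 \<and> M (A q + 1) = numer (cost os (level os q)) \<and>
        M (A q + 2) = denom (cost os (level os q)) \<and>
        M (A q + 3) = gain os (best os (level os q)) - gain os (best os (level os (Suc q))) \<and>
        P (int (s + q)) = int (best os (level os q))" if "q < r" for q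
        using r(2) that by (simp add: Inv_def M_def P_def)
      moreover have "M j = \<sigma> 20 j" if "j < A 0 \<or> A r \<le> j" for j
        using r(2) that by (auto simp: Inv_def M_def)
      moreover have "P j = \<sigma> 2 j" if "j < int s" for j
        using r(2) that by (auto simp: Inv_def P_def)
      ultimately show ?case
        by (auto simp: Inv_def M'' P'' less_Suc_eq A_def)
    qed (use r(2) \<tau>(2) os in \<open>simp_all add: fr' Inv_def level_less\<close>)
  next
    fix \<tau>'
    assume inv: "Inv R \<tau>'" and fr: "\<And>a. a \<notin> insert 5 (writes level_prog) \<Longrightarrow> \<tau>' a = \<tau> a"
    have fr': "\<tau>' 0 = \<sigma> 0" "\<tau>' 1 = \<sigma> 1" "\<tau>' 3 = \<sigma> 3" "\<tau>' 4 = \<sigma> 4" "\<tau>' 13 = \<sigma> 13"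
      using fr \<tau>(1) by (simp_all add: writes_level)
    \<comment> \<open>After the loop array 10 refers to level \<open>R\<close>, one past the last
      supplier. Both levels have cost 0, so its option is that of level \<open>R - 1\<close> as
      well.\<close>
    have best: "best os (level os R) = best os (cheapest os)"
      "best os (level os (R - 1)) = best os (cheapest os)"
      using best_last R(2) by simp_all
    show "wp demand_prog 5 ?Q \<tau>'"
    proof (rule wp_frame[OF wp_demand[of \<tau>' "best os (level os R)"]], goal_cases)
      case (5 \<tau>'')
      define M where "M = \<tau>' 20"
      have R1: "A R - 1 = A (R - 1) + 3"
        using R(2) by (simp add: A_def)
      have M: "M (A q) = \<sigma> 4 0 \<and> M (A q + 1) = numer (cost os (level os q)) \<and>
        M (A q + 2) = denom (cost os (level os q)) \<and>
        M (A q + 3) = gain os (best os (level os q)) - gain os (best os (level os (Suc q))) \<and>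
        \<tau>' 2 (int (s + q)) = int (best os (level os q))" if "q < R" for q
        using inv that by (simp add: Inv_def M_def)
      have M'': "\<tau>'' 20 = (if 0 < last_supply os
          then M(A (R - 1) + 3 := last_supply os, D := 0) else M(D := - last_supply os))"
      proof -
        have "A R - 1 = 2 + \<tau>' 13 0 + 4 * \<tau>' 6 0"
          "D = 3 + \<tau>' 13 0 + 4 * (\<tau>' 0 1 * \<tau>' 0 0) + \<tau>' 4 0"
          using inv R(1) by (simp_all add: Inv_def A_def D_def fr')
        then show ?thesis
          using 5(1) unfolding best last_supply_def[symmetric] R1[symmetric]
          by (simp only: M_def)
      qed
      have cap: "\<tau>'' 20 (A r + 3) = level_capacity R os r" if "r < R" for r
      proof (cases "Suc r = R")
        case True
        then show ?thesis
          using M[OF that] D best unfolding M'' A_def D_def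
          by (auto simp: level_capacity_def last_supply_def)
      next
        case False
        with that have "A r + 3 < A (R - 1)" "A r + 3 < D"
          using D by (auto simp: A_def)
        then show ?thesis
          using M[OF that] False unfolding M'' by (simp add: level_capacity_def)
      qed
      have rest: "\<tau>'' 20 j = M j" if "j \<noteq> A (R - 1) + 3" "j \<noteq> D" for j
        using that by (simp add: M'')
      have "\<tau>'' 20 (A r + l) = M (A r + l)" if "r < R" "l \<in> {0, 1, 2}" for r l
      proof (rule rest)
        have "int r \<le> int (R - 1)"
          using that by simp
        then show "A r + l \<noteq> A (R - 1) + 3"
          using that(2) unfolding A_def by force
        show "A r + l \<noteq> D"
          using that D by (auto simp: A_def)
      qed
      from this[of _ 0] this[of _ 1] this[of _ 2]
      have fields: "\<tau>'' 20 (A r) = \<sigma> 4 0 \<and> \<tau>'' 20 (A r + 1) = numer (cost os (level os r)) \<and>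
          \<tau>'' 20 (A r + 2) = denom (cost os (level os r))" if "r < R" for r
        using M[OF that] that by simp
      have outside: "\<tau>'' 20 j = \<sigma> 20 j" if "j < A 0 \<or> A R \<le> j \<and> j \<noteq> D" for j
      proof -
        have "\<tau>'' 20 j = M j"
          using that D R1 R(2) by (intro rest) (auto simp: A_def)
        also have "\<dots> = \<sigma> 20 j"
          using inv that by (auto simp: Inv_def M_def)
        finally show ?thesis .
      qed
      have "\<tau>'' 2 = \<tau>' 2" "\<tau>'' 6 = \<tau>' 6"
        using 5(2) by (simp_all add: writes_demand)
      moreover have "\<tau>'' 20 D = max 0 (- last_supply os)"
        by (simp add: M'')
      moreover have "\<tau>'' 1 = (\<sigma> 1)(1 + \<sigma> 4 0 := int (best os (level os (R - 1))))"
        using 5(1) unfolding fr' best by blast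
      moreover have "\<tau>'' 3 0 = \<sigma> 3 0 + int (1 + 3 * length os)"
        using 5(1) unfolding fr' by blast
      moreover have "\<tau>' 6 0 = int (s + R)" "\<forall>j. j < int s \<longrightarrow> \<tau>' 2 j = \<sigma> 2 j"
        using inv unfolding Inv_def by blast+
      ultimately show ?case
        using M fields cap outside by simp
    qed (use inv os in \<open>simp_all add: fr' Inv_def best_less\<close>)
  qed
  have "wp point_prog (5 * length os + 3 + (5 * length os + 3 + (5 * length os + 3 +
      (2 + R * ((10 * length os + 14) + 2) + 5)))) ?Q \<sigma>"
    unfolding point_prog_def
  proof (rule wp_Seq, rule wp_cheapest[OF os], goal_cases)
    case (1 \<tau>1)
    then have os1: "stored_at (\<tau>1 0) (\<tau>1 3 0) os" using os by simp
    show ?case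
    proof (rule wp_Seq, rule wp_dearest[OF os1 1(2)], goal_cases)
      case (1 \<tau>2)
      note \<tau>1 = \<open>\<And>a. a \<notin> {7, 8} \<Longrightarrow> \<tau>1 a = \<sigma> a\<close> \<open>\<tau>1 8 0 = int (cheapest os)\<close>
      have os2: "stored_at (\<tau>2 0) (\<tau>2 3 0) os" "\<tau>2 8 0 = int (cheapest os)"
        using os1 1 \<tau>1 by simp_all
      show ?case
      proof (rule wp_Seq, rule wp_best[OF os2 _ _ 1(2) dearest_less], goal_cases)
        case (3 \<tau>3)
        note \<tau>2 = \<open>\<And>a. a \<notin> {7, 9} \<Longrightarrow> \<tau>2 a = \<tau>1 a\<close> \<open>\<tau>2 9 0 = int (dearest os)\<close>
        show ?case
          by (rule wp_Seq, rule loop) (use 3 \<tau>1 \<tau>2 os2 in simp_all)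
      qed simp_all
    qed
  qed
  then show ?thesis
    by (rule wp_frame) (simp_all add: algebra_simps)
qed

end


section \<open>Encoded instances and the composed algorithm\<close>

section \<open>Layout of inputs\<close>

lemma nth_concat_map:
  assumes "v < n" "k < length (f v)"
  shows "(\<Sum>w<v. length (f w)) + k < length (concat (map f [0..<n]))"
    "concat (map f [0..<n]) ! ((\<Sum>w<v. length (f w)) + k) = f v ! k"
proof -
  have len: "length (concat (map f [0..<n])) = (\<Sum>w<n. length (f w))" for n
    by (induction n) simp_all
  have "(\<Sum>w<v. length (f w)) + k < (\<Sum>w<n. length (f w)) \<and>
    concat (map f [0..<n]) ! ((\<Sum>w<v. length (f w)) + k) = f v ! k"
    using assms(1)
  proof (induction n)
    case (Suc n)
    then show ?case
      using assms(2) len[of n] by (cases "v = n") (auto simp: nth_append)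
  qed simp
  then show "(\<Sum>w<v. length (f w)) + k < length (concat (map f [0..<n]))"
    "concat (map f [0..<n]) ! ((\<Sum>w<v. length (f w)) + k) = f v ! k"
    by (simp_all add: len)
qed

lemma concat_map_blocks:
  assumes "\<And>i. i < N \<Longrightarrow> f i = map (\<lambda>l. h (i * k + l)) [0..<k]"
  shows "concat (map f [0..<N]) = map h [0..<N * k]"
  using assms
proof (induction N)
  case (Suc N)
  have "[0..<Suc N * k] = [0..<N * k] @ map (\<lambda>l. N * k + l) [0..<k]"
    using upt_add_eq_append[of 0 "N * k" k] map_add_upt[of "N * k" k]
    by (simp add: add.commute)
  with Suc show ?case by simp
qed simp

lemma map_upt_add: "map h [0..<p + q] = map h [0..<p] @ map (\<lambda>i. h (p + i)) [0..<q]"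
  by (rule nth_equalityI) (auto simp: nth_append)

lemma length_encode_matrix: "length (encode_matrix n d) = 2 * (n * n)"
  by (simp add: encode_matrix_def encode_rat_def length_concat comp_def sum_list_triv)

lemma input_memory_nth: "k < length xs \<Longrightarrow> input_memory xs 0 (int k + 1) = xs ! k"
  by (simp add: input_memory_def)

text \<open>The given algorithm may read any cell, so the array built for it must agree with its
  input memory everywhere, zeros outside the list included.\<close>

lemma input_memory_eqI:
  assumes "xs = map (\<lambda>j. \<mu> (1 + int j)) [0..<k]" "\<mu> 0 = int k"
    "\<And>j. j < 0 \<or> int k < j \<Longrightarrow> \<mu> j = 0"
  shows "input_memory xs 0 = \<mu>"
proof
  fix j
  show "input_memory xs 0 j = \<mu> j"
    using assms(2,3) by (auto simp: input_memory_def assms(1))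
qed


section \<open>The instance of facility location\<close>

locale reduction =
  fixes I :: tcsd_input
  assumes I: "I \<in> I4_inputs"
begin

abbreviation n :: nat where "n \<equiv> tcsd_size I"

abbreviation os :: "nat \<Rightarrow> options" where "os v \<equiv> tcsd_opts I v"

text \<open>The program finds this number ready in cell 0 of the input. It strictly exceeds the
  length of every option list, which makes level \<open>R - 1\<close> free.\<close>

definition R :: nat where "R = length (encode_tcsd I)"

abbreviation lev :: "nat \<Rightarrow> nat" where "lev s \<equiv> level (os (s div R)) (s mod R)"

abbreviation pos :: "nat \<Rightarrow> nat" where "pos s \<equiv> best (os (s div R)) (lev s)"

definition reduced :: cfl_input where
  "reduced = \<lparr>cfl_size = n, cfl_dist = tcsd_dist I,
     cfl_suppliers = map (\<lambda>s. (s div R, cost (os (s div R)) (lev s),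
       nat (level_capacity R (os (s div R)) (s mod R)))) [0..<n * R],
     cfl_demand = (\<lambda>v. nat (- last_supply (os v)))\<rparr>"

lemma tcsd: "tcsd_instance {..<n} (tcsd_metric I) (tcsd_R I)"
proof -
  obtain \<beta> nn N f B where *: "I4_setting \<beta> {..<n} (tcsd_metric I) nn N f B"
    "\<And>v. v < n \<Longrightarrow> tcsd_R I v = I4_R \<beta> {..<n} (tcsd_metric I) nn N f B v"
    using I by (auto simp: I4_inputs_def tcsd_points_def)
  from I4_tcsd_instance[OF *(1)] *(2) show ?thesis
    by (simp add: tcsd_instance_def)
qed

lemma size_ge_2: "2 \<le> n"
  using I by (auto simp: I4_inputs_def tcsd_points_def I4_setting_def)

text \<open>The free option is the point's own facility: \<open>v\<close> lies in its facility set
  and has cost 0.\<close>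

lemma zero_cost: "v < n \<Longrightarrow> free_option (os v)"
proof
  assume v: "v < n"
  show "0 \<le> cost (os v) j" if "j < length (os v)" for j
  proof -
    have "(of_rat (cost (os v) j), gain (os v) j) \<in> tcsd_R I v"
      using nth_mem[OF that] by (force simp: tcsd_R_def tcsd_option_list_def)
    then show ?thesis
      using tcsd v by (fastforce simp: tcsd_instance_def)
  qed
  obtain \<beta> nn N f B where *: "I4_setting \<beta> {..<n} (tcsd_metric I) nn N f B"
    "tcsd_R I v = I4_R \<beta> {..<n} (tcsd_metric I) nn N f B v"
    using I v by (auto simp: I4_inputs_def tcsd_points_def)
  have "(0, int (nn v) - int (B v)) \<in> tcsd_R I v"
    using *(1) v unfolding *(2) by (force simp: I4_R_def I4_setting_def)
  then obtain j where "j < length (os v)" "of_rat (cost (os v) j) = (0 :: real)"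
    by (auto simp: tcsd_R_def tcsd_option_list_def in_set_conv_nth)
  then show "\<exists>j<length (os v). cost (os v) j = 0"
    by auto
qed

text \<open>Taking the option of supply \<open>nn v\<close> at every point makes all supplies
  nonnegative.\<close>

lemma solution_exists: "\<exists>s. tcsd_solution {..<n} (tcsd_R I) s"
proof -
  obtain \<beta> nn N f B where *:
    "\<And>v. v < n \<Longrightarrow> tcsd_R I v = I4_R \<beta> {..<n} (tcsd_metric I) nn N f B v"
    using I by (auto simp: I4_inputs_def tcsd_points_def)
  then have "tcsd_solution {..<n} (tcsd_R I) (\<lambda>v.
      ((2 * \<beta> - 1) / (2 * \<beta>\<^sup>2) * real (nn v) * nearest_dist {..<n} (tcsd_metric I) v, int (nn v)))"
    by (auto simp: tcsd_solution_def I4_R_def intro!: sum_nonneg)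
  then show ?thesis by blast
qed

definition block :: "nat \<Rightarrow> int list" where
  "block v = int (length (os v)) #
     concat (map (\<lambda>j. encode_rat (cost (os v) j) @ [gain (os v) j]) [0..<length (os v)])"

lemma encode_split: "encode_tcsd I = [int n] @ encode_matrix n (tcsd_dist I) @ concat (map block [0..<n])"
proof -
  have "map (\<lambda>(g, z). encode_rat g @ [z]) (os v) =
      map (\<lambda>j. encode_rat (cost (os v) j) @ [gain (os v) j]) [0..<length (os v)]" for v
    by (rule nth_equalityI) (auto simp: case_prod_beta)
  then show ?thesis
    by (simp add: encode_tcsd_def block_def[abs_def])
qed

lemma length_block: "length (block v) = 1 + 3 * length (os v)"
  by (simp add: block_def length_concat comp_def encode_rat_def sum_list_triv)

lemma nth_block:
  "block v ! 0 = int (length (os v))"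
  "j < length (os v) \<Longrightarrow> l < 3 \<Longrightarrow>
    block v ! (1 + l + 3 * j) = [numer (cost (os v) j), denom (cost (os v) j), gain (os v) j] ! l"
proof -
  show "block v ! 0 = int (length (os v))"
    by (simp add: block_def)
  assume "j < length (os v)" "l < 3"
  then show "block v ! (1 + l + 3 * j) = [numer (cost (os v) j), denom (cost (os v) j), gain (os v) j] ! l"
    using nth_concat_map(2)[of j "length (os v)" l "\<lambda>j. encode_rat (cost (os v) j) @ [gain (os v) j]"]
    by (simp add: block_def encode_rat_def numeral_3_eq_3 ac_simps)
qed

abbreviation \<mu> :: "int \<Rightarrow> int" where "\<mu> \<equiv> input_memory (encode_tcsd I) 0"

definition address :: "nat \<Rightarrow> int" where
  "address v = 2 + int (2 * (n * n)) + int (\<Sum>w<v. 1 + 3 * length (os w))"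

lemma input_size: "\<mu> 1 = int n"
  using input_memory_nth[of 0 "encode_tcsd I"] by (simp add: encode_split)

lemma input_length: "\<mu> 0 = int R"
  by (simp add: input_memory_def R_def)

lemma length_parts: "1 + 2 * (n * n) + length (concat (map block [0..<n])) = R"
  by (simp only: R_def encode_split length_append length_encode_matrix) simp

lemma input_matrix: "i < 2 * (n * n) \<Longrightarrow> \<mu> (2 + int i) = encode_matrix n (tcsd_dist I) ! i"
  using input_memory_nth[of "1 + i" "encode_tcsd I"]
  by (simp add: encode_split nth_append length_encode_matrix add.commute)

lemma input_block:
  assumes "v < n" "k < length (block v)"
  shows "\<mu> (address v + int k) = block v ! k"
proof -
  let ?o = "(\<Sum>w<v. length (block w)) + k"
  note nth = nth_concat_map[of v n k block, OF assms]
  have "\<mu> (int (1 + (2 * (n * n) + ?o)) + 1) = encode_tcsd I ! (1 + (2 * (n * n) + ?o))"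
    using nth(1) length_parts by (intro input_memory_nth) (simp add: R_def)
  also have "\<dots> = block v ! k"
    using nth(2) by (simp add: encode_split nth_append length_encode_matrix)
  also have "int (1 + (2 * (n * n) + ?o)) + 1 = address v + int k"
    by (simp add: address_def length_block)
  finally show ?thesis .
qed

lemma stored: "v < n \<Longrightarrow> stored_at \<mu> (address v) (os v)"
  unfolding stored_at_def
proof (intro conjI allI impI)
  assume v: "v < n"
  show "\<mu> (address v) = int (length (os v))"
    using input_block[OF v, of 0] by (simp add: length_block nth_block(1))
  fix j assume j: "j < length (os v)"
  have "\<mu> (address v + int (1 + l + 3 * j)) = [numer (cost (os v) j), denom (cost (os v) j), gain (os v) j] ! l"
    if "l < 3" for l
    using input_block[OF v, of "1 + l + 3 * j"] nth_block(2)[OF j that] j that by (simp add: length_block)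
  from this[of 0] this[of 1] this[of 2]
  show "\<mu> (address v + 1 + 3 * int j) = numer (cost (os v) j)"
    "\<mu> (address v + 2 + 3 * int j) = denom (cost (os v) j)"
    "\<mu> (address v + 3 + 3 * int j) = gain (os v) j"
    by (simp_all add: add.assoc)
qed

lemma matrix_le: "2 * (n * n) \<le> R" and size_le: "n \<le> R"
proof -
  show *: "2 * (n * n) \<le> R"
    using length_parts by simp
  have "n \<le> n * n" using size_ge_2 by simp
  with * show "n \<le> R" by linarith
qed

lemma length_options_less: "v < n \<Longrightarrow> length (os v) < R"
proof -
  assume v: "v < n"
  have "length (block v) - 1 < length (concat (map block [0..<n]))"
    using nth_concat_map(1)[OF v, of "length (block v) - 1" block] by (simp add: length_block)
  then show ?thesis
    using length_parts by (simp add: length_block)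
qed

lemma R_pos: "0 < R"
  using size_le size_ge_2 by simp

lemma reduced_simps [simp]:
  "cfl_points reduced = {..<n}" "cfl_metric reduced = tcsd_metric I"
  "cfl_supplier_set reduced = {..<n * R}" "cfl_demand reduced v = nat (- last_supply (os v))"
  "s < n * R \<Longrightarrow> cfl_location reduced s = s div R"
  "s < n * R \<Longrightarrow> cfl_opening_cost reduced s = of_rat (cost (os (s div R)) (lev s))"
  "s < n * R \<Longrightarrow> cfl_capacity reduced s = nat (level_capacity R (os (s div R)) (s mod R))"
  by (simp_all add: reduced_def cfl_points_def cfl_metric_def[abs_def] tcsd_metric_def[abs_def]
      cfl_supplier_set_def cfl_location_def cfl_opening_cost_def cfl_capacity_def)

text \<open>Prices and capacities are passed through the index \<open>v * R + r\<close>; at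
  \<open>s div R\<close> and \<open>s mod R\<close> they turn into those of \<open>reduced\<close>
  by \<open>div_mult_mod_eq\<close>.\<close>

sublocale levels n R "tcsd_metric I" "tcsd_R I"
  "\<lambda>v r. fst (tcsd_option_list I v ! pos (v * R + r))" "\<lambda>v r. cfl_opening_cost reduced (v * R + r)"
  "\<lambda>v r. snd (tcsd_option_list I v ! pos (v * R + r))" "\<lambda>v r. cfl_capacity reduced (v * R + r)"
  "cfl_demand reduced"
proof
  show "tcsd_instance {..<n} (tcsd_metric I) (tcsd_R I)" "0 < R"
    by (rule tcsd, rule R_pos)
next
  fix v r assume v: "v < n" and r: "r < R"
  interpret free_option "os v" by (rule zero_cost[OF v])
  have s: "v * R + r < n * R" "(v * R + r) div R = v" "(v * R + r) mod R = r"
    using block_less[OF v r] r by simp_all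
  have option: "tcsd_option_list I v ! j = (of_rat (cost (os v) j), gain (os v) j)"
    if "j < length (os v)" for j
    using that by (simp add: tcsd_option_list_def case_prod_beta)
  show "(fst (tcsd_option_list I v ! pos (v * R + r)), snd (tcsd_option_list I v ! pos (v * R + r))) \<in> tcsd_R I v"
    using best_less by (simp add: s tcsd_R_def tcsd_option_list_def)
  show "fst (tcsd_option_list I v ! pos (v * R + r)) \<le> cfl_opening_cost reduced (v * R + r)"
    using cost_best[OF level_less] by (simp add: s option best_less of_rat_less_eq)
  show "0 \<le> cfl_opening_cost reduced (v * R + r)"
    using nonneg[OF level_less] by (simp add: s)
  have "(\<Sum>q = r..<R. int (cfl_capacity reduced (v * R + q))) = (\<Sum>q = r..<R. level_capacity R (os v) q)"
    using level_capacity_nonneg block_less[OF v] by (intro sum.cong) simp_all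
  also have "\<dots> = gain (os v) (best (os v) (level (os v) r)) + max 0 (- last_supply (os v))"
    by (rule sum_level_capacity[OF length_options_less[OF v] r])
  finally show "(\<Sum>q = r..<R. int (cfl_capacity reduced (v * R + q))) =
      snd (tcsd_option_list I v ! pos (v * R + r)) + int (cfl_demand reduced v)"
    by (simp add: s(2) r option best_less)
next
  fix v assume v: "v < n"
  interpret free_option "os v" by (rule zero_cost[OF v])
  have r: "R - 1 < R" using R_pos by simp
  have "cost (os v) (best (os v) (level (os v) (R - 1))) = 0"
    using cost_best[OF level_less, of "R - 1"] level_zero[of "R - 1"] length_options_less[OF v]
      nonneg[OF best_less, of "level (os v) (R - 1)"] by simp
  moreover have "(v * R + q) div R = v" "(v * R + q) mod R = q" if "q < R" for q
    using that by simp_all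
  note this[OF r]
  ultimately show "fst (tcsd_option_list I v ! pos (v * R + (R - 1))) = 0"
    using best_less by (simp only:) (simp add: tcsd_option_list_def case_prod_beta)
next
  fix v a z assume v: "v < n" and az: "(a, z) \<in> tcsd_R I v"
  interpret free_option "os v" by (rule zero_cost[OF v])
  obtain j where j: "j < length (os v)" "a = of_rat (cost (os v) j)" "z = gain (os v) j"
    using az by (auto simp: tcsd_R_def tcsd_option_list_def in_set_conv_nth)
  obtain r where r: "r < R" "gain (os v) j \<le> gain (os v) (best (os v) (level (os v) r))"
    "(\<Sum>q = r..<R. cost (os v) (level (os v) q)) \<le> 4 * cost (os v) j"
    using level_for_option[OF j(1) length_options_less[OF v]] .
  have "(\<Sum>q = r..<R. cfl_opening_cost reduced (v * R + q)) =
      (\<Sum>q = r..<R. of_rat (cost (os v) (level (os v) q)))"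
    using block_less[OF v] by (intro sum.cong) simp_all
  also have "\<dots> = of_rat (\<Sum>q = r..<R. cost (os v) (level (os v) q))"
    by (simp add: of_rat_sum)
  also have "\<dots> \<le> of_rat (4 * cost (os v) j)"
    using r(3) by (simp only: of_rat_less_eq)
  also have "\<dots> = 4 * a"
    by (simp add: j(2) of_rat_mult)
  finally have "(\<Sum>q = r..<R. cfl_opening_cost reduced (v * R + q)) \<le> 4 * a" .
  moreover have "z \<le> snd (tcsd_option_list I v ! pos (v * R + r))"
    using r(1,2) best_less by (simp add: j(3) tcsd_option_list_def case_prod_beta)
  ultimately show "\<exists>r<R. z \<le> snd (tcsd_option_list I v ! pos (v * R + r)) \<and>
      (\<Sum>q = r..<R. cfl_opening_cost reduced (v * R + q)) \<le> 4 * a"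
    using r(1) by blast
qed

lemma reduced_input: "reduced \<in> cfl_inputs"
  using metric cfl_feasible solution_exists R_pos price_nonneg
  by (auto simp: cfl_inputs_def less_mult_imp_div_less div_mult_mod_eq)

text \<open>Locations are known to be \<open>s div R\<close> only for actual suppliers, and the cost
  evaluates them nowhere else.\<close>

lemma cfl_cost_reduced:
  "cfl_cost {..<n} d {..<n * R} (cfl_location reduced) f = cfl_cost {..<n} d {..<n * R} (\<lambda>s. s div R) f"
  by (auto simp: cfl_cost_def fun_eq_iff intro!: sum.cong)

lemma tcsd_approx_of_reduced:
  assumes "cfl_approx_solution \<alpha> {..<n} (tcsd_metric I) {..<n * R} (cfl_location reduced)
      (cfl_opening_cost reduced) (cfl_capacity reduced) (cfl_demand reduced) (X, x)"
    and "\<And>v. v < n \<Longrightarrow> \<rho> v < R"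
      "\<And>v r. v < n \<Longrightarrow> r < \<rho> v \<Longrightarrow> v * R + r \<notin> X"
      "\<And>v. v < n \<Longrightarrow> v * R + \<rho> v \<in> X \<or> \<rho> v = R - 1"
  shows "tcsd_approx_solution (4 * \<alpha>) {..<n} (tcsd_metric I) (tcsd_R I)
    (\<lambda>v. tcsd_option_list I v ! pos (v * R + \<rho> v))"
  using tcsd_approx_of_cfl_approx[of \<alpha> X x \<rho>] assms
  by (simp add: cfl_approx_solution_def cfl_opt_def cfl_cost_reduced div_mult_mod_eq)


section \<open>Running the reduction\<close>

definition row :: "memory \<Rightarrow> nat \<Rightarrow> bool" where
  "row \<tau> s \<longleftrightarrow> (let A = 3 + int (2 * (n * n)) + 4 * int s in
     \<tau> 2 (int s) = int (pos s) \<and> \<tau> 20 A = int (s div R) \<and>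
     \<tau> 20 (A + 1) = numer (cost (os (s div R)) (lev s)) \<and>
     \<tau> 20 (A + 2) = denom (cost (os (s div R)) (lev s)) \<and>
     \<tau> 20 (A + 3) = level_capacity R (os (s div R)) (s mod R))"

abbreviation demand_address :: "nat \<Rightarrow> int" where
  "demand_address v \<equiv> 3 + int (2 * (n * n)) + 4 * int (n * R) + int v"

text \<open>Header, matrix, suppliers and demands are matched with consecutive segments of array 20
  by \<open>map_upt_add\<close>, each shifted by one because cell 0 holds the length.\<close>

lemma encode_reduced:
  assumes "\<tau> 20 0 = 2 + int (2 * (n * n)) + 4 * int (n * R) + int n"
    "\<tau> 20 1 = int n" "\<tau> 20 2 = int (n * R)"
    "\<And>i. i < 2 * (n * n) \<Longrightarrow> \<tau> 20 (3 + int i) = \<mu> (2 + int i)"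
    "\<And>s. s < n * R \<Longrightarrow> row \<tau> s"
    "\<And>v. v < n \<Longrightarrow> \<tau> 20 (demand_address v) = max 0 (- last_supply (os v))"
    "\<And>j. j < 0 \<or> demand_address n \<le> j \<Longrightarrow> \<tau> 20 j = 0"
  shows "input_memory (encode_cfl reduced) 0 = \<tau> 20"
    "length (encode_cfl reduced) = 2 + 2 * (n * n) + n * R * 4 + n"
proof -
  let ?h = "\<lambda>j. \<tau> 20 (1 + int j)"
  let ?m = "2 * (n * n)"
  have "encode_cfl reduced = map ?h [0..<2 + ?m + n * R * 4 + n]"
  proof -
    have "encode_matrix n (tcsd_dist I) = map (\<lambda>i. ?h (2 + i)) [0..<?m]"
      using assms(4) input_matrix
      by (intro nth_equalityI) (simp_all add: length_encode_matrix add.assoc[symmetric])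
    moreover have "concat (map (\<lambda>(p, f, u). [int p] @ encode_rat f @ [int u]) (cfl_suppliers reduced)) =
        map (\<lambda>i. ?h (2 + ?m + i)) [0..<n * R * 4]"
      unfolding reduced_def cfl_input.simps map_map
    proof (rule concat_map_blocks)
      fix s assume s: "s < n * R"
      then have "s div R < n"
        by (simp add: less_mult_imp_div_less)
      then interpret free_option "os (s div R)" by (rule zero_cost)
      have *: "1 + int (2 + ?m + (s * 4 + l)) = 3 + int ?m + 4 * int s + int l" for l
        by simp
      have "[0..<4] = [0, 1, 2, 3::nat]"
        by (simp add: upt_rec)
      then show "((\<lambda>(p, f, u). [int p] @ encode_rat f @ [int u]) \<circ> (\<lambda>s. (s div R,
          cost (os (s div R)) (lev s), nat (level_capacity R (os (s div R)) (s mod R))))) s =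
          map (\<lambda>l. ?h (2 + ?m + (s * 4 + l))) [0..<4]"
        using assms(5)[OF s] level_capacity_nonneg[of R "s mod R"]
        unfolding * by (simp add: row_def Let_def encode_rat_def)
    qed
    moreover have "map (\<lambda>p. int (cfl_demand reduced p)) [0..<n] =
        map (\<lambda>i. ?h (2 + ?m + n * R * 4 + i)) [0..<n]"
    proof (rule map_cong[OF refl])
      fix v assume "v \<in> set [0..<n]"
      moreover have "1 + int (2 + ?m + n * R * 4 + v) = demand_address v"
        by simp
      ultimately show "int (cfl_demand reduced v) = ?h (2 + ?m + n * R * 4 + v)"
        using assms(6)[of v] by (simp only: reduced_simps) simp
    qed
    moreover have "[int n, int (n * R)] = map ?h [0..<2]"
      using assms(2,3) by (simp add: upt_rec)
    moreover have "cfl_size reduced = n" "cfl_dist reduced = tcsd_dist I"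
      "length (cfl_suppliers reduced) = n * R"
      by (simp_all add: reduced_def)
    ultimately show ?thesis
      unfolding encode_cfl_def by (simp only: map_upt_add append_assoc)
  qed
  then show "input_memory (encode_cfl reduced) 0 = \<tau> 20"
  proof (rule input_memory_eqI)
    show "\<tau> 20 0 = int (2 + ?m + n * R * 4 + n)"
      using assms(1) by simp
    show "\<tau> 20 j = 0" if "j < 0 \<or> int (2 + ?m + n * R * 4 + n) < j" for j
      using that by (intro assms(7)) auto
  qed
  show "length (encode_cfl reduced) = 2 + ?m + n * R * 4 + n"
    using \<open>encode_cfl reduced = _\<close> by simp
qed

lemma wp_points:
  assumes \<sigma>: "\<sigma> 0 = \<mu>" "\<sigma> 13 0 = int (2 * (n * n))" "\<sigma> 3 0 = address 0" "\<sigma> 6 0 = 0"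
    "\<And>j. 3 + int (2 * (n * n)) \<le> j \<Longrightarrow> \<sigma> 20 j = 0" "\<And>j. j \<le> 0 \<Longrightarrow> \<sigma> 20 j = 0" "\<sigma> 1 0 = int n"
  shows "wp (For 4 size_exp point_prog) (2 + n * ((16 + 15 * R + R * (10 * R + 16)) + 2))
    (\<lambda>\<tau>. \<tau> 6 0 = int (n * R) \<and> (\<forall>s<n * R. row \<tau> s) \<and>
      (\<forall>v<n. \<tau> 20 (demand_address v) = max 0 (- last_supply (os v)) \<and>
        \<tau> 1 (1 + int v) = int (pos (v * R + (R - 1)))) \<and>
      (\<forall>j. j \<le> 0 \<or> demand_address n \<le> j \<longrightarrow> \<tau> 20 j = 0) \<and>
      (\<forall>j < 3 + int (2 * (n * n)). \<tau> 20 j = \<sigma> 20 j) \<and> \<tau> 1 0 = int n) \<sigma>"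
proof -
  define Inv where "Inv = (\<lambda>v (\<tau> :: memory). \<tau> 3 0 = address v \<and> \<tau> 6 0 = int (v * R) \<and>
    (\<forall>s<v * R. row \<tau> s) \<and>
    (\<forall>w<v. \<tau> 20 (demand_address w) = max 0 (- last_supply (os w)) \<and>
      \<tau> 1 (1 + int w) = int (pos (w * R + (R - 1)))) \<and>
    (\<forall>j. j \<le> 0 \<or> demand_address n \<le> j \<longrightarrow> \<tau> 20 j = 0) \<and>
    (\<forall>j < 3 + int (2 * (n * n)). \<tau> 20 j = \<sigma> 20 j) \<and> \<tau> 1 0 = int n)"
  show ?thesis
  proof (rule wp_For[where Inv = Inv])
    have "3 + int (2 * (n * n)) \<le> demand_address n"
      by simp
    then have "\<sigma> 20 j = 0" if "j \<le> 0 \<or> demand_address n \<le> j" for j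
      using \<sigma>(5,6) that by (meson order_trans)
    then show "Inv 0 (\<sigma>(4 := (\<sigma> 4)(0 := 0)))"
      unfolding Inv_def using \<sigma> by simp
    show "4 \<notin> writes point_prog"
      by (simp add: writes_point)
    show "aval size_exp \<tau> = int n" if "\<And>a. a \<notin> insert 4 (writes point_prog) \<Longrightarrow> \<tau> a = \<sigma> a" for \<tau>
      using that \<sigma>(1) input_size by (simp add: writes_point)
  next
    fix v \<tau>
    assume v: "v < n" and inv: "Inv v \<tau>" and v0: "\<tau> 4 0 = int v"
      and fr: "\<And>a. a \<notin> insert 4 (writes point_prog) \<Longrightarrow> \<tau> a = \<sigma> a"
    have fr': "\<tau> 0 = \<mu>" "\<tau> 13 0 = int (2 * (n * n))"
      using fr \<sigma> by (simp_all add: writes_point)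
    have \<tau>: "\<tau> 3 0 = address v" "\<tau> 6 0 = int (v * R)" "\<tau> 1 0 = int n"
      "\<And>s. s < v * R \<Longrightarrow> row \<tau> s"
      "\<And>w. w < v \<Longrightarrow> \<tau> 20 (demand_address w) = max 0 (- last_supply (os w))"
      "\<And>w. w < v \<Longrightarrow> \<tau> 1 (1 + int w) = int (pos (w * R + (R - 1)))"
      "\<And>j. j \<le> 0 \<or> demand_address n \<le> j \<Longrightarrow> \<tau> 20 j = 0"
      "\<And>j. j < 3 + int (2 * (n * n)) \<Longrightarrow> \<tau> 20 j = \<sigma> 20 j"
      using inv unfolding Inv_def by blast+
    interpret free_option "os v" by (rule zero_cost[OF v])
    have m: "length (os v) < R" by (rule length_options_less[OF v])
    have "v * R + R \<le> n * R"
      using mult_le_mono1[of "Suc v" n R] v by simp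
    \<comment> \<open>The block of point \<open>v\<close> ends within the supplier part, hence
      before every demand cell; this separates all the writes below.\<close>
    then have vn: "int (v * R) + int R \<le> int (n * R)"
      by (simp only: flip: of_nat_add of_nat_le_iff)
    let ?A = "\<lambda>r. 3 + int (2 * (n * n)) + 4 * int (v * R + r)"
    have D: "3 + \<tau> 13 0 + 4 * (\<tau> 0 1 * int R) + \<tau> 4 0 = demand_address v"
      by (simp add: fr' v0 input_size)
    show "wp point_prog (16 + 15 * R + R * (10 * R + 16))
        (\<lambda>\<tau>'. Inv (Suc v) (\<tau>'(4 := (\<tau>' 4)(0 := int (Suc v))))) \<tau>"
    proof (rule wp_frame[OF wp_point[of \<tau> R "v * R"]], goal_cases)
      case (5)
      show ?case using vn unfolding D unfolding fr' by simp
    next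
      case 6
      have "15 * length (os v) \<le> 15 * R" "R * (10 * length (os v) + 16) \<le> R * (10 * R + 16)"
        using m by (intro mult_le_mono2; simp)+
      then show ?case by linarith
    next
      case (7 \<tau>')
      note facts = 7(1)[unfolded D, unfolded fr'(2) v0]
      have last: "pos (v * R + (R - 1)) = best (os v) (level (os v) (R - 1))"
      proof -
        have "pos (v * R + r) = best (os v) (level (os v) r)" if "r < R" for r
          using that by simp
        from this[of "R - 1"] show ?thesis using R_pos by simp
      qed
      have \<tau>': "\<tau>' 3 0 = address (Suc v)" "\<tau>' 6 0 = int (Suc v * R)"
        "\<tau>' 1 = (\<tau> 1)(1 + int v := int (pos (v * R + (R - 1))))"
        "\<tau>' 20 (demand_address v) = max 0 (- last_supply (os v))"
        unfolding last using facts \<tau>(1) by (simp add: address_def, simp, blast+)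
      have new: "row \<tau>' (v * R + r)" if "r < R" for r
        using facts that unfolding row_def Let_def by simp
      have out: "\<tau>' 20 j = \<tau> 20 j" if "j < ?A 0 \<or> ?A R \<le> j \<and> j \<noteq> demand_address v" for j
        using facts that by blast
      have out2: "\<tau>' 2 j = \<tau> 2 j" if "j < int (v * R)" for j
        using facts that by blast
      have rows: "row \<tau>' s" if "s < Suc v * R" for s
      proof (cases "s < v * R")
        case True
        then have s: "int s < int (v * R)" by (simp only: of_nat_less_iff)
        then have "\<tau>' 20 (3 + int (2 * (n * n)) + 4 * int s + l) = \<tau> 20 (3 + int (2 * (n * n)) + 4 * int s + l)"
          if "l \<le> 3" for l
          using that s by (intro out) simp
        from this[of 0] this[of 1] this[of 2] this[of 3] show ?thesis
          using \<tau>(4)[OF True] out2[OF s] by (simp add: row_def Let_def)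
      next
        case False
        then show ?thesis
          using new[of "s - v * R"] that by simp
      qed
      have dem: "\<tau>' 20 (demand_address w) = max 0 (- last_supply (os w))"
        "\<tau>' 1 (1 + int w) = int (pos (w * R + (R - 1)))" if "w < Suc v" for w
      proof -
        have "\<tau>' 20 (demand_address w) = \<tau> 20 (demand_address w)" if "w \<noteq> v"
          using that vn by (intro out) simp
        then show "\<tau>' 20 (demand_address w) = max 0 (- last_supply (os w))"
          using \<tau>'(4) \<tau>(5)[of w] \<open>w < Suc v\<close> by (cases "w = v") simp_all
        show "\<tau>' 1 (1 + int w) = int (pos (w * R + (R - 1)))"
          using \<tau>'(3) \<tau>(6)[of w] \<open>w < Suc v\<close> by (cases "w = v") simp_all
      qed
      have "\<tau>' 20 j = 0" if "j \<le> 0 \<or> demand_address n \<le> j" for j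
      proof -
        have "0 < ?A 0"
          using of_nat_0_le_iff[of "2 * (n * n)"] of_nat_0_le_iff[of "v * R + 0"] by linarith
        then have "\<tau>' 20 j = \<tau> 20 j"
          using that vn v by (intro out) auto
        with \<tau>(7)[OF that] show ?thesis by simp
      qed
      moreover have "\<tau>' 20 j = \<sigma> 20 j" if "j < 3 + int (2 * (n * n))" for j
      proof -
        have "j < ?A 0"
          using that of_nat_0_le_iff[of "v * R + 0"] by linarith
        with out \<tau>(8)[OF that] show ?thesis by simp
      qed
      moreover have "\<tau>' 1 0 = int n"
        using \<tau>'(3) \<tau>(3) by simp
      ultimately have "Inv (Suc v) \<tau>'"
        unfolding Inv_def using \<tau>'(1,2) rows dem by blast
      then show ?case
        by (simp add: Inv_def row_def)
    qed (use \<tau> stored[OF v] m in \<open>simp_all add: fr' input_length\<close>)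
  next
    fix \<tau> assume "Inv n \<tau>"
    then show "\<tau> 6 0 = int (n * R) \<and> (\<forall>s<n * R. row \<tau> s) \<and>
      (\<forall>v<n. \<tau> 20 (demand_address v) = max 0 (- last_supply (os v)) \<and>
        \<tau> 1 (1 + int v) = int (pos (v * R + (R - 1)))) \<and>
      (\<forall>j. j \<le> 0 \<or> demand_address n \<le> j \<longrightarrow> \<tau> 20 j = 0) \<and>
      (\<forall>j < 3 + int (2 * (n * n)). \<tau> 20 j = \<sigma> 20 j) \<and> \<tau> 1 0 = int n"
      unfolding Inv_def by blast
  qed
qed


lemma wp_build:
  "wp build_prog (build_steps R) (\<lambda>\<tau>. \<tau> 20 = input_memory (encode_cfl reduced) 0 \<and>
      length (encode_cfl reduced) = 2 + 2 * (n * n) + n * R * 4 + n \<and>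
      (\<forall>a>20. \<tau> a = (\<lambda>_. 0)) \<and> \<tau> 0 = \<mu> \<and> (\<forall>s<n * R. \<tau> 2 (int s) = int (pos s)) \<and>
      \<tau> 1 0 = int n \<and> (\<forall>v<n. \<tau> 1 (1 + int v) = int (pos (v * R + (R - 1)))))
    (input_memory (encode_tcsd I))" (is "wp _ _ ?Q ?\<sigma>")
proof -
  let ?m = "2 * (n * n)"
  have \<sigma>: "?\<sigma> a = (\<lambda>_. 0)" if "a \<noteq> 0" for a
    using that by (auto simp: input_memory_def)
  define k where "k = 1 + (1 + ((2 + ?m * (1 + 2)) + (1 +
    ((2 + n * ((16 + 15 * R + R * (10 * R + 16)) + 2)) + (1 + 1)))))"
  have "wp build_prog k ?Q ?\<sigma>"
    unfolding build_prog_def k_def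
  proof (rule wp_Seq, rule wp_assign, rule wp_Seq, rule wp_assign, goal_cases)
    case (1 \<tau>1 \<tau>2)
    have \<tau>2: "\<tau>2 0 = \<mu>" "\<tau>2 1 0 = int n" "\<tau>2 20 = (\<lambda>_. 0)(1 := int n)"
      "\<And>a. a \<notin> {0, 1, 20} \<Longrightarrow> \<tau>2 a = (\<lambda>_. 0)"
      using 1 \<sigma> by (simp_all add: input_size)
    show ?case
    proof (rule wp_Seq, rule wp_For[where Inv = "\<lambda>i \<tau>. \<tau> 20 1 = int n \<and>
        (\<forall>k<i. \<tau> 20 (3 + int k) = \<mu> (2 + int k)) \<and>
        (\<forall>j. j \<noteq> 1 \<and> (j < 3 \<or> 3 + int i \<le> j) \<longrightarrow> \<tau> 20 j = 0)" and N = ?m], goal_cases)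
      case (3 \<tau>)
      then show ?case using \<tau>2(1) by (simp add: input_size)
    next
      case (4 i \<tau>)
      have "\<tau> 0 = \<mu>" using 4(4)[of 0] \<tau>2(1) by simp
      with 4 show ?case
        by (intro wp_Write) (auto simp: less_Suc_eq)
    next
      case (5 \<tau>3)
      show ?case
      proof (rule wp_Seq, rule wp_assign, goal_cases)
        case (1 \<tau>4)
        have \<tau>4: "\<tau>4 0 = \<mu>" "\<tau>4 1 0 = int n" "\<tau>4 20 = \<tau>3 20" "\<tau>4 13 0 = int ?m"
          "\<tau>4 3 0 = address 0" "\<And>a. a \<notin> {0, 1, 3, 13, 20} \<Longrightarrow> \<tau>4 a = (\<lambda>_. 0)"
          using 1 5 \<tau>2 by (simp_all add: address_def)
        have zero: "\<tau>4 20 j = 0" if "3 + int ?m \<le> j \<or> j \<le> 0" for j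
        proof -
          have "j \<noteq> 1 \<and> (j < 3 \<or> 3 + int ?m \<le> j)"
            using that of_nat_0_le_iff[of ?m] by linarith
          then show ?thesis using 5(1) \<tau>4(3) by simp
        qed
        show ?case
        proof (rule wp_Seq, rule wp_frame[OF wp_points order_refl], goal_cases)
          case (8 \<tau>5)
          have \<tau>5: "\<tau>5 0 = \<mu>" "\<tau>5 13 0 = int ?m" "\<And>a. 20 < a \<Longrightarrow> \<tau>5 a = (\<lambda>_. 0)"
            using 8(2) \<tau>4 by (simp_all add: writes_point)
          have low: "\<tau>5 20 j = \<tau>3 20 j" if "j < 3 + int ?m" for j
            using 8(1) that \<tau>4(3) by simp
          show ?case
          proof (rule wp_Seq, rule wp_assign, rule wp_assign, goal_cases)
            case (1 \<tau>6 \<tau>7)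
            \<comment> \<open>Cells 2 and 0 are written last: array 6 has then counted all
              \<open>n * R\<close> suppliers, so neither value requires a stored product.\<close>
            have upd: "\<tau>7 20 = (\<tau>5 20)(2 := int (n * R), 0 := 2 + int ?m + 4 * int (n * R) + int n)"
              using 1 8(1) \<tau>5 by (simp add: input_size ac_simps)
            have fr: "\<tau>7 a = \<tau>5 a" if "a \<noteq> 20" for a
              using 1 that by simp
            have high: "\<tau>7 20 j = \<tau>5 20 j" if "3 \<le> j \<or> j < 0 \<or> j = 1" for j
              using that by (auto simp: upd)
            have rows: "row \<tau>7 s" if "s < n * R" for s
            proof -
              have "\<tau>7 20 (3 + int ?m + 4 * int s + l) = \<tau>5 20 (3 + int ?m + 4 * int s + l)" if "0 \<le> l" for l
                using that by (intro high) simp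
              from this[of 0] this[of 1] this[of 2] this[of 3] show ?thesis
                using 8(1) that fr[of 2] by (simp add: row_def Let_def)
            qed
            have "\<tau>7 20 0 = 2 + int ?m + 4 * int (n * R) + int n" "\<tau>7 20 2 = int (n * R)"
              by (simp_all add: upd)
            moreover have "\<tau>7 20 1 = int n"
            proof -
              have "1 < 3 + int ?m"
                using of_nat_0_le_iff[of ?m] by linarith
              then show ?thesis using high[of 1] low[of 1] 5(1) by simp
            qed
            moreover have "\<tau>7 20 (3 + int i) = \<mu> (2 + int i)" if "i < ?m" for i
            proof -
              have "int i < int ?m" using that by (simp only: of_nat_less_iff)
              then show ?thesis
                using high[of "3 + int i"] low[of "3 + int i"] 5(1) that by simp
            qed
            moreover have "\<tau>7 20 (demand_address v) = max 0 (- last_supply (os v))" if "v < n" for v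
              using 8(1) that by (subst high) simp_all
            moreover have "\<tau>7 20 j = 0" if "j < 0 \<or> demand_address n \<le> j" for j
            proof -
              have "3 \<le> demand_address n" by simp
              then have "\<tau>7 20 j = \<tau>5 20 j" using that by (intro high) linarith
              also have "\<dots> = 0" using 8(1) that by (meson less_imp_le)
              finally show ?thesis .
            qed
            ultimately have enc: "input_memory (encode_cfl reduced) 0 = \<tau>7 20"
              "length (encode_cfl reduced) = 2 + 2 * (n * n) + n * R * 4 + n"
              using encode_reduced[of \<tau>7] rows by blast+
            have "\<tau>7 2 (int s) = int (pos s)" if "s < n * R" for s
              using rows[OF that] by (simp add: row_def Let_def)
            then show ?case
              using enc 8(1) \<tau>5 by (simp add: fr)
          qed
        qed (use \<tau>4 zero in simp_all)
      qed
    qed (use \<tau>2 in auto)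
  qed
  moreover have "k \<le> build_steps R"
  proof -
    have "n * ((16 + 15 * R + R * (10 * R + 16)) + 2) \<le> R * (18 + 15 * R + R * (10 * R + 16))"
      using size_le by (intro mult_le_mono) simp_all
    with matrix_le show ?thesis
      by (simp add: k_def build_steps_def)
  qed
  ultimately show ?thesis
    by (rule wp_frame)
qed

text \<open>The default R - 1 is right although that level may be closed, since its option is free.\<close>

primrec lowest :: "nat set \<Rightarrow> nat \<Rightarrow> nat \<Rightarrow> nat" where
  "lowest X v 0 = R - 1"
| "lowest X v (Suc i) = (if v * R + (R - Suc i) \<in> X then R - Suc i else lowest X v i)"

lemma lowest:
  assumes "i \<le> R"
  shows "lowest X v i < R" "R - i \<le> r \<Longrightarrow> r < lowest X v i \<Longrightarrow> v * R + r \<notin> X"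
    "v * R + lowest X v i \<in> X \<or> lowest X v i = R - 1"
proof -
  have "lowest X v i < R \<and> (\<forall>r. R - i \<le> r \<and> r < lowest X v i \<longrightarrow> v * R + r \<notin> X) \<and>
    (v * R + lowest X v i \<in> X \<or> lowest X v i = R - 1)"
    using assms
  proof (induction i)
    case 0
    then show ?case using R_pos by auto
  next
    case (Suc i)

    show ?case
    proof (cases "v * R + (R - Suc i) \<in> X")
      case True
      then show ?thesis using Suc.prems by auto
    next
      case False
      then have eq: "lowest X v (Suc i) = lowest X v i" by simp
      have IH: "lowest X v i < R" "\<And>r. R - i \<le> r \<Longrightarrow> r < lowest X v i \<Longrightarrow> v * R + r \<notin> X"
        "v * R + lowest X v i \<in> X \<or> lowest X v i = R - 1"
        using Suc by simp_all
      have "v * R + r \<notin> X" if "R - Suc i \<le> r" "r < lowest X v i" for r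
      proof (cases "r = R - Suc i")
        case True
        with False show ?thesis by simp
      next
        case False
        with that show ?thesis by (intro IH(2)) linarith+
      qed
      with IH(1,3) show ?thesis unfolding eq by blast
    qed
  qed
  then show "lowest X v i < R" "R - i \<le> r \<Longrightarrow> r < lowest X v i \<Longrightarrow> v * R + r \<notin> X"
    "v * R + lowest X v i \<in> X \<or> lowest X v i = R - 1"
    by blast+
qed


text \<open>Array 21 is the relocated output array, where the flag of supplier \<open>s\<close> sits
  in cell \<open>1 + s\<close>, while array 2 starts at cell 0. Each open level overwrites the
  previous answer, so the one inspected last, which has the lowest index, remains.\<close>

lemma wp_decode:
  assumes \<sigma>: "\<sigma> 0 = \<mu>" "\<And>s. s < n * R \<Longrightarrow> \<sigma> 2 (int s) = int (pos s)" "\<sigma> 1 0 = int n"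
    "\<And>v. v < n \<Longrightarrow> \<sigma> 1 (1 + int v) = int (pos (v * R + (R - 1)))"
    and flags: "\<And>s. s < n * R \<Longrightarrow> 0 < \<sigma> 21 (1 + int s) \<longleftrightarrow> s \<in> X"
  shows "wp decode_prog (decode_steps R)
    (\<lambda>\<tau>. \<tau> 1 0 = int n \<and> (\<forall>v<n. \<tau> 1 (1 + int v) = int (pos (v * R + lowest X v R)))) \<sigma>"
proof -
  let ?inner = "Branch (Read 21 (Sub (Add (Mul (Var 4) count_exp) count_exp) (Var 5)))
       (Write 1 (Add (Const 1) (Var 4))
         (Read 2 (Sub (Add (Mul (Var 4) count_exp) count_exp) (Add (Var 5) (Const 1)))))
       Nop"
  define Inv where "Inv = (\<lambda>v (\<tau> :: memory). \<tau> 1 0 = int n \<and>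
    (\<forall>w<v. \<tau> 1 (1 + int w) = int (pos (w * R + lowest X w R))) \<and>
    (\<forall>w<n. v \<le> w \<longrightarrow> \<tau> 1 (1 + int w) = int (pos (w * R + (R - 1)))))"
  have "wp decode_prog (2 + n * ((2 + R * (2 + 2)) + 2))
    (\<lambda>\<tau>. \<tau> 1 0 = int n \<and> (\<forall>v<n. \<tau> 1 (1 + int v) = int (pos (v * R + lowest X v R)))) \<sigma>"
    unfolding decode_prog_def
  proof (rule wp_For[where Inv = Inv], goal_cases)
    case 1
    then show ?case using \<sigma> by (simp add: Inv_def)
  next
    case (3 \<tau>)
    then show ?case using \<sigma>(1) by (simp add: input_size)
  next
    case (4 v \<tau>)
    have fr: "\<tau> 0 = \<mu>" "\<tau> 2 = \<sigma> 2" "\<tau> 21 = \<sigma> 21"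
      using 4(4) \<sigma>(1) by simp_all
    show ?case
    proof (rule wp_For[where Inv = "\<lambda>i \<tau>'.
        \<tau>' 1 = (\<tau> 1)(1 + int v := int (pos (v * R + lowest X v i)))" and N = R], goal_cases)
      case 1
      then show ?case
        using 4(1,2) by (auto simp: Inv_def fun_eq_iff)
    next
      case (3 \<tau>')
      then show ?case using fr by (simp add: input_length)
    next
      case (4 i \<tau>')
      have fr': "\<tau>' 0 = \<mu>" "\<tau>' 2 = \<sigma> 2" "\<tau>' 21 = \<sigma> 21" "\<tau>' 4 0 = int v"
        using 4(4) fr \<open>\<tau> 4 0 = int v\<close> by simp_all
      define s where "s = v * R + (R - Suc i)"
      have s: "s < n * R"
        unfolding s_def using \<open>v < n\<close> \<open>i < R\<close> by (intro block_less) simp_all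
      have addr: "int v * int R + int R - int i = 1 + int s"
        "int v * int R + int R - (int i + 1) = int s"
        using \<open>i < R\<close> by (simp_all add: s_def)
      have "wp ?inner (Suc (max 1 1)) (\<lambda>\<tau>'. (\<tau>'(5 := (\<tau>' 5)(0 := int (Suc i)))) 1 =
          (\<tau> 1)(1 + int v := int (pos (v * R + lowest X v (Suc i))))) \<tau>'"
      proof (rule wp_Branch, goal_cases)
        case 1
        then have "s \<in> X"
          using flags[OF s] \<open>\<tau>' 5 0 = int i\<close> by (simp add: fr' input_length addr)
        then show ?case
          using 4(2,3) \<sigma>(2)[OF s]
          by (intro wp_Write) (simp add: fr' input_length addr flip: s_def)
      next
        case 2
        then have "s \<notin> X"
          using flags[OF s] \<open>\<tau>' 5 0 = int i\<close> by (simp add: fr' input_length addr)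
        then show ?case
          using 4(2) by (intro wp_Nop) (simp flip: s_def)
      qed
      then show ?case by (simp add: numeral_2_eq_2)
    next
      case (5 \<tau>')
      then show ?case
        using 4(1,2) by (auto simp: Inv_def less_Suc_eq)
    qed simp
  next
    case (5 \<tau>)
    then show ?case by (simp add: Inv_def)
  qed simp
  then show ?thesis
  proof (rule wp_frame)
    have "n * ((2 + R * (2 + 2)) + 2) \<le> R * (4 * R + 4)"
      using size_le by (intro mult_le_mono) simp_all
    then show "2 + n * ((2 + R * (2 + 2)) + 2) \<le> decode_steps R"
      by (simp add: decode_steps_def)
  qed simp
qed

text \<open>The open suppliers determine the options, and TCSD charges a cheapest transport for
  these, so the leading flags of the output are all that has to be decoded.\<close>

lemma tcsd_output:
  assumes out: "cfl_approx_output \<alpha> reduced (output_list \<sigma>)"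
    and \<sigma>: "\<tau> 0 = \<mu>" "\<And>s. s < n * R \<Longrightarrow> \<tau> 2 (int s) = int (pos s)" "\<tau> 1 0 = int n"
    "\<And>v. v < n \<Longrightarrow> \<tau> 1 (1 + int v) = int (pos (v * R + (R - 1)))"
    and "\<tau> 21 = \<sigma> 1"
  obtains s \<tau>' where "runs decode_prog \<tau> s \<tau>'" "s \<le> decode_steps R"
    "tcsd_approx_output (4 * \<alpha>) I (output_list \<tau>')"
proof -
  obtain X x where X: "output_list \<sigma> = encode_cfl_solution reduced (X, x)"
    "cfl_approx_solution \<alpha> {..<n} (tcsd_metric I) {..<n * R} (cfl_location reduced)
      (cfl_opening_cost reduced) (cfl_capacity reduced) (cfl_demand reduced) (X, x)"
    using out by (auto simp: cfl_approx_output_def)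
  have "0 < \<tau> 21 (1 + int s) \<longleftrightarrow> s \<in> X" if "s < n * R" for s
  proof -
    have len: "s < length (encode_cfl_solution reduced (X, x))"
      using that by (simp add: encode_cfl_solution_def reduced_def)
    have "output_list \<sigma> ! s = \<sigma> 1 (1 + int s)"
      using len unfolding X(1)[symmetric] by (simp add: output_list_def)
    moreover have "encode_cfl_solution reduced (X, x) ! s = (if s \<in> X then 1 else 0)"
      using that by (simp add: encode_cfl_solution_def reduced_def nth_append)
    ultimately have "\<tau> 21 (1 + int s) = (if s \<in> X then 1 else 0)"
      unfolding assms(6) X(1) by (simp only:)
    then show ?thesis by simp
  qed
  from wp_decode[OF \<sigma> this] obtain s \<tau>' where \<tau>': "runs decode_prog \<tau> s \<tau>'" "s \<le> decode_steps R"
    "\<tau>' 1 0 = int n" "\<And>v. v < n \<Longrightarrow> \<tau>' 1 (1 + int v) = int (pos (v * R + lowest X v R))"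
    by (auto simp: wp_def)
  have "tcsd_approx_output (4 * \<alpha>) I (output_list \<tau>')"
    unfolding tcsd_approx_output_def
  proof (intro exI[of _ "\<lambda>v. pos (v * R + lowest X v R)"] conjI ballI)
    show "output_list \<tau>' = map (\<lambda>v. int (pos (v * R + lowest X v R))) [0..<n]"
      using \<tau>'(3,4) by (simp add: output_list_def)
    show "pos (v * R + lowest X v R) < length (tcsd_option_list I v)" if "v \<in> tcsd_points I" for v
      using free_option.best_less[OF zero_cost, of v] lowest(1)[of R X v] that
      by (simp add: tcsd_option_list_def tcsd_points_def)
    show "tcsd_approx_solution (4 * \<alpha>) (tcsd_points I) (tcsd_metric I) (tcsd_R I)
        (\<lambda>v. tcsd_option_list I v ! pos (v * R + lowest X v R))"
      unfolding tcsd_points_def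
      using lowest[where i = R and X = X] by (intro tcsd_approx_of_reduced[OF X(2)]) simp_all
  qed
  with \<tau>'(1,2) that show thesis by blast
qed

end

theorem theorem5:
  fixes \<alpha> :: real
  assumes "\<exists>c. solves_in_poly_time c cfl_inputs encode_cfl (cfl_approx_output \<alpha>)"
  shows "\<exists>c. solves_in_poly_time c I4_inputs encode_tcsd (tcsd_approx_output (4 * \<alpha>))"
proof -
  obtain c a k where c: "\<And>J. J \<in> cfl_inputs \<Longrightarrow> \<exists>t \<sigma>. exec c (input_memory (encode_cfl J)) t \<sigma> \<and>
      t \<le> a * input_size (encode_cfl J) ^ k + a \<and> cfl_approx_output \<alpha> J (output_list \<sigma>)"
    using assms unfolding solves_in_poly_time_def by blast
  obtain K1 D1 where build: "\<And>\<sigma> s \<sigma>' m. runs build_prog \<sigma> s \<sigma>' \<Longrightarrow> bounded_memory m \<sigma> \<Longrightarrow>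
      (\<exists>t \<le> s * (K1 * Suc (m + D1 * s)). exec build_prog \<sigma> t \<sigma>') \<and> bounded_memory (m + D1 * s) \<sigma>'"
    using affine_prog_exec[OF affine_build] by blast
  obtain K2 D2 where decode: "\<And>\<sigma> s \<sigma>' m. runs decode_prog \<sigma> s \<sigma>' \<Longrightarrow> bounded_memory m \<sigma> \<Longrightarrow>
      (\<exists>t \<le> s * (K2 * Suc (m + D2 * s)). exec decode_prog \<sigma> t \<sigma>') \<and> bounded_memory (m + D2 * s) \<sigma>'"
    using affine_prog_exec[OF affine_decode] by blast
  \<comment> \<open>For input size \<open>L\<close>: the bit length of the memory after building,
    then the times of building, of the given algorithm and of decoding.\<close>
  define b1 where "b1 = (\<lambda>L. L + D1 * build_steps L)"
  define t1 where "t1 = (\<lambda>L. build_steps L * (K1 * Suc (b1 L)))"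
  \<comment> \<open>The facility location input has \<open>2 + 2 * (n * n) + n * R * 4 + n\<close>
    numbers, each below \<open>2 ^ b1 L\<close>, and \<open>L\<close> bounds \<open>n\<close>,
    \<open>R\<close> and \<open>2 * (n * n)\<close>.\<close>
  define tc where "tc = (\<lambda>L. a * ((2 + L + L * L * 4 + L) * Suc (b1 L)) ^ k + a)"
  define t2 where "t2 = (\<lambda>L. decode_steps L * (K2 * Suc (b1 L + tc L + D2 * decode_steps L)))"
  have "polynomially_bounded (\<lambda>L. t1 L + (tc L + t2 L))"
    unfolding t1_def tc_def t2_def b1_def build_steps_def decode_steps_def Suc_eq_plus1
    by (intro polynomially_bounded_intros)
  then obtain a' k' where poly: "\<And>L. t1 L + (tc L + t2 L) \<le> a' * L ^ k' + a'"
    using polynomially_bounded_le by blast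
  have mono: "build_steps x \<le> build_steps y" "decode_steps x \<le> decode_steps y" if "x \<le> y" for x y
    using that unfolding build_steps_def decode_steps_def by (intro add_mono mult_mono; simp)+
  let ?c = "Seq build_prog (Seq (shift_prog 20 c) decode_prog)"
  have "\<exists>t \<sigma>. exec ?c (input_memory (encode_tcsd I)) t \<sigma> \<and>
      t \<le> a' * input_size (encode_tcsd I) ^ k' + a' \<and> tcsd_approx_output (4 * \<alpha>) I (output_list \<sigma>)"
    if "I \<in> I4_inputs" for I
  proof -
    interpret reduction I using that by unfold_locales
    define L where "L = input_size (encode_tcsd I)"
    have RL: "R \<le> L"
      by (simp add: R_def L_def length_le_input_size)
    obtain s1 \<sigma>1 where \<sigma>1: "runs build_prog (input_memory (encode_tcsd I)) s1 \<sigma>1" "s1 \<le> build_steps R"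
      "\<sigma>1 20 = input_memory (encode_cfl reduced) 0"
      "length (encode_cfl reduced) = 2 + 2 * (n * n) + n * R * 4 + n"
      "\<And>a. 20 < a \<Longrightarrow> \<sigma>1 a = (\<lambda>_. 0)" "\<sigma>1 0 = \<mu>" "\<And>s. s < n * R \<Longrightarrow> \<sigma>1 2 (int s) = int (pos s)"
      "\<sigma>1 1 0 = int n" "\<And>v. v < n \<Longrightarrow> \<sigma>1 1 (1 + int v) = int (pos (v * R + (R - 1)))"
      using wp_build unfolding wp_def by blast
    have s1: "s1 \<le> build_steps L"
      using \<sigma>1(2) mono(1)[OF RL] by simp
    have "bounded_memory L (input_memory (encode_tcsd I))"
      unfolding L_def by (rule bounded_input_memory)
    from build[OF \<sigma>1(1) this] obtain u1 where
      u1: "u1 \<le> s1 * (K1 * Suc (L + D1 * s1))" "exec build_prog (input_memory (encode_tcsd I)) u1 \<sigma>1"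
      and "bounded_memory (L + D1 * s1) \<sigma>1" by blast
    then have bound1: "bounded_memory (b1 L) \<sigma>1"
      using s1 by (elim bounded_memory_mono) (simp add: b1_def)
    have "s1 * (K1 * Suc (L + D1 * s1)) \<le> t1 L"
      unfolding t1_def b1_def using s1 by (intro mult_le_mono add_mono Suc_le_mono[THEN iffD2]) simp_all
    with u1(1) have u1_le: "u1 \<le> t1 L" by simp
    \<comment> \<open>All arrays after 20 are still 0, so the relocated algorithm starts in exactly
      its input memory.\<close>
    have start: "input_memory (encode_cfl reduced) = (\<lambda>a. \<sigma>1 (a + 20))"
    proof
      fix a
      show "input_memory (encode_cfl reduced) a = \<sigma>1 (a + 20)"
        using \<sigma>1(3,5) by (cases "a = 0") (auto simp: input_memory_def)
    qed
    obtain t \<sigma> where t: "exec c (input_memory (encode_cfl reduced)) t \<sigma>"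
      "t \<le> a * input_size (encode_cfl reduced) ^ k + a" "cfl_approx_output \<alpha> reduced (output_list \<sigma>)"
      using c[OF reduced_input] by blast
    from exec_shift[OF t(1) start] obtain \<sigma>2 where
      \<sigma>2: "exec (shift_prog 20 c) \<sigma>1 t \<sigma>2" "\<sigma> = (\<lambda>a. \<sigma>2 (a + 20))" "\<And>a. a < 20 \<Longrightarrow> \<sigma>2 a = \<sigma>1 a"
      by blast
    have "input_size (encode_cfl reduced) \<le> length (encode_cfl reduced) * Suc (b1 L)"
    proof (rule input_size_le)
      fix x assume "x \<in> set (encode_cfl reduced)"
      then obtain i where "i < length (encode_cfl reduced)" "x = encode_cfl reduced ! i"
        by (auto simp: in_set_conv_nth)
      then have "x = \<sigma>1 20 (int i + 1)"
        unfolding \<sigma>1(3) by (simp add: input_memory_nth)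
      then show "\<bar>x\<bar> < 2 ^ b1 L"
        using bound1 by (simp add: bounded_memory_def)
    qed
    also have "\<dots> \<le> (2 + L + L * L * 4 + L) * Suc (b1 L)"
      unfolding \<sigma>1(4) using matrix_le size_le RL
      by (intro mult_le_mono add_mono order_refl) simp_all
    finally have "a * input_size (encode_cfl reduced) ^ k + a \<le> tc L"
      unfolding tc_def by (intro add_mono mult_le_mono2 power_mono) simp_all
    with t(2) have t_le: "t \<le> tc L" by simp
    \<comment> \<open>The running time of the given algorithm also limits the length of the numbers
      it leaves behind.\<close>
    have bound2: "bounded_memory (b1 L + tc L) \<sigma>2"
      using exec_bounded_memory[OF \<sigma>2(1) bound1] t_le by (elim bounded_memory_mono) simp
    obtain s2 \<sigma>3 where \<sigma>3: "runs decode_prog \<sigma>2 s2 \<sigma>3" "s2 \<le> decode_steps R"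
      "tcsd_approx_output (4 * \<alpha>) I (output_list \<sigma>3)"
    proof (rule tcsd_output[OF t(3), of \<sigma>2])
      show "\<sigma>2 21 = \<sigma> 1" by (simp add: \<sigma>2(2))
    qed (use \<sigma>1 \<sigma>2(3) in simp_all)
    have s2: "s2 \<le> decode_steps L"
      using \<sigma>3(2) mono(2)[OF RL] by simp
    from decode[OF \<sigma>3(1) bound2] obtain u2 where
      u2: "u2 \<le> s2 * (K2 * Suc (b1 L + tc L + D2 * s2))" "exec decode_prog \<sigma>2 u2 \<sigma>3" by blast
    have "s2 * (K2 * Suc (b1 L + tc L + D2 * s2)) \<le> t2 L"
      unfolding t2_def using s2 by (intro mult_le_mono add_mono Suc_le_mono[THEN iffD2]) simp_all
    with u2(1) have "u2 \<le> t2 L" by simp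
    then have "u1 + (t + u2) \<le> a' * L ^ k' + a'"
      using u1_le t_le poly[of L] by linarith
    moreover have "exec ?c (input_memory (encode_tcsd I)) (u1 + (t + u2)) \<sigma>3"
      by (rule exec.Seq[OF u1(2) exec.Seq[OF \<sigma>2(1) u2(2)]])
    ultimately show ?thesis
      using \<sigma>3(3) unfolding L_def by blast
  qed
  then show ?thesis
    unfolding solves_in_poly_time_def by blast
qed

end
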